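(* Let $A$ and $B$ be arbitrary abelian groups. The cartesian wreath product $A \operatorname{Wr} B$ (or, equally, the direct wreath product $A \operatorname{wr} B$) generates the product variety $\operatorname{var}(A)\cdot\operatorname{var}(B)$ if and only if one of the following holds: (1) at least one of the groups $A$ and $B$ is not of finite exponent; or (2) $A$ and $B$ are of finite exponents $m$ and $n$ respectively, and for each prime $p$ dividing both $m$ and $n$ the factor group $B[p^k]/B[p^{k-1}]$ is infinite, where $p^k$ is the highest power of $p$ dividing $n$.
   Context: For groups $A,B$: the cartesian wreath product $A\operatorname{Wr}B$ is the semidirect product of the group $A^B$ of all functions $B\to A$ (pointwise operations) by $B$ acting by translation of arguments; the direct wreath product $A\operatorname{wr}B$ is the analogous group built from the subgroup $A^{(B)}$ of finitely supported functions. $\operatorname{var}(G)$ is the variety of groups generated by $G$. The product $\mathfrak U\cdot\mathfrak V$ of varieties is the variety of all groups $G$ having a normal subgroup $N\in\mathfrak U$ with $G/N\in\mathfrak V$. For an abelian group $B$ and a positive integer $s$, $B[s]=\langle b\in B \mid b^s=1\rangle$ (group operation written multiplicatively here). *)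

theory Defs
  imports
    "HOL-Algebra.Product_Groups"
    "HOL-Algebra.Generated_Groups"
    "HOL-Computational_Algebra.Primes"
begin

section \<open>Varieties of groups\<close>

text \<open>
  A group word in the variables $x_0, x_1, \ldots$ is a list of letters: \<open>(i, True)\<close> stands
  for $x_i$ and \<open>(i, False)\<close> for $x_i^{-1}$.  Words need not be reduced.
\<close>

type_synonym group_word = "(nat \<times> bool) list"

primrec eval_word :: "'g monoid \<Rightarrow> (nat \<Rightarrow> 'g) \<Rightarrow> group_word \<Rightarrow> 'g" where
  "eval_word G \<sigma> [] = \<one>\<^bsub>G\<^esub>"
| "eval_word G \<sigma> (l # w) =
     (if snd l then \<sigma> (fst l) else inv\<^bsub>G\<^esub> (\<sigma> (fst l))) \<otimes>\<^bsub>G\<^esub> eval_word G \<sigma> w"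

definition satisfies_law :: "'g monoid \<Rightarrow> group_word \<Rightarrow> bool" where
  "satisfies_law G w \<longleftrightarrow> (\<forall>\<sigma> \<in> UNIV \<rightarrow> carrier G. eval_word G \<sigma> w = \<one>\<^bsub>G\<^esub>)"

text \<open>
  A variety is the class of all groups satisfying a given set of laws.  In HOL a class of groups
  meets each type \<open>'h\<close> in a set of type \<open>'h monoid set\<close>; the set of laws is what ties these
  sets together across types, and \<open>variety U\<close> is therefore polymorphic in \<open>'h\<close>.  A variety is
  determined by its countable members, so any infinite \<open>'h\<close> suffices to tell varieties apart;
  a finite \<open>'h\<close> does not.
\<close>

definition variety :: "group_word set \<Rightarrow> 'h monoid set" where
  "variety U = {H. group H \<and> (\<forall>w\<in>U. satisfies_law H w)}"

text \<open>
  The smallest variety containing \<open>G\<close>.  The occurrence of \<^const>\<open>variety\<close> in the index set is at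
  the type of \<open>G\<close>, the other one at the type of the members.
\<close>

definition generated_variety :: "'g monoid \<Rightarrow> 'h monoid set" where
  "generated_variety G = (\<Inter>U\<in>{U. G \<in> variety U}. variety U)"

lemma generated_variety_iff_laws:
  assumes "group G"
  shows "H \<in> generated_variety G \<longleftrightarrow>
    group H \<and> (\<forall>w. satisfies_law G w \<longrightarrow> satisfies_law H w)"
proof
  assume H: "H \<in> generated_variety G"
  have "G \<in> variety {w. satisfies_law G w}"
    using assms by (simp add: variety_def)
  with H have "H \<in> variety {w. satisfies_law G w}"
    unfolding generated_variety_def by blast
  then show "group H \<and> (\<forall>w. satisfies_law G w \<longrightarrow> satisfies_law H w)"
    by (simp add: variety_def)
next
  assume "group H \<and> (\<forall>w. satisfies_law G w \<longrightarrow> satisfies_law H w)"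
  then show "H \<in> generated_variety G"
    by (auto simp: generated_variety_def variety_def)
qed

text \<open>
  The second factor is given at type \<open>'h set\<close> because the elements of the quotient \<open>H Mod N\<close>
  are cosets.
\<close>

definition product_variety :: "'h monoid set \<Rightarrow> 'h set monoid set \<Rightarrow> 'h monoid set" where
  "product_variety \<U> \<V> =
     {H. group H \<and> (\<exists>N. N \<lhd> H \<and> H\<lparr>carrier := N\<rparr> \<in> \<U> \<and> H Mod N \<in> \<V>)}"

section \<open>Wreath products\<close>

definition semidirect_product ::
    "'n monoid \<Rightarrow> 'b monoid \<Rightarrow> ('b \<Rightarrow> 'n \<Rightarrow> 'n) \<Rightarrow> ('n \<times> 'b) monoid" where
  "semidirect_product N B act =
     \<lparr>carrier = carrier N \<times> carrier B,
      monoid.mult = (\<lambda>(f, b) (g, c). (f \<otimes>\<^bsub>N\<^esub> act b g, b \<otimes>\<^bsub>B\<^esub> c)),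
      one = (\<one>\<^bsub>N\<^esub>, \<one>\<^bsub>B\<^esub>)\<rparr>"

text \<open>The left action of \<open>B\<close> on functions \<open>B \<rightarrow> A\<close>, which are extensional on the carrier of \<open>B\<close>.\<close>

definition translate :: "'b monoid \<Rightarrow> 'b \<Rightarrow> ('b \<Rightarrow> 'a) \<Rightarrow> 'b \<Rightarrow> 'a" where
  "translate B b f = (\<lambda>x\<in>carrier B. f (inv\<^bsub>B\<^esub> b \<otimes>\<^bsub>B\<^esub> x))"

definition cartesian_wreath :: "'a monoid \<Rightarrow> 'b monoid \<Rightarrow> (('b \<Rightarrow> 'a) \<times> 'b) monoid" where
  "cartesian_wreath A B =
     semidirect_product (product_group (carrier B) (\<lambda>_. A)) B (translate B)"

definition direct_wreath :: "'a monoid \<Rightarrow> 'b monoid \<Rightarrow> (('b \<Rightarrow> 'a) \<times> 'b) monoid" where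
  "direct_wreath A B =
     semidirect_product (sum_group (carrier B) (\<lambda>_. A)) B (translate B)"

section \<open>Exponents and torsion\<close>

definition finite_exponent :: "'g monoid \<Rightarrow> bool" where
  "finite_exponent G \<longleftrightarrow> (\<exists>n::nat. n > 0 \<and> (\<forall>x\<in>carrier G. x [^]\<^bsub>G\<^esub> n = \<one>\<^bsub>G\<^esub>))"

text \<open>Meaningful only if \<open>finite_exponent G\<close> holds.\<close>

definition group_exponent :: "'g monoid \<Rightarrow> nat" where
  "group_exponent G = (LEAST n::nat. n > 0 \<and> (\<forall>x\<in>carrier G. x [^]\<^bsub>G\<^esub> n = \<one>\<^bsub>G\<^esub>))"

definition torsion_part :: "'b monoid \<Rightarrow> nat \<Rightarrow> 'b set" where
  "torsion_part B s = generate B {b \<in> carrier B. b [^]\<^bsub>B\<^esub> s = \<one>\<^bsub>B\<^esub>}"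

definition torsion_factor :: "'b monoid \<Rightarrow> nat \<Rightarrow> nat \<Rightarrow> 'b set monoid" where
  "torsion_factor B s t = B\<lparr>carrier := torsion_part B s\<rparr> Mod torsion_part B t"

end

(*
  The Fox derivatives of a word w decide its fate. Evaluating w in a wreath product at functions
  supported at 1 shows that w is a law of A Wr B (or A wr B) only if, for all values of the
  variables in B, the coefficients of the Fox derivatives of w, collected by their value in B, are
  divisible by the exponent m of A. Conversely, the Kaloujnine-Krasner cocycle shows that w holds
  in all extensions of abelian groups of exponent m by abelian groups of exponent n as soon as m
  divides the coefficients collected by exponent vector modulo n. The two conditions agree when
  B has enough elements. If B is not of finite exponent, exponent vectors are separated by
  powers of one element of large order. Otherwise m is treated one prime power at a time:
  independent elements of order p^k, which exist because B[p^k]/B[p^(k-1)] is infinite, separate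
  vectors modulo p^k, and Fourier inversion on (Z/n')^r, with n' prime to p, does the rest.

  If B[p^k]/B[p^(k-1)] is finite, then so is the set of the powers b^(n/p), and iterated
  commutators of [z, z']^(m/p) with many powers y_i^(n/p) are trivial in A Wr B: some power d
  occurs p times among them, and d acts so that (1 - d)^p = 1 - d^p = 0 modulo p. The same word
  is not a law of the wreath product of Z/m by a large power of Z/n.
*)
theory Submission
  imports
    Complex_Main
    Defs
    "HOL-Algebra.Weak_Morphisms"
    "Jordan_Normal_Form.Char_Poly"
begin

section \<open>Sums over fibres of linear forms modulo \<open>N\<close>\<close>

text \<open>The obstacle is that \<open>B\<close> may have too few independent elements to realise
  (Z/n)^r. For a prime p dividing both exponents the condition supplies independent elements in the
  p-part only; from the rest of \<open>B\<close> one can count on no more than a single element of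
  order n'. Such an element shows residues modulo n' of linear forms in the exponent vector, never
  the vector itself. Recovering the vector costs a power of n' as denominator, which is harmless
  modulo a power of p. This is why m is split into prime powers. For m = 0 every denominator is
  harmless.

  Infinite exponent is encoded as 0: divisibility by 0 is vanishing and congruence modulo 0 is
  equality, so the same statements serve all cases.

  In the negative direction, the product variety depends on m and n alone, so \<open>B\<close> can
  be traded for a power of Z/n with enough independent elements. The witness is then a finite group,
  which has a copy on every infinite type.\<close>

lemma algebraic_int_root_of_unity_sum:
  fixes \<zeta> :: complex and c :: "nat \<Rightarrow> int"
  assumes "N > 0" and \<zeta>: "\<zeta> ^ N = 1"
  shows "algebraic_int (\<Sum>j<N. of_int (c j) * \<zeta> ^ j)"
proof -
  define y where "y = (\<Sum>j<N. of_int (c j) * \<zeta> ^ j)"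
  \<comment> \<open>A circulant integer matrix: row \<open>i\<close> lists the coefficients of
    \<open>y * \<zeta> ^ i\<close>, so the powers of \<open>\<zeta>\<close> form an eigenvector for
    \<open>y\<close>, which is thus a root of a monic integer polynomial. The index is k - i modulo
    \<open>N\<close>, with \<open>N - i\<close> to stay within the naturals.\<close>
  define C where "C = mat N N (\<lambda>(i, k). c ((k + (N - i)) mod N))"
  let ?h = "of_int :: int \<Rightarrow> complex"
  let ?C = "map_mat ?h C"
  define v where "v = vec N (\<lambda>i. \<zeta> ^ i)"
  have C: "C \<in> carrier_mat N N" by (simp add: C_def)
  hence C': "?C \<in> carrier_mat N N" by simp
  have \<zeta>mod: "\<zeta> ^ (k mod N) = \<zeta> ^ k" for k
  proof -
    have "\<zeta> ^ k = \<zeta> ^ (N * (k div N) + k mod N)" by simp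
    also have "\<dots> = \<zeta> ^ (k mod N)" by (simp only: power_add power_mult \<zeta>) simp
    finally show ?thesis by simp
  qed
  have row: "(\<Sum>k<N. ?h (c ((k + (N - i)) mod N)) * \<zeta> ^ k) = y * \<zeta> ^ i" if "i < N" for i
  proof -
    have "y * \<zeta> ^ i = (\<Sum>j<N. ?h (c j) * \<zeta> ^ ((j + i) mod N))"
      by (simp add: y_def sum_distrib_right power_add mult.assoc \<zeta>mod)
    also have "\<dots> = (\<Sum>k<N. ?h (c ((k + (N - i)) mod N)) * \<zeta> ^ k)"
    proof (rule sum.reindex_bij_witness[of _ "\<lambda>k. (k + (N - i)) mod N" "\<lambda>j. (j + i) mod N"])
      fix j assume j: "j \<in> {..<N}"
      have "((j + i) mod N + (N - i)) mod N = (j + i + (N - i)) mod N"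
        by (simp add: mod_add_left_eq)
      also have "j + i + (N - i) = j + N" using that by simp
      finally show *: "((j + i) mod N + (N - i)) mod N = j" using j by simp
      show "?h (c (((j + i) mod N + (N - i)) mod N)) * \<zeta> ^ ((j + i) mod N) = ?h (c j) * \<zeta> ^ ((j + i) mod N)"
        by (simp add: *)
    next
      fix k assume k: "k \<in> {..<N}"
      have "((k + (N - i)) mod N + i) mod N = (k + (N - i) + i) mod N"
        by (simp add: mod_add_left_eq)
      also have "k + (N - i) + i = k + N" using that by simp
      finally show "((k + (N - i)) mod N + i) mod N = k" using k by simp
    qed (use assms in auto)
    finally show ?thesis by simp
  qed
  have "?C *\<^sub>v v = y \<cdot>\<^sub>v v"
    by (rule eq_vecI) (auto simp: C_def v_def scalar_prod_def row[symmetric] lessThan_atLeast0)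
  moreover have "v \<noteq> 0\<^sub>v N"
  proof
    assume "v = 0\<^sub>v N"
    hence "v $ 0 = 0" using assms by simp
    thus False using assms by (simp add: v_def)
  qed
  ultimately have "eigenvalue ?C y"
    using C' unfolding eigenvalue_def eigenvector_def by (intro exI[of _ v]) (simp add: v_def)
  hence "poly (char_poly ?C) y = 0" using eigenvalue_root_char_poly[OF C'] by simp
  hence "poly (map_poly ?h (char_poly C)) y = 0" by (simp add: of_int_hom.char_poly_hom[OF C])
  moreover have "lead_coeff (char_poly C) = 1" using degree_monic_char_poly[OF C] by simp
  ultimately show ?thesis unfolding y_def[symmetric] algebraic_int_altdef_ipoly by blast
qed

lemma root_of_unity_orthogonality:
  fixes d :: int
  assumes "N > 0"
  defines "\<zeta> \<equiv> cis (2 * pi / N)"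
  shows "(\<Sum>a<N. \<zeta> powi (int a * d)) = (if int N dvd d then of_nat N else 0)"
proof -
  have \<zeta>: "\<zeta> \<noteq> 0" by (simp add: \<zeta>_def)
  have e: "\<zeta> powi (int a * d) = (\<zeta> powi d) ^ a" for a
    by (metis mult.commute power_int_mult power_int_of_nat)
  have \<zeta>N: "\<zeta> ^ N = 1" using assms by (simp add: Complex.DeMoivre)
  have one: "\<zeta> powi d = 1 \<longleftrightarrow> int N dvd d"
  proof
    assume "int N dvd d"
    then obtain k where "d = int N * k" by blast
    thus "\<zeta> powi d = 1" using \<zeta>N by (simp add: power_int_mult)
  next
    assume 1: "\<zeta> powi d = 1"
    have "\<zeta> powi d = cis (2 * pi / N * d)" by (simp add: \<zeta>_def cis_power_int mult.commute)
    hence "cis (2 * pi / N * d) = 1" using 1 by simp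
    hence "cos (2 * pi / N * d) = 1" by (metis cis.sel(1) one_complex.sel(1))
    then obtain k :: int where "2 * pi / N * d = real_of_int k * 2 * pi"
      unfolding cos_one_2pi_int by blast
    hence "real_of_int d = real_of_int (int N * k)" using assms by (simp add: field_simps)
    hence "d = int N * k" by linarith
    thus "int N dvd d" by simp
  qed
  show ?thesis
  proof (cases "int N dvd d")
    case True
    hence "(\<zeta> powi d) ^ a = 1" for a using one by simp
    thus ?thesis using True by (simp add: e)
  next
    case False
    have "(\<zeta> powi d) ^ N = (\<zeta> ^ N) powi d"
      by (metis mult.commute power_int_mult power_int_of_nat)
    hence "(\<zeta> powi d) ^ N = 1" by (simp add: \<zeta>N)
    hence "(\<Sum>a<N. (\<zeta> powi d) ^ a) = 0"
      using False by (simp add: one geometric_sum)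
    thus ?thesis using False by (simp add: e)
  qed
qed

text \<open>Fourier inversion on \<open>(\<int>/N)\<^sup>2\<close>. The values of the transform lie in
  \<open>M \<int>[\<zeta>]\<close>, and rational algebraic integers are integers.\<close>

lemma dvd_fibre_sum_two:
  fixes s x y :: "'t \<Rightarrow> int" and M :: int
  assumes T: "finite T" and N: "N > 0" and MN: "M = 0 \<or> coprime M (int N)"
    and H: "\<And>a b j. M dvd (\<Sum>t | t \<in> T \<and> int N dvd a * x t + b * y t - j. s t)"
  shows "M dvd (\<Sum>t | t \<in> T \<and> int N dvd x t - x0 \<and> int N dvd y t - y0. s t)"
proof -
  define \<zeta> where "\<zeta> = cis (2 * pi / N)"
  have \<zeta>0: "\<zeta> \<noteq> 0" by (simp add: \<zeta>_def)
  have \<zeta>N: "\<zeta> ^ N = 1" using N by (simp add: \<zeta>_def Complex.DeMoivre)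
  define F where "F = (\<Sum>t | t \<in> T \<and> int N dvd x t - x0 \<and> int N dvd y t - y0. s t)"
  define g where "g a b t = int a * (x t - x0) + int b * (y t - y0)" for a b t
  \<comment> \<open>The division by \<open>M\<close> is exact by \<open>H\<close>; for
    \<open>M = 0\<close> the fibre sums vanish and so do these quotients.\<close>
  define c where "c a b j = (\<Sum>t | t \<in> T \<and> nat (g a b t mod int N) = j. s t) div M" for a b j
  have c: "(\<Sum>t | t \<in> T \<and> nat (g a b t mod int N) = j. s t) = M * c a b j" if "j < N" for a b j
  proof -
    have "nat (g a b t mod int N) = j \<longleftrightarrow> int N dvd int a * x t + int b * y t - (int j + int a * x0 + int b * y0)" for t
    proof -
      have "nat (g a b t mod int N) = j \<longleftrightarrow> g a b t mod int N = int j mod int N"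
        using that N by (auto simp: nat_eq_iff)
      also have "\<dots> \<longleftrightarrow> int N dvd g a b t - int j" by (simp add: mod_eq_dvd_iff)
      also have "g a b t - int j = int a * x t + int b * y t - (int j + int a * x0 + int b * y0)"
        by (simp add: g_def algebra_simps)
      finally show ?thesis .
    qed
    thus ?thesis using H[of "int a" "int b" "int j + int a * x0 + int b * y0"] by (simp add: c_def)
  qed
  have powi_mod: "\<zeta> powi k = \<zeta> ^ nat (k mod int N)" for k
  proof -
    have "\<zeta> powi k = \<zeta> powi (int N * (k div int N) + k mod int N)" by simp
    also have "\<dots> = \<zeta> powi (k mod int N)"
      using \<zeta>0 by (subst power_int_add) (simp_all add: power_int_mult \<zeta>N)
    also have "\<dots> = \<zeta> ^ nat (k mod int N)" using N by (simp add: power_int_def)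
    finally show ?thesis .
  qed
  \<comment> \<open>The Fourier coefficient at \<open>(a, b)\<close>, grouped by the residue of its
    exponent, which exhibits the factor \<open>M\<close>.\<close>
  have inner: "(\<Sum>t\<in>T. of_int (s t) * \<zeta> powi g a b t) = of_int M * (\<Sum>j<N. of_int (c a b j) * \<zeta> ^ j)" for a b
  proof -
    have "(\<Sum>t\<in>T. of_int (s t) * \<zeta> powi g a b t)
      = (\<Sum>j<N. \<Sum>t | t \<in> T \<and> nat (g a b t mod int N) = j. of_int (s t) * \<zeta> powi g a b t)"
      by (rule sum.group[symmetric]) (use T N in \<open>auto simp: nat_less_iff\<close>)
    also have "\<dots> = (\<Sum>j<N. (\<Sum>t | t \<in> T \<and> nat (g a b t mod int N) = j. of_int (s t)) * \<zeta> ^ j)"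
      by (intro sum.cong refl) (simp add: sum_distrib_right powi_mod)
    also have "\<dots> = (\<Sum>j<N. of_int (M * c a b j) * \<zeta> ^ j)"
      by (intro sum.cong refl) (simp flip: of_int_sum add: c)
    finally show ?thesis by (simp add: sum_distrib_left mult.assoc)
  qed
  define P where "P = (\<Sum>j<N. of_int (\<Sum>a<N. \<Sum>b<N. c a b j) * \<zeta> ^ j)"
  have P: "P = (\<Sum>a<N. \<Sum>b<N. \<Sum>j<N. of_int (c a b j) * \<zeta> ^ j)"
    unfolding P_def by (simp add: sum_distrib_right)
      (subst sum.swap, rule sum.cong[OF refl], subst sum.swap, simp)
  have "of_int F = (\<Sum>t\<in>T. if int N dvd x t - x0 \<and> int N dvd y t - y0 then of_int (s t) else 0 :: complex)"
    unfolding F_def of_int_sum by (rule sum.inter_filter[OF T])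
  hence "of_nat (N * N) * of_int F = (\<Sum>t\<in>T. of_nat (N * N) * (if int N dvd x t - x0 \<and> int N dvd y t - y0 then of_int (s t) else 0 :: complex))"
    by (simp only: sum_distrib_left)
  also have "\<dots> = (\<Sum>t\<in>T. of_int (s t) * ((\<Sum>a<N. \<zeta> powi (int a * (x t - x0))) * (\<Sum>b<N. \<zeta> powi (int b * (y t - y0)))))"
    unfolding \<zeta>_def root_of_unity_orthogonality[OF N] by (intro sum.cong refl) simp
  also have "\<dots> = (\<Sum>t\<in>T. \<Sum>a<N. \<Sum>b<N. of_int (s t) * \<zeta> powi g a b t)"
    using \<zeta>0 by (simp only: sum_product, simp only: sum_distrib_left, simp add: g_def power_int_add)
  also have "\<dots> = (\<Sum>a<N. \<Sum>b<N. \<Sum>t\<in>T. of_int (s t) * \<zeta> powi g a b t)"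
    by (subst sum.swap, rule sum.cong[OF refl], subst sum.swap, simp)
  also have "\<dots> = of_int M * P" by (simp add: inner P sum_distrib_left)
  finally have eq: "of_nat (N * N) * of_int F = of_int M * P" .
  show ?thesis
  \<comment> \<open>For \<open>M = 0\<close> nothing has to be cancelled modulo \<open>M\<close>:
    \<open>N * N * F = 0\<close> in characteristic 0. Otherwise both factors \<open>N\<close> are
    removed by coprimality.\<close>
  proof (cases "M = 0")
    case True
    hence "F = 0" using eq N by simp
    thus ?thesis by (simp add: F_def)
  next
    case False
    have "algebraic_int P" unfolding P_def using N \<zeta>N by (rule algebraic_int_root_of_unity_sum)
    moreover have "P = of_nat (N * N) * of_int F / of_int M" using eq False by (simp add: field_simps)
    hence "P \<in> \<rat>" by simp
    ultimately have "P \<in> \<int>" by (rule rational_algebraic_int_is_int)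
    then obtain k where "P = of_int k" by (auto elim: Ints_cases)
    hence "(of_int (int (N * N) * F) :: complex) = of_int (M * k)" using eq by simp
    hence "int N * (int N * F) = M * k" by (simp only: of_int_eq_iff) simp
    hence "M dvd int N * (int N * F)" by simp
    hence "M dvd F" using MN False by (simp add: coprime_dvd_mult_right_iff)
    thus ?thesis by (simp add: F_def)
  qed
qed

text \<open>Coordinates are split off one at a time. A linear form in the first \<open>r\<close>
  coordinates and the last coordinate act as \<open>x\<close> and \<open>y\<close> above: each
  combination of the two is again a linear form, and the outcome is the hypothesis for the subset of
  \<open>T\<close> with prescribed last coordinate.\<close>

lemma dvd_fibre_sum:
  fixes s :: "'t \<Rightarrow> int" and v :: "'t \<Rightarrow> nat \<Rightarrow> int" and M :: int
  assumes "finite T" and N: "N > 0" and MN: "M = 0 \<or> coprime M (int N)"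
    and "\<And>a j. M dvd (\<Sum>t | t \<in> T \<and> int N dvd (\<Sum>i<r. a i * v t i) - j. s t)"
  shows "M dvd (\<Sum>t | t \<in> T \<and> (\<forall>i<r. int N dvd v t i - u i). s t)"
  using assms(1,4)
proof (induction r arbitrary: T)
  case 0
  from "0.prems"(2)[of undefined 0] show ?case by simp
next
  case (Suc r)
  let ?T = "{t \<in> T. int N dvd v t r - u r}"
  have "M dvd (\<Sum>t | t \<in> ?T \<and> int N dvd (\<Sum>i<r. a i * v t i) - j. s t)" for a j
  proof -
    have "M dvd (\<Sum>t | t \<in> T \<and> int N dvd (\<Sum>i<r. a i * v t i) - j \<and> int N dvd v t r - u r. s t)"
    proof (rule dvd_fibre_sum_two[OF Suc.prems(1) N MN])
      fix \<alpha> \<beta> l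
      have "(\<Sum>i<Suc r. (if i < r then \<alpha> * a i else \<beta>) * v t i) = \<alpha> * (\<Sum>i<r. a i * v t i) + \<beta> * v t r" for t
        by (simp add: sum_distrib_left mult.assoc)
      thus "M dvd (\<Sum>t | t \<in> T \<and> int N dvd \<alpha> * (\<Sum>i<r. a i * v t i) + \<beta> * v t r - l. s t)"
        using Suc.prems(2)[of "\<lambda>i. if i < r then \<alpha> * a i else \<beta>" l] by simp
    qed
    moreover have "{t. t \<in> ?T \<and> int N dvd (\<Sum>i<r. a i * v t i) - j} = {t. t \<in> T \<and> int N dvd (\<Sum>i<r. a i * v t i) - j \<and> int N dvd v t r - u r}"
      by auto
    ultimately show ?thesis by simp
  qed
  from Suc.IH[OF _ this] Suc.prems(1)
  have "M dvd (\<Sum>t | t \<in> ?T \<and> (\<forall>i<r. int N dvd v t i - u i). s t)" by simp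
  moreover have "{t. t \<in> ?T \<and> (\<forall>i<r. int N dvd v t i - u i)} = {t. t \<in> T \<and> (\<forall>i<Suc r. int N dvd v t i - u i)}"
    by (auto simp: less_Suc_eq)
  ultimately show ?case by simp
qed

section \<open>Words, exponent vectors and exponents\<close>

definition winv :: "group_word \<Rightarrow> group_word" where
  "winv w = rev (map (\<lambda>(i, s). (i, \<not> s)) w)"

definition wsubst :: "group_word \<Rightarrow> (nat \<Rightarrow> group_word) \<Rightarrow> group_word" where
  "wsubst w ws = concat (map (\<lambda>(i, s). if s then ws i else winv (ws i)) w)"

definition wrename :: "(nat \<Rightarrow> nat) \<Rightarrow> group_word \<Rightarrow> group_word" where
  "wrename f w = map (\<lambda>(i, s). (f i, s)) w"

definition wpow :: "group_word \<Rightarrow> nat \<Rightarrow> group_word" where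
  "wpow w n = concat (replicate n w)"

definition wcomm :: "group_word \<Rightarrow> group_word \<Rightarrow> group_word" where
  "wcomm u v = u @ v @ winv u @ winv v"

text \<open>\<open>eval_word\<close> takes a record of type \<open>'g monoid\<close>, whereas
  \<open>group\<close> fixes an arbitrary record extension; these locales only restrict the
  type.\<close>

locale unextended_group = group G for G :: "'g monoid" (structure)

locale unextended_comm_group = comm_group G for G :: "'g monoid" (structure)

sublocale unextended_comm_group \<subseteq> unextended_group ..

context unextended_group
begin

lemma eval_word_closed [simp]: "\<sigma> \<in> UNIV \<rightarrow> carrier G \<Longrightarrow> eval_word G \<sigma> w \<in> carrier G"
  by (induction w) (auto simp: Pi_iff)

lemma eval_word_append:
  "\<sigma> \<in> UNIV \<rightarrow> carrier G \<Longrightarrow> eval_word G \<sigma> (u @ v) = eval_word G \<sigma> u \<otimes> eval_word G \<sigma> v"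
  by (induction u) (auto simp: Pi_iff m_assoc)

lemma eval_winv:
  assumes "\<sigma> \<in> UNIV \<rightarrow> carrier G"
  shows "eval_word G \<sigma> (winv w) = inv (eval_word G \<sigma> w)"
proof (induction w)
  case (Cons l w)
  have "eval_word G \<sigma> (winv (l # w)) = eval_word G \<sigma> (winv w) \<otimes> eval_word G \<sigma> [(fst l, \<not> snd l)]"
    using assms by (simp add: winv_def eval_word_append split: prod.splits)
  thus ?case using assms Cons by (auto simp: inv_mult_group Pi_iff)
qed (simp add: winv_def)

lemma eval_wsubst:
  assumes "\<sigma> \<in> UNIV \<rightarrow> carrier G"
  shows "eval_word G \<sigma> (wsubst w ws) = eval_word G (\<lambda>i. eval_word G \<sigma> (ws i)) w"
  using assms by (induction w) (auto simp: wsubst_def eval_word_append eval_winv)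

lemma eval_wrename:
  "eval_word G \<sigma> (wrename f w) = eval_word G (\<sigma> \<circ> f) w"
  by (induction w) (auto simp: wrename_def)

lemma eval_wpow:
  assumes "\<sigma> \<in> UNIV \<rightarrow> carrier G"
  shows "eval_word G \<sigma> (wpow w n) = eval_word G \<sigma> w [^] n"
proof (induction n)
  case (Suc n)
  have "eval_word G \<sigma> (wpow w (Suc n)) = eval_word G \<sigma> w \<otimes> eval_word G \<sigma> w [^] n"
    using assms Suc by (simp add: wpow_def eval_word_append)
  also have "\<dots> = eval_word G \<sigma> w [^] Suc n"
    using assms by (metis eval_word_closed nat_pow_Suc2)
  finally show ?case .
qed (simp add: wpow_def)

lemma eval_wcomm:
  assumes "\<sigma> \<in> UNIV \<rightarrow> carrier G"
  shows "eval_word G \<sigma> (wcomm u v) = eval_word G \<sigma> u \<otimes> eval_word G \<sigma> v \<otimes>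
    inv (eval_word G \<sigma> u) \<otimes> inv (eval_word G \<sigma> v)"
  using assms by (simp add: wcomm_def eval_word_append eval_winv m_assoc)

lemma eval_word_hom:
  assumes "h \<in> hom G H" "group H" "\<sigma> \<in> UNIV \<rightarrow> carrier G"
  shows "eval_word H (h \<circ> \<sigma>) w = h (eval_word G \<sigma> w)"
proof -
  interpret H: group_hom G H h using assms by (simp add: group_hom_def group_hom_axioms_def is_group)
  show ?thesis using assms(3) by (induction w) (auto simp: Pi_iff H.hom_mult)
qed

lemma eval_word_subgroup:
  assumes "subgroup K G" "\<sigma> \<in> UNIV \<rightarrow> K"
  shows "eval_word (G\<lparr>carrier := K\<rparr>) \<sigma> w = eval_word G \<sigma> w"
  using assms by (induction w) (auto simp: Pi_iff m_inv_consistent)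

lemma eval_word_single:
  assumes "a \<in> carrier G"
  shows "eval_word G (\<lambda>j. if j = i then a else \<one>) w =
    a [^] sum_list (map (\<lambda>(j, s). if j = i then (if s then 1 else - 1) else 0 :: int) w)"
proof (induction w)
  case (Cons l w)
  define e where "e = sum_list (map (\<lambda>(j, s). if j = i then (if s then 1 else - 1) else 0 :: int) w)"
  have "a [^] (1 + e) = a \<otimes> a [^] e" "a [^] (- 1 + e) = inv a \<otimes> a [^] e"
    using assms by (simp_all only: int_pow_mult int_pow_neg) simp_all
  thus ?case using Cons assms by (cases l) (auto simp: e_def[symmetric])
qed simp

end

text \<open>The exponent vector, that is, the image of a word in the free abelian group.\<close>

definition wexp :: "group_word \<Rightarrow> nat \<Rightarrow> int" where
  "wexp w i = sum_list (map (\<lambda>(j, s). if j = i then (if s then 1 else - 1) else 0) w)"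

lemma wexp_Nil [simp]: "wexp [] i = 0"
  and wexp_Cons [simp]: "wexp (l # w) i = (if fst l = i then (if snd l then 1 else - 1) else 0) + wexp w i"
  by (auto simp: wexp_def split: prod.splits)

text \<open>In an abelian group, the common value at \<open>b\<close> of all words in the first
  \<open>r\<close> variables with exponent vector \<open>v\<close>.\<close>

primrec vpow :: "('g, 'm) monoid_scheme \<Rightarrow> (nat \<Rightarrow> 'g) \<Rightarrow> (nat \<Rightarrow> int) \<Rightarrow> nat \<Rightarrow> 'g" where
  "vpow G b v 0 = \<one>\<^bsub>G\<^esub>"
| "vpow G b v (Suc r) = vpow G b v r \<otimes>\<^bsub>G\<^esub> b r [^]\<^bsub>G\<^esub> v r"

context comm_group
begin

lemma vpow_closed [simp]: "b \<in> {..<r} \<rightarrow> carrier G \<Longrightarrow> vpow G b v r \<in> carrier G"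
  by (induction r) (auto simp: Pi_iff)

lemma vpow_add:
  assumes "b \<in> {..<r} \<rightarrow> carrier G"
  shows "vpow G b (\<lambda>i. u i + v i) r = vpow G b u r \<otimes> vpow G b v r"
  using assms
proof (induction r)
  case (Suc r)
  hence b: "b r \<in> carrier G" "b \<in> {..<r} \<rightarrow> carrier G" by auto
  show ?case using b Suc.IH[OF b(2)] by (simp add: int_pow_mult m_ac)
qed simp

lemma vpow_neg:
  assumes "b \<in> {..<r} \<rightarrow> carrier G"
  shows "vpow G b (\<lambda>i. - v i) r = inv (vpow G b v r)"
  using assms
proof (induction r)
  case (Suc r)
  hence b: "b r \<in> carrier G" "b \<in> {..<r} \<rightarrow> carrier G" by auto
  show ?case using b Suc.IH[OF b(2)] by (simp add: int_pow_neg inv_mult)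
qed simp

lemma vpow_diff:
  assumes "b \<in> {..<r} \<rightarrow> carrier G"
  shows "vpow G b (\<lambda>i. u i - v i) r = vpow G b u r \<otimes> inv (vpow G b v r)"
  using vpow_add[OF assms, of u "\<lambda>i. - v i"] vpow_neg[OF assms] by simp

lemma vpow_eq_iff:
  assumes "b \<in> {..<r} \<rightarrow> carrier G"
  shows "vpow G b u r = vpow G b v r \<longleftrightarrow> vpow G b (\<lambda>i. u i - v i) r = \<one>"
  unfolding vpow_diff[OF assms] using assms
  by (metis inv_equality inv_inv r_inv vpow_closed inv_closed)

lemma vpow_mult_base:
  assumes "b \<in> {..<r} \<rightarrow> carrier G" "c \<in> {..<r} \<rightarrow> carrier G"
  shows "vpow G (\<lambda>i. b i \<otimes> c i) v r = vpow G b v r \<otimes> vpow G c v r"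
  using assms
proof (induction r)
  case (Suc r)
  hence "b r \<in> carrier G" "b \<in> {..<r} \<rightarrow> carrier G" "c r \<in> carrier G" "c \<in> {..<r} \<rightarrow> carrier G" by auto
  with Suc.IH show ?case by (simp add: int_pow_distrib m_ac)
qed simp

lemma vpow_powers:
  assumes "x \<in> carrier G"
  shows "vpow G (\<lambda>i. x [^] (e i :: int)) v r = x [^] (\<Sum>i<r. e i * v i)"
  using assms by (induction r) (auto simp: int_pow_mult int_pow_pow)

lemma vpow_int_pow:
  assumes "b \<in> {..<r} \<rightarrow> carrier G"
  shows "vpow G b v r [^] (k::int) = vpow G b (\<lambda>i. v i * k) r"
  using assms
proof (induction r)
  case (Suc r)
  hence "b r \<in> carrier G" "b \<in> {..<r} \<rightarrow> carrier G" by auto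
  with Suc.IH show ?case by (simp add: int_pow_distrib int_pow_pow)
qed simp

lemma vpow_eq_one:
  assumes "\<And>i. i < r \<Longrightarrow> b i [^] v i = \<one>"
  shows "vpow G b v r = \<one>"
  using assms by (induction r) auto

lemma vpow_single:
  assumes "b \<in> {..<r} \<rightarrow> carrier G"
  shows "vpow G b (\<lambda>i. if i = j then k else 0) r = (if j < r then b j [^] k else \<one>)"
  using assms
proof (induction r)
  case (Suc r)
  hence "b r \<in> carrier G" "b \<in> {..<r} \<rightarrow> carrier G" by auto
  with Suc.IH show ?case by (cases j r rule: linorder_cases) (auto simp: less_Suc_eq Pi_iff)
qed simp

end

lemma (in unextended_comm_group) eval_word_eq_vpow:
  assumes b: "b \<in> UNIV \<rightarrow> carrier G" and "fst ` set w \<subseteq> {..<r}"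
  shows "eval_word G b w = vpow G b (wexp w) r"
  using assms(2)
proof (induction w)
  case Nil
  show ?case by (simp add: vpow_eq_one)
next
  case (Cons l w)
  have b': "b \<in> {..<r} \<rightarrow> carrier G" using b by auto
  have bi: "b (fst l) \<in> carrier G" using b by auto
  let ?e = "if snd l then 1 else - 1 :: int"
  have "(if snd l then b (fst l) else inv (b (fst l))) = b (fst l) [^] ?e"
    using bi by (simp add: int_pow_neg)
  also have "\<dots> = vpow G b (\<lambda>i. if i = fst l then ?e else 0) r"
    using Cons.prems by (subst vpow_single[OF b']) auto
  finally have "eval_word G b (l # w) = vpow G b (\<lambda>i. (if i = fst l then ?e else 0) + wexp w i) r"
    using Cons by (simp add: vpow_add[OF b'])
  also have "(\<lambda>i. (if i = fst l then ?e else 0) + wexp w i) = wexp (l # w)" by auto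
  finally show ?case .
qed

text \<open>With the usual convention that the exponent is \<open>0\<close> if it is not finite.\<close>

definition expo :: "'g monoid \<Rightarrow> nat" where
  "expo G = (if finite_exponent G then group_exponent G else 0)"

text \<open>The integers annihilating a group form an ideal of Z, and \<open>expo\<close> is its
  nonnegative generator. This characterisation makes the convention 0 for infinite exponent
  fit.\<close>

lemma (in unextended_group) expo_dvd_iff:
  "(\<forall>x\<in>carrier G. x [^] (k::int) = \<one>) \<longleftrightarrow> int (expo G) dvd k"
proof (cases "finite_exponent G")
  case False
  have "k = 0" if "\<forall>x\<in>carrier G. x [^] k = \<one>"
  proof (rule ccontr)
    assume "k \<noteq> 0"
    have "x [^] nat \<bar>k\<bar> = \<one>" if "x \<in> carrier G" for x
    proof -
      have "x [^] \<bar>k\<bar> = \<one>"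
        using that \<open>\<forall>x\<in>carrier G. x [^] k = \<one>\<close> by (auto simp: abs_if int_pow_neg)
      thus ?thesis by (metis abs_ge_zero int_nat_eq int_pow_int)
    qed
    moreover have "nat \<bar>k\<bar> > 0" using \<open>k \<noteq> 0\<close> by simp
    ultimately show False using False unfolding finite_exponent_def by blast
  qed
  thus ?thesis using False by (auto simp: expo_def)
next
  case True
  define n where "n = group_exponent G"
  let ?P = "\<lambda>n. n > 0 \<and> (\<forall>x\<in>carrier G. x [^] (n::nat) = \<one>)"
  have "\<exists>n. ?P n" using True unfolding finite_exponent_def .
  hence n: "?P n" unfolding n_def group_exponent_def by (rule LeastI_ex)
  have min: "\<not> ?P k" if "k < n" for k
    using that unfolding n_def group_exponent_def by (rule not_less_Least)
  have nx: "x [^] (int n * q) = \<one>" if "x \<in> carrier G" for x q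
  proof -
    have "x [^] (int n * q) = (x [^] int n) [^] q" using that by (simp add: int_pow_pow)
    thus ?thesis using n that by (simp add: int_pow_int)
  qed
  have red: "x [^] k = x [^] nat (k mod int n)" if "x \<in> carrier G" for x
  proof -
    have "x [^] k = x [^] (int n * (k div int n) + k mod int n)" by simp
    also have "\<dots> = x [^] (int n * (k div int n)) \<otimes> x [^] (k mod int n)"
      using that by (simp only: int_pow_mult)
    also have "\<dots> = x [^] (k mod int n)" using that by (simp add: nx)
    also have "\<dots> = x [^] nat (k mod int n)"
      using n by (metis int_nat_eq int_pow_int of_nat_0_less_iff pos_mod_sign)
    finally show ?thesis .
  qed
  \<comment> \<open>The remainder is smaller than \<open>n\<close>, so by minimality it annihilates
    the group only if it is 0.\<close>
  have "\<not> ?P (nat (k mod int n))" using n by (intro min) (simp add: nat_less_iff)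
  hence "(\<forall>x\<in>carrier G. x [^] nat (k mod int n) = \<one>) \<longleftrightarrow> nat (k mod int n) = 0"
    by (metis gr0I nat_pow_0)
  also have "\<dots> \<longleftrightarrow> k mod int n = 0"
    using n by (metis nat_0_iff of_nat_0_less_iff order_antisym pos_mod_sign nat_0)
  finally show ?thesis using True red by (auto simp: expo_def n_def[symmetric] dvd_eq_mod_eq_0)
qed

lemma (in unextended_group) int_pow_expo: "x \<in> carrier G \<Longrightarrow> int (expo G) dvd k \<Longrightarrow> x [^] (k::int) = \<one>"
  using expo_dvd_iff by blast

section \<open>Laws of abelian groups\<close>

lemma (in unextended_comm_group) satisfies_law_if_dvd_wexp:
  assumes k: "\<And>x. x \<in> carrier G \<Longrightarrow> x [^] int k = \<one>" and dvd: "\<And>i. int k dvd wexp w i"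
  shows "satisfies_law G w"
  unfolding satisfies_law_def
proof
  fix \<sigma> :: "nat \<Rightarrow> 'g" assume \<sigma>: "\<sigma> \<in> UNIV \<rightarrow> carrier G"
  obtain r where r: "fst ` set w \<subseteq> {..<r}"
    by (metis finite_imageI finite_set finite_nat_iff_bounded)
  have "\<sigma> i [^] wexp w i = \<one>" for i
  proof -
    obtain q where q: "wexp w i = int k * q" using dvd[of i] by blast
    have "\<sigma> i \<in> carrier G" using \<sigma> by auto
    thus ?thesis using k by (simp add: q flip: int_pow_pow)
  qed
  thus "eval_word G \<sigma> w = \<one>" unfolding eval_word_eq_vpow[OF \<sigma> r] by (intro vpow_eq_one)
qed

lemma (in unextended_group) expo_dvd_wexp:
  assumes "satisfies_law G w"
  shows "int (expo G) dvd wexp w i"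
  unfolding expo_dvd_iff[symmetric]
proof
  fix a assume a: "a \<in> carrier G"
  hence "eval_word G (\<lambda>j. if j = i then a else \<one>) w = \<one>"
    using assms by (auto simp: satisfies_law_def)
  thus "a [^] wexp w i = \<one>" using eval_word_single[OF a] by (simp add: wexp_def)
qed

text \<open>Hence the laws of an abelian group depend on its exponent alone, which later permits
  replacing the two groups by others of the same exponents.\<close>

lemma (in unextended_comm_group) satisfies_law_iff_expo_dvd:
  "satisfies_law G w \<longleftrightarrow> (\<forall>i. int (expo G) dvd wexp w i)"
  using satisfies_law_if_dvd_wexp[of "expo G" w] expo_dvd_wexp int_pow_expo by auto

section \<open>Fox derivatives and wreath products\<close>

text \<open>A signed list of keys is a word in the free group on the keys. \<open>scount\<close>
  reads off its coefficients in the free abelian group, totalled over the keys in \<open>P\<close>;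
  \<open>sprod\<close> is its value under \<open>\<phi>\<close>, with the order of the factors
  kept.\<close>

definition scount :: "('k \<Rightarrow> bool) \<Rightarrow> ('k \<times> bool) list \<Rightarrow> int" where
  "scount P xs = sum_list (map (\<lambda>(k, s). if P k then (if s then 1 else - 1) else 0) xs)"

definition sprod :: "('g, 'm) monoid_scheme \<Rightarrow> ('k \<Rightarrow> 'g) \<Rightarrow> ('k \<times> bool) list \<Rightarrow> 'g" where
  "sprod G \<phi> xs = foldr (\<lambda>(k, s) y. (if s then \<phi> k else inv\<^bsub>G\<^esub> (\<phi> k)) \<otimes>\<^bsub>G\<^esub> y) xs \<one>\<^bsub>G\<^esub>"

lemma scount_Nil [simp]: "scount P [] = 0"
  and scount_Cons [simp]: "scount P (x # xs) = (if P (fst x) then (if snd x then 1 else - 1) else 0) + scount P xs"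
  by (auto simp: scount_def split: prod.splits)

lemma sprod_Nil [simp]: "sprod G \<phi> [] = \<one>\<^bsub>G\<^esub>"
  and sprod_Cons [simp]: "sprod G \<phi> (x # xs) = (if snd x then \<phi> (fst x) else inv\<^bsub>G\<^esub> (\<phi> (fst x))) \<otimes>\<^bsub>G\<^esub> sprod G \<phi> xs"
  by (auto simp: sprod_def split: prod.splits)

text \<open>List positions become an index set with weights 1 and -1, the format of the results on
  fibre sums.\<close>

lemma scount_eq_sum:
  "scount P xs = (\<Sum>t | t \<in> {..<length xs} \<and> P (fst (xs ! t)). if snd (xs ! t) then 1 else - 1)"
proof -
  have "scount P xs = (\<Sum>t<length xs. if P (fst (xs ! t)) then (if snd (xs ! t) then 1 else - 1) else 0)"
    unfolding scount_def by (subst sum_list_sum_nth) (auto simp: lessThan_atLeast0 case_prod_beta intro: sum.cong)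
  also have "\<dots> = (\<Sum>t | t \<in> {..<length xs} \<and> P (fst (xs ! t)). if snd (xs ! t) then 1 else - 1)"
    by (subst sum.inter_filter) auto
  finally show ?thesis .
qed

lemma sprod_cong:
  "(\<And>k. k \<in> fst ` set xs \<Longrightarrow> \<phi> k = \<psi> k) \<Longrightarrow> sprod G \<phi> xs = sprod G \<psi> xs"
  by (induction xs) auto

lemma sprod_map_apfst: "sprod G \<phi> (map (apfst h) xs) = sprod G (\<lambda>k. \<phi> (h k)) xs"
  by (induction xs) auto

lemma (in group) sprod_const:
  assumes "a \<in> carrier G"
  shows "sprod G (\<lambda>k. if P k then a else \<one>) xs = a [^] scount P xs"
  using assms by (induction xs) (auto simp: int_pow_mult int_pow_neg)

lemma (in comm_group) sprod_eq_finprod: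
  assumes "\<psi> \<in> UNIV \<rightarrow> carrier G" "finite C" "f ` fst ` set xs \<subseteq> C"
  shows "sprod G (\<lambda>k. \<psi> (f k)) xs = finprod G (\<lambda>c. \<psi> c [^] scount (\<lambda>k. f k = c) xs) C"
  using assms(3)
proof (induction xs)
  case Nil
  have "finprod G (\<lambda>c. \<psi> c [^] (0::int)) C = finprod G (\<lambda>c. \<one>) C" by simp
  thus ?case by simp
next
  case (Cons x xs)
  let ?c = "f (fst x)" and ?e = "if snd x then 1 else - 1 :: int"
  have \<psi>: "\<psi> c \<in> carrier G" for c using assms(1) by auto
  have "finprod G (\<lambda>c. \<psi> c [^] scount (\<lambda>k. f k = c) (x # xs)) C
    = finprod G (\<lambda>c. (if ?c = c then \<psi> c [^] ?e else \<one>) \<otimes> \<psi> c [^] scount (\<lambda>k. f k = c) xs) C"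
    using \<psi> by (intro finprod_cong') (auto simp: int_pow_mult simp flip: int_pow_mult)
  also have "\<dots> = finprod G (\<lambda>c. if ?c = c then \<psi> c [^] ?e else \<one>) C \<otimes> finprod G (\<lambda>c. \<psi> c [^] scount (\<lambda>k. f k = c) xs) C"
    using \<psi> by (intro finprod_multf) auto
  also have "finprod G (\<lambda>c. if ?c = c then \<psi> c [^] ?e else \<one>) C = \<psi> ?c [^] ?e"
    using Cons.prems assms \<psi> by (intro finprod_singleton) auto
  also have "finprod G (\<lambda>c. \<psi> c [^] scount (\<lambda>k. f k = c) xs) C = sprod G (\<lambda>k. \<psi> (f k)) xs"
    using Cons by simp
  finally show ?case using \<psi> by (simp add: int_pow_neg)
qed

text \<open>Commutativity lets the factors be collected by \<open>f\<close>: each fibre contributes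
  one element raised to the signed count of the fibre, a multiple of \<open>m\<close>.\<close>

lemma (in comm_group) sprod_eq_one:
  assumes \<phi>: "\<And>k. k \<in> fst ` set xs \<Longrightarrow> \<phi> k \<in> carrier G"
    and f: "\<And>k l. k \<in> fst ` set xs \<Longrightarrow> l \<in> fst ` set xs \<Longrightarrow> f k = f l \<Longrightarrow> \<phi> k = \<phi> l"
    and m: "\<And>x. x \<in> carrier G \<Longrightarrow> x [^] m = \<one>"
    and dvd: "\<And>k. k \<in> fst ` set xs \<Longrightarrow> (m::int) dvd scount (\<lambda>l. f l = f k) xs"
  shows "sprod G \<phi> xs = \<one>"
proof -
  define K where "K = fst ` set xs"
  \<comment> \<open>\<open>\<phi>\<close> factors through \<open>f\<close> on the keys that occur;
    elsewhere the value \<open>\<one>\<close> makes \<open>\<psi>\<close> a total map into the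
    carrier.\<close>
  define \<psi> where "\<psi> c = (if c \<in> f ` K then \<phi> (inv_into K f c) else \<one>)" for c
  have \<psi>f: "\<psi> (f k) = \<phi> k" if "k \<in> K" for k
    using that f[of "inv_into K f (f k)" k] by (auto simp: \<psi>_def K_def[symmetric] inv_into_into f_inv_into_f)
  have \<psi>: "\<psi> c \<in> carrier G" for c
    using \<phi> inv_into_into[of c f K] by (auto simp: \<psi>_def K_def[symmetric])
  have "sprod G \<phi> xs = sprod G (\<lambda>k. \<psi> (f k)) xs" by (rule sprod_cong) (simp add: \<psi>f K_def)
  also have "\<dots> = finprod G (\<lambda>c. \<psi> c [^] scount (\<lambda>k. f k = c) xs) (f ` K)"
    by (rule sprod_eq_finprod) (use \<psi> in \<open>auto simp: K_def\<close>)
  also have "\<dots> = \<one>"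
  proof (rule finprod_one_eqI)
    fix c assume "c \<in> f ` K"
    then obtain q where "scount (\<lambda>k. f k = c) xs = m * q" using dvd by (auto simp: K_def elim!: dvdE)
    thus "\<psi> c [^] scount (\<lambda>k. f k = c) xs = \<one>" using \<psi> m by (simp flip: int_pow_pow)
  qed
  finally show ?thesis .
qed

text \<open>An entry \<open>((i, u), s)\<close> stands for the term \<open>\<plusminus>u\<close> of the Fox derivative with respect to
  \<open>x\<^sub>i\<close>; its position \<open>u\<close> is the prefix before a letter \<open>x\<^sub>i\<close>, or up to and including a letter \<open>x\<^sub>i\<^sup>-\<^sup>1\<close>.\<close>

primrec fox :: "group_word \<Rightarrow> ((nat \<times> group_word) \<times> bool) list" where
  "fox [] = []"
| "fox (l # w) = ((fst l, if snd l then [] else [l]), snd l) # map (apfst (apsnd ((#) l))) (fox w)"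

lemma fox_vars:
  "((i, u), s) \<in> set (fox w) \<Longrightarrow> i \<in> fst ` set w \<and> fst ` set u \<subseteq> fst ` set w"
proof (induction w arbitrary: i u s)
  case (Cons l w)
  from Cons.prems consider "i = fst l" "set u \<subseteq> {l}" | v where "u = l # v" "((i, v), s) \<in> set (fox w)"
    by (auto split: if_splits)
  thus ?case
  proof cases
    case 1
    thus ?thesis by auto
  next
    case (2 v)
    from Cons.IH[OF this(2)] this(1) show ?thesis by auto
  qed
qed simp

section \<open>Group structure and evaluation of words in wreath products\<close>

lemma carrier_cartesian_wreath:
  "carrier (cartesian_wreath A B) = (carrier B \<rightarrow>\<^sub>E carrier A) \<times> carrier B"
  by (simp add: cartesian_wreath_def semidirect_product_def)

lemma one_cartesian_wreath:
  "\<one>\<^bsub>cartesian_wreath A B\<^esub> = ((\<lambda>x\<in>carrier B. \<one>\<^bsub>A\<^esub>), \<one>\<^bsub>B\<^esub>)"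
  by (simp add: cartesian_wreath_def semidirect_product_def)

lemma mult_cartesian_wreath:
  "(f, b) \<otimes>\<^bsub>cartesian_wreath A B\<^esub> (g, c) =
    ((\<lambda>x\<in>carrier B. f x \<otimes>\<^bsub>A\<^esub> g (inv\<^bsub>B\<^esub> b \<otimes>\<^bsub>B\<^esub> x)), b \<otimes>\<^bsub>B\<^esub> c)"
  by (auto simp: cartesian_wreath_def semidirect_product_def translate_def)

lemma inverse_in_cartesian_wreath:
  assumes "group A" "group B" and f: "f \<in> carrier B \<rightarrow>\<^sub>E carrier A" and b: "b \<in> carrier B"
  defines "g \<equiv> ((\<lambda>x\<in>carrier B. inv\<^bsub>A\<^esub> (f (b \<otimes>\<^bsub>B\<^esub> x))), inv\<^bsub>B\<^esub> b)"
  shows "g \<in> carrier (cartesian_wreath A B)"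
    and "g \<otimes>\<^bsub>cartesian_wreath A B\<^esub> (f, b) = \<one>\<^bsub>cartesian_wreath A B\<^esub>"
proof -
  interpret A: group A by fact
  interpret B: group B by fact
  show "g \<in> carrier (cartesian_wreath A B)"
    using f b by (auto simp: g_def carrier_cartesian_wreath PiE_iff)
  show "g \<otimes>\<^bsub>cartesian_wreath A B\<^esub> (f, b) = \<one>\<^bsub>cartesian_wreath A B\<^esub>"
    using f b by (auto simp: g_def mult_cartesian_wreath one_cartesian_wreath PiE_iff intro!: restrict_ext)
qed

lemma group_cartesian_wreath:
  assumes "group A" "group B"
  shows "group (cartesian_wreath A B)"
proof (rule groupI)
  interpret A: group A by fact
  interpret B: group B by fact
  let ?W = "cartesian_wreath A B"
  show "x \<otimes>\<^bsub>?W\<^esub> y \<in> carrier ?W" if "x \<in> carrier ?W" "y \<in> carrier ?W" for x y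
    using that by (auto simp: carrier_cartesian_wreath mult_cartesian_wreath PiE_iff)
  show "\<one>\<^bsub>?W\<^esub> \<in> carrier ?W"
    by (auto simp: carrier_cartesian_wreath one_cartesian_wreath)
  show "x \<otimes>\<^bsub>?W\<^esub> y \<otimes>\<^bsub>?W\<^esub> z = x \<otimes>\<^bsub>?W\<^esub> (y \<otimes>\<^bsub>?W\<^esub> z)"
    if "x \<in> carrier ?W" "y \<in> carrier ?W" "z \<in> carrier ?W" for x y z
    using that by (auto simp: carrier_cartesian_wreath mult_cartesian_wreath PiE_iff
        A.m_assoc B.m_assoc B.inv_mult_group intro!: restrict_ext)
  show "\<one>\<^bsub>?W\<^esub> \<otimes>\<^bsub>?W\<^esub> x = x" if "x \<in> carrier ?W" for x
    using that by (auto simp: carrier_cartesian_wreath mult_cartesian_wreath one_cartesian_wreath PiE_iff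
        intro!: extensionalityI[of _ "carrier B"])
  show "\<exists>y\<in>carrier ?W. y \<otimes>\<^bsub>?W\<^esub> x = \<one>\<^bsub>?W\<^esub>" if x: "x \<in> carrier ?W" for x
  proof -
    obtain f b where "x = (f, b)" "f \<in> carrier B \<rightarrow>\<^sub>E carrier A" "b \<in> carrier B"
      using x by (cases x) (auto simp: carrier_cartesian_wreath)
    thus ?thesis using inverse_in_cartesian_wreath[OF assms, of f b] by blast
  qed
qed

lemma inv_cartesian_wreath:
  assumes "group A" "group B" "f \<in> carrier B \<rightarrow>\<^sub>E carrier A" "b \<in> carrier B"
  shows "inv\<^bsub>cartesian_wreath A B\<^esub> (f, b) = ((\<lambda>x\<in>carrier B. inv\<^bsub>A\<^esub> (f (b \<otimes>\<^bsub>B\<^esub> x))), inv\<^bsub>B\<^esub> b)"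
  using assms inverse_in_cartesian_wreath[OF assms]
  by (intro group.inv_equality group_cartesian_wreath) (auto simp: carrier_cartesian_wreath)

text \<open>A letter contributes its base function translated by the prefix before it. The inverse
  of \<open>(f, b)\<close> has as base function the inverse of \<open>f\<close> translated by the
  inverse of \<open>b\<close>, so for an inverse letter the prefix includes the letter; this
  dictates the positions in \<open>fox\<close>.\<close>

lemma eval_word_cartesian_wreath:
  assumes "group A" "group B"
    and f: "\<And>i. f i \<in> carrier B \<rightarrow>\<^sub>E carrier A" and b: "\<And>i. b i \<in> carrier B"
  shows "eval_word (cartesian_wreath A B) (\<lambda>i. (f i, b i)) w =
    ((\<lambda>x\<in>carrier B. sprod A (\<lambda>(i, u). f i (inv\<^bsub>B\<^esub> (eval_word B b u) \<otimes>\<^bsub>B\<^esub> x)) (fox w)), eval_word B b w)"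
proof -
  interpret A: unextended_group A using assms by (simp add: unextended_group_def)
  interpret B: unextended_group B using assms by (simp add: unextended_group_def)
  have [simp]: "eval_word B b w \<in> carrier B" for w using b by auto
  show ?thesis
  proof (induction w)
    case Nil
    show ?case by (simp add: one_cartesian_wreath restrict_def)
  next
    case (Cons l w)
    show ?case
    proof (cases "snd l")
      case True
      thus ?thesis using Cons b
        by (auto simp: mult_cartesian_wreath sprod_map_apfst case_prod_beta B.m_assoc B.inv_mult_group intro!: restrict_ext)
    next
      case False
      thus ?thesis using Cons b
        by (auto simp: mult_cartesian_wreath inv_cartesian_wreath[OF assms(1,2) f b] sprod_map_apfst case_prod_beta B.m_assoc B.inv_mult_group intro!: restrict_ext)
    qed
  qed
qed

lemma direct_wreath_eq:
  assumes "group A"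
  shows "direct_wreath A B = (cartesian_wreath A B)\<lparr>carrier :=
    {f \<in> carrier B \<rightarrow>\<^sub>E carrier A. finite {x \<in> carrier B. f x \<noteq> \<one>\<^bsub>A\<^esub>}} \<times> carrier B\<rparr>"
  using carrier_sum_group[of "carrier B" "\<lambda>_. A"] assms
  by (simp add: direct_wreath_def cartesian_wreath_def semidirect_product_def sum_group_def
      subgroup_generated_def)

lemma subgroup_direct_wreath:
  assumes "group A" "group B"
  shows "subgroup ({f \<in> carrier B \<rightarrow>\<^sub>E carrier A. finite {x \<in> carrier B. f x \<noteq> \<one>\<^bsub>A\<^esub>}} \<times> carrier B)
    (cartesian_wreath A B)" (is "subgroup ?D ?W")
proof -
  interpret A: group A by fact
  interpret B: group B by fact
  interpret W: group ?W using assms by (rule group_cartesian_wreath)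
  show ?thesis
  proof
    show "?D \<subseteq> carrier ?W" by (auto simp: carrier_cartesian_wreath)
    show "\<one>\<^bsub>?W\<^esub> \<in> ?D" by (auto simp: one_cartesian_wreath)
  next
    fix x y assume "x \<in> ?D" "y \<in> ?D"
    then obtain f b g c where xy: "x = (f, b)" "y = (g, c)"
      and f: "f \<in> carrier B \<rightarrow>\<^sub>E carrier A" "finite {x \<in> carrier B. f x \<noteq> \<one>\<^bsub>A\<^esub>}" "b \<in> carrier B"
      and g: "g \<in> carrier B \<rightarrow>\<^sub>E carrier A" "finite {x \<in> carrier B. g x \<noteq> \<one>\<^bsub>A\<^esub>}" "c \<in> carrier B"
      by blast
    have "{x \<in> carrier B. f x \<otimes>\<^bsub>A\<^esub> g (inv\<^bsub>B\<^esub> b \<otimes>\<^bsub>B\<^esub> x) \<noteq> \<one>\<^bsub>A\<^esub>}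
      \<subseteq> {x \<in> carrier B. f x \<noteq> \<one>\<^bsub>A\<^esub>} \<union> (\<lambda>x. b \<otimes>\<^bsub>B\<^esub> x) ` {x \<in> carrier B. g x \<noteq> \<one>\<^bsub>A\<^esub>}"
    proof
      fix x assume x: "x \<in> {x \<in> carrier B. f x \<otimes>\<^bsub>A\<^esub> g (inv\<^bsub>B\<^esub> b \<otimes>\<^bsub>B\<^esub> x) \<noteq> \<one>\<^bsub>A\<^esub>}"
      hence "x = b \<otimes>\<^bsub>B\<^esub> (inv\<^bsub>B\<^esub> b \<otimes>\<^bsub>B\<^esub> x)" "inv\<^bsub>B\<^esub> b \<otimes>\<^bsub>B\<^esub> x \<in> carrier B"
        using f(3) by (auto simp flip: B.m_assoc)
      thus "x \<in> {x \<in> carrier B. f x \<noteq> \<one>\<^bsub>A\<^esub>} \<union> (\<lambda>x. b \<otimes>\<^bsub>B\<^esub> x) ` {x \<in> carrier B. g x \<noteq> \<one>\<^bsub>A\<^esub>}"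
        using x by (cases "f x = \<one>\<^bsub>A\<^esub>") auto
    qed
    hence "finite {x \<in> carrier B. f x \<otimes>\<^bsub>A\<^esub> g (inv\<^bsub>B\<^esub> b \<otimes>\<^bsub>B\<^esub> x) \<noteq> \<one>\<^bsub>A\<^esub>}"
      by (rule finite_subset) (use f g in auto)
    thus "x \<otimes>\<^bsub>?W\<^esub> y \<in> ?D"
      using f(1,3) g(1,3) by (auto simp: xy mult_cartesian_wreath PiE_iff cong: conj_cong)
  next
    fix x assume "x \<in> ?D"
    then obtain f b where x: "x = (f, b)"
      and f: "f \<in> carrier B \<rightarrow>\<^sub>E carrier A" "finite {x \<in> carrier B. f x \<noteq> \<one>\<^bsub>A\<^esub>}" "b \<in> carrier B"
      by blast
    have "{x \<in> carrier B. inv\<^bsub>A\<^esub> (f (b \<otimes>\<^bsub>B\<^esub> x)) \<noteq> \<one>\<^bsub>A\<^esub>}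
      \<subseteq> (\<lambda>x. inv\<^bsub>B\<^esub> b \<otimes>\<^bsub>B\<^esub> x) ` {x \<in> carrier B. f x \<noteq> \<one>\<^bsub>A\<^esub>}"
    proof
      fix x assume x: "x \<in> {x \<in> carrier B. inv\<^bsub>A\<^esub> (f (b \<otimes>\<^bsub>B\<^esub> x)) \<noteq> \<one>\<^bsub>A\<^esub>}"
      hence "x = inv\<^bsub>B\<^esub> b \<otimes>\<^bsub>B\<^esub> (b \<otimes>\<^bsub>B\<^esub> x)" "b \<otimes>\<^bsub>B\<^esub> x \<in> carrier B" "f (b \<otimes>\<^bsub>B\<^esub> x) \<noteq> \<one>\<^bsub>A\<^esub>"
        using f(3) by (auto simp flip: B.m_assoc)
      thus "x \<in> (\<lambda>x. inv\<^bsub>B\<^esub> b \<otimes>\<^bsub>B\<^esub> x) ` {x \<in> carrier B. f x \<noteq> \<one>\<^bsub>A\<^esub>}" by blast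
    qed
    hence "finite {x \<in> carrier B. inv\<^bsub>A\<^esub> (f (b \<otimes>\<^bsub>B\<^esub> x)) \<noteq> \<one>\<^bsub>A\<^esub>}"
      by (rule finite_subset) (use f in auto)
    thus "inv\<^bsub>?W\<^esub> x \<in> ?D"
      using f(1,3) by (auto simp: x inv_cartesian_wreath[OF assms] PiE_iff cong: conj_cong)
  qed
qed

text \<open>Treats both wreath products at once: laws of the cartesian one pass to any subgroup
  \<open>K\<close>, and the test functions used to exploit a law of \<open>W\<close> have finite
  support.\<close>

lemma wreath_obtain_subgroup:
  assumes "group A" "group B" "W = cartesian_wreath A B \<or> W = direct_wreath A B"
  obtains K where "W = (cartesian_wreath A B)\<lparr>carrier := K\<rparr>" "subgroup K (cartesian_wreath A B)"
    "{f \<in> carrier B \<rightarrow>\<^sub>E carrier A. finite {x \<in> carrier B. f x \<noteq> \<one>\<^bsub>A\<^esub>}} \<times> carrier B \<subseteq> K"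
  using assms(3)
proof
  assume "W = cartesian_wreath A B"
  thus ?thesis
    using group.subgroup_self[OF group_cartesian_wreath[OF assms(1,2)]]
    by (intro that[of "carrier (cartesian_wreath A B)"]) (auto simp: carrier_cartesian_wreath)
next
  assume W: "W = direct_wreath A B"
  show ?thesis
    by (rule that[OF _ subgroup_direct_wreath[OF assms(1,2)]]) (auto simp: W direct_wreath_eq[OF assms(1)])
qed

lemma group_wreath:
  assumes "group A" "group B" "W = cartesian_wreath A B \<or> W = direct_wreath A B"
  shows "group W"
  by (rule wreath_obtain_subgroup[OF assms]) (auto intro: subgroup.subgroup_is_group group_cartesian_wreath assms)

lemma satisfies_law_wreath:
  assumes "group A" "group B" "W = cartesian_wreath A B \<or> W = direct_wreath A B"
    and law: "satisfies_law (cartesian_wreath A B) w"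
  shows "satisfies_law W w"
proof -
  obtain K where K: "W = (cartesian_wreath A B)\<lparr>carrier := K\<rparr>" "subgroup K (cartesian_wreath A B)"
    by (rule wreath_obtain_subgroup[OF assms(1-3)])
  interpret W: unextended_group "cartesian_wreath A B"
    using group_cartesian_wreath[OF assms(1,2)] by (simp add: unextended_group_def)
  show ?thesis
    using law subgroup.subset[OF K(2)] by (auto simp: satisfies_law_def K(1) W.eval_word_subgroup[OF K(2)])
qed

text \<open>Evaluate \<open>w\<close> at a function supported at \<open>\<one>\<close>.\<close>

lemma expo_dvd_scount_fox:
  assumes AB: "group A" "group B" "W = cartesian_wreath A B \<or> W = direct_wreath A B"
    and law: "satisfies_law W w" and b: "b \<in> UNIV \<rightarrow> carrier B" and c: "c \<in> carrier B"
  shows "int (expo A) dvd scount (\<lambda>(j, u). j = i \<and> eval_word B b u = c) (fox w)"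
    and "eval_word B b w = \<one>\<^bsub>B\<^esub>"
proof -
  let ?W = "cartesian_wreath A B"
  interpret A: unextended_group A using AB by (simp add: unextended_group_def)
  interpret B: unextended_group B using AB by (simp add: unextended_group_def)
  interpret W: unextended_group ?W
    using group_cartesian_wreath[OF AB(1,2)] by (simp add: unextended_group_def)
  obtain K where K: "W = ?W\<lparr>carrier := K\<rparr>" "subgroup K ?W"
    "{f \<in> carrier B \<rightarrow>\<^sub>E carrier A. finite {x \<in> carrier B. f x \<noteq> \<one>\<^bsub>A\<^esub>}} \<times> carrier B \<subseteq> K"
    by (rule wreath_obtain_subgroup[OF AB])
  have bi: "b i \<in> carrier B" for i using b by auto
  \<comment> \<open>A nontrivial function is given to variable \<open>i\<close> only, which isolates
    the Fox derivative with respect to it.\<close>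
  define f where "f a j = (\<lambda>x\<in>carrier B. if j = i \<and> x = \<one>\<^bsub>B\<^esub> then a else \<one>\<^bsub>A\<^esub>)" for a j
  have f: "f a j \<in> carrier B \<rightarrow>\<^sub>E carrier A" if "a \<in> carrier A" for a j
    using that by (auto simp: f_def)
  have eval: "((\<lambda>x\<in>carrier B. sprod A (\<lambda>(j, u). f a j (inv\<^bsub>B\<^esub> (eval_word B b u) \<otimes>\<^bsub>B\<^esub> x)) (fox w)), eval_word B b w) = \<one>\<^bsub>?W\<^esub>"
    if a: "a \<in> carrier A" for a
  proof -
    have "finite {x \<in> carrier B. f a j x \<noteq> \<one>\<^bsub>A\<^esub>}" for j
      by (rule finite_subset[of _ "{\<one>\<^bsub>B\<^esub>}"]) (auto simp: f_def)
    hence "(f a j, b j) \<in> K" for j using f[OF a] bi by (intro subsetD[OF K(3)]) simp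
    hence \<sigma>: "(\<lambda>j. (f a j, b j)) \<in> UNIV \<rightarrow> K" by simp
    hence "eval_word W (\<lambda>j. (f a j, b j)) w = \<one>\<^bsub>W\<^esub>" using law by (simp add: satisfies_law_def K(1))
    hence "eval_word ?W (\<lambda>j. (f a j, b j)) w = \<one>\<^bsub>?W\<^esub>"
      using W.eval_word_subgroup[OF K(2) \<sigma>] by (simp add: K(1))
    thus ?thesis using eval_word_cartesian_wreath[OF AB(1,2), of "f a" b w] f[OF a] bi by simp
  qed
  \<comment> \<open>The second component does not depend on the base functions, so trivial ones
    do.\<close>
  show "eval_word B b w = \<one>\<^bsub>B\<^esub>" using eval[of "\<one>\<^bsub>A\<^esub>"] by (simp add: one_cartesian_wreath)
  show "int (expo A) dvd scount (\<lambda>(j, u). j = i \<and> eval_word B b u = c) (fox w)"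
    unfolding A.expo_dvd_iff[symmetric]
  proof
    fix a assume a: "a \<in> carrier A"
    \<comment> \<open>Evaluation at \<open>c\<close> singles out the terms whose position has value
      \<open>c\<close>.\<close>
    have "f a j (inv\<^bsub>B\<^esub> (eval_word B b u) \<otimes>\<^bsub>B\<^esub> c) = (if j = i \<and> eval_word B b u = c then a else \<one>\<^bsub>A\<^esub>)" for j u
    proof -
      have u: "eval_word B b u \<in> carrier B" using b by simp
      have "inv\<^bsub>B\<^esub> (eval_word B b u) \<otimes>\<^bsub>B\<^esub> c = \<one>\<^bsub>B\<^esub> \<longleftrightarrow> eval_word B b u = c"
        using u c by (metis B.inv_closed B.inv_equality B.inv_inv B.l_inv)
      thus ?thesis using u c by (simp add: f_def)
    qed
    hence "sprod A (\<lambda>k. if (\<lambda>(j, u). j = i \<and> eval_word B b u = c) k then a else \<one>\<^bsub>A\<^esub>) (fox w)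
      = sprod A (\<lambda>(j, u). f a j (inv\<^bsub>B\<^esub> (eval_word B b u) \<otimes>\<^bsub>B\<^esub> c)) (fox w)"
      by (intro sprod_cong) (auto split: prod.splits)
    also have "\<dots> = \<one>\<^bsub>A\<^esub>"
      using fun_cong[OF arg_cong[OF eval[OF a], of fst], of c] c by (simp add: one_cartesian_wreath)
    finally show "a [^]\<^bsub>A\<^esub> scount (\<lambda>(j, u). j = i \<and> eval_word B b u = c) (fox w) = \<one>\<^bsub>A\<^esub>"
      by (simp only: A.sprod_const[OF a])
  qed
qed

section \<open>Groups satisfying the laws of the wreath product belong to the product
  variety\<close>

lemma satisfies_law_wrename: "satisfies_law G w \<Longrightarrow> satisfies_law G (wrename f w)" if "group G"
proof -
  interpret unextended_group G using that by (simp add: unextended_group_def)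
  show "satisfies_law G (wrename f w)" if "satisfies_law G w"
    using that by (auto simp: satisfies_law_def eval_wrename Pi_iff)
qed

lemma sprod_fox_const: "sprod G (\<lambda>(i, u). g i) (fox w) = eval_word G g w"
  by (induction w) (auto simp: sprod_map_apfst case_prod_beta)

text \<open>The words \<open>ws i\<close> take values in the base group, which is a power of
  \<open>A\<close> and therefore satisfies \<open>v\<close>.\<close>

lemma satisfies_law_cartesian_wreath_wsubst:
  assumes AB: "group A" "group B" and v: "satisfies_law A v" and ws: "\<And>i. satisfies_law B (ws i)"
  shows "satisfies_law (cartesian_wreath A B) (wsubst v ws)"
  unfolding satisfies_law_def
proof
  let ?W = "cartesian_wreath A B"
  interpret A: unextended_group A using AB by (simp add: unextended_group_def)
  interpret B: unextended_group B using AB by (simp add: unextended_group_def)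
  interpret W: unextended_group ?W
    using group_cartesian_wreath[OF AB] by (simp add: unextended_group_def)
  fix \<sigma> :: "nat \<Rightarrow> _" assume \<sigma>: "\<sigma> \<in> UNIV \<rightarrow> carrier ?W"
  have "\<sigma> i \<in> carrier ?W" for i using \<sigma> by auto
  hence \<sigma>': "fst (\<sigma> i) \<in> carrier B \<rightarrow>\<^sub>E carrier A" "snd (\<sigma> i) \<in> carrier B" for i
    by (simp_all add: carrier_cartesian_wreath mem_Times_iff)
  have closed: "eval_word ?W \<sigma> (ws i) \<in> carrier ?W" for i using \<sigma> by simp
  define f where "f i = fst (eval_word ?W \<sigma> (ws i))" for i
  have f: "f i \<in> carrier B \<rightarrow>\<^sub>E carrier A" for i
    using closed[of i] by (simp add: f_def carrier_cartesian_wreath mem_Times_iff)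
  have "eval_word ?W \<sigma> (ws i) = (f i, \<one>\<^bsub>B\<^esub>)" for i
  proof -
    have "snd (eval_word ?W (\<lambda>i. (fst (\<sigma> i), snd (\<sigma> i))) (ws i)) = eval_word B (\<lambda>i. snd (\<sigma> i)) (ws i)"
      by (subst eval_word_cartesian_wreath[OF AB]) (use \<sigma>' in auto)
    also have "\<dots> = \<one>\<^bsub>B\<^esub>" using ws[of i] \<sigma>' by (simp add: satisfies_law_def)
    finally show ?thesis by (simp add: f_def prod_eq_iff)
  qed
  hence "eval_word ?W \<sigma> (wsubst v ws) = eval_word ?W (\<lambda>i. (f i, \<one>\<^bsub>B\<^esub>)) v"
    using \<sigma> by (simp add: W.eval_wsubst)
  also have "\<dots> = ((\<lambda>x\<in>carrier B. sprod A (\<lambda>(i, u). f i (inv\<^bsub>B\<^esub> (eval_word B (\<lambda>_. \<one>\<^bsub>B\<^esub>) u) \<otimes>\<^bsub>B\<^esub> x)) (fox v)), eval_word B (\<lambda>_. \<one>\<^bsub>B\<^esub>) v)"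
    using f by (intro eval_word_cartesian_wreath[OF AB]) auto
  also have one: "eval_word B (\<lambda>_. \<one>\<^bsub>B\<^esub>) u = \<one>\<^bsub>B\<^esub>" for u by (induction u) auto
  also have "(\<lambda>x\<in>carrier B. sprod A (\<lambda>(i, u). f i (inv\<^bsub>B\<^esub> (eval_word B (\<lambda>_. \<one>\<^bsub>B\<^esub>) u) \<otimes>\<^bsub>B\<^esub> x)) (fox v)) = (\<lambda>x\<in>carrier B. \<one>\<^bsub>A\<^esub>)"
  proof (intro restrict_ext)
    fix x assume x: "x \<in> carrier B"
    have "sprod A (\<lambda>(i, u). f i (inv\<^bsub>B\<^esub> (eval_word B (\<lambda>_. \<one>\<^bsub>B\<^esub>) u) \<otimes>\<^bsub>B\<^esub> x)) (fox v) = eval_word A (\<lambda>i. f i x) v"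
      using x by (simp add: one sprod_fox_const)
    also have "\<dots> = \<one>\<^bsub>A\<^esub>" using v f x by (auto simp: satisfies_law_def PiE_iff)
    finally show "sprod A (\<lambda>(i, u). f i (inv\<^bsub>B\<^esub> (eval_word B (\<lambda>_. \<one>\<^bsub>B\<^esub>) u) \<otimes>\<^bsub>B\<^esub> x)) (fox v) = \<one>\<^bsub>A\<^esub>" .
  qed
  finally show "eval_word ?W \<sigma> (wsubst v ws) = \<one>\<^bsub>?W\<^esub>" by (simp add: one_cartesian_wreath restrict_def)
qed

text \<open>The normal subgroup is the verbal subgroup of the laws of \<open>B\<close>.\<close>

lemma in_product_variety_if_wreath_laws:
  fixes A :: "'a monoid" and B :: "'b monoid" and H :: "'h monoid"
  assumes AB: "group A" "group B" and H: "group H"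
    and laws: "\<And>w. satisfies_law (cartesian_wreath A B) w \<Longrightarrow> satisfies_law H w"
  shows "H \<in> product_variety (generated_variety A) (generated_variety B)"
proof -
  interpret A: unextended_group A using AB by (simp add: unextended_group_def)
  interpret B: unextended_group B using AB by (simp add: unextended_group_def)
  interpret H: unextended_group H using H by (simp add: unextended_group_def)
  define N where "N = {eval_word H \<sigma> w | \<sigma> w. \<sigma> \<in> UNIV \<rightarrow> carrier H \<and> satisfies_law B w}"
  have N_rep: "\<exists>\<sigma> ws. \<sigma> \<in> UNIV \<rightarrow> carrier H \<and> (\<forall>i. satisfies_law B (ws i)) \<and> (\<forall>v. eval_word H n v = eval_word H \<sigma> (wsubst v ws))"
    if n: "n \<in> UNIV \<rightarrow> N" for n :: "nat \<Rightarrow> 'h"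
  proof -
    have "\<exists>\<sigma> w. n i = eval_word H \<sigma> w \<and> \<sigma> \<in> UNIV \<rightarrow> carrier H \<and> satisfies_law B w" for i
      using n by (auto simp: N_def Pi_iff)
    then obtain \<sigma> w where \<sigma>w: "\<And>i. n i = eval_word H (\<sigma> i) (w i)" "\<And>i. \<sigma> i \<in> UNIV \<rightarrow> carrier H"
      "\<And>i. satisfies_law B (w i)" by metis
    \<comment> \<open>Different elements of \<open>N\<close> come with different assignments.
      Renaming through the pairing function makes their variables disjoint, so one assignment serves
      the whole sequence.\<close>
    define \<sigma>' where "\<sigma>' k = (case prod_decode k of (i, j) \<Rightarrow> \<sigma> i j)" for k
    define ws where "ws i = wrename (\<lambda>j. prod_encode (i, j)) (w i)" for i
    have \<sigma>': "\<sigma>' \<in> UNIV \<rightarrow> carrier H" using \<sigma>w(2) by (auto simp: \<sigma>'_def Pi_iff split: prod.splits)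
    have "n i = eval_word H \<sigma>' (ws i)" for i
    proof -
      have "\<sigma>' \<circ> (\<lambda>j. prod_encode (i, j)) = \<sigma> i" by (auto simp: \<sigma>'_def)
      thus ?thesis by (simp add: ws_def H.eval_wrename \<sigma>w(1))
    qed
    hence "n = (\<lambda>i. eval_word H \<sigma>' (ws i))" by auto
    hence "eval_word H n v = eval_word H \<sigma>' (wsubst v ws)" for v
      using \<sigma>' by (simp add: H.eval_wsubst)
    moreover have "satisfies_law B (ws i)" for i
      using \<sigma>w(3) AB(2) by (simp add: ws_def satisfies_law_wrename)
    ultimately show ?thesis using \<sigma>' by blast
  qed
  \<comment> \<open>Laws of \<open>B\<close> substituted into any word give a law of
    \<open>B\<close>. Closure under the group operations is the case of words of length one and
    two.\<close>
  have N_closed: "eval_word H n v \<in> N" if n: "n \<in> UNIV \<rightarrow> N" for n :: "nat \<Rightarrow> 'h" and v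
  proof -
    obtain \<sigma> ws where *: "\<sigma> \<in> UNIV \<rightarrow> carrier H" "\<And>i. satisfies_law B (ws i)"
      "\<And>v. eval_word H n v = eval_word H \<sigma> (wsubst v ws)" using N_rep[OF n] by blast
    have one: "eval_word B (\<lambda>_. \<one>\<^bsub>B\<^esub>) v = \<one>\<^bsub>B\<^esub>" by (induction v) auto
    have "satisfies_law B (wsubst v ws)"
      using *(2) by (auto simp: satisfies_law_def B.eval_wsubst one)
    thus ?thesis using *(1,3) by (auto simp: N_def)
  qed
  have N_sub: "N \<subseteq> carrier H" by (auto simp: N_def)
  have N: "subgroup N H"
  proof
    show "N \<subseteq> carrier H" by fact
    have "satisfies_law B []" by (simp add: satisfies_law_def)
    hence "eval_word H (\<lambda>_. \<one>\<^bsub>H\<^esub>) [] \<in> N" unfolding N_def by fastforce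
    thus "\<one>\<^bsub>H\<^esub> \<in> N" by simp
    show "x \<otimes>\<^bsub>H\<^esub> y \<in> N" if "x \<in> N" "y \<in> N" for x y
      using N_closed[of "\<lambda>i. if i = 0 then x else y" "[(0, True), (1, True)]"] that N_sub by auto
    show "inv\<^bsub>H\<^esub> x \<in> N" if "x \<in> N" for x
      using N_closed[of "\<lambda>i. x" "[(0, False)]"] that N_sub by auto
  qed
  have normal: "N \<lhd> H"
    unfolding H.normal_inv_iff
  proof (intro conjI ballI N)
    fix g n assume g: "g \<in> carrier H" and "n \<in> N"
    then obtain \<sigma> w where n: "n = eval_word H \<sigma> w" "\<sigma> \<in> UNIV \<rightarrow> carrier H" "satisfies_law B w"
      by (auto simp: N_def)
    \<comment> \<open>Conjugation is an endomorphism, and endomorphisms carry values of a word to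
      values of the same word.\<close>
    define h where "h x = g \<otimes>\<^bsub>H\<^esub> x \<otimes>\<^bsub>H\<^esub> inv\<^bsub>H\<^esub> g" for x
    have "h \<in> hom H H"
    proof (rule homI)
      fix x y assume xy: "x \<in> carrier H" "y \<in> carrier H"
      have "h x \<otimes>\<^bsub>H\<^esub> h y = g \<otimes>\<^bsub>H\<^esub> x \<otimes>\<^bsub>H\<^esub> (inv\<^bsub>H\<^esub> g \<otimes>\<^bsub>H\<^esub> g) \<otimes>\<^bsub>H\<^esub> y \<otimes>\<^bsub>H\<^esub> inv\<^bsub>H\<^esub> g"
        using g xy by (simp only: h_def H.m_assoc H.m_closed H.inv_closed)
      thus "h (x \<otimes>\<^bsub>H\<^esub> y) = h x \<otimes>\<^bsub>H\<^esub> h y" using g xy by (simp add: h_def H.m_assoc)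
    qed (use g in \<open>auto simp: h_def\<close>)
    hence "h n = eval_word H (h \<circ> \<sigma>) w" using H.eval_word_hom[OF _ H n(2)] n(1) by simp
    moreover have "h \<circ> \<sigma> \<in> UNIV \<rightarrow> carrier H" using n(2) g by (auto simp: h_def Pi_iff)
    ultimately show "g \<otimes>\<^bsub>H\<^esub> n \<otimes>\<^bsub>H\<^esub> inv\<^bsub>H\<^esub> g \<in> N" using n(3) unfolding N_def h_def by blast
  qed
  interpret N: normal N H by (rule normal)
  \<comment> \<open>A value of \<open>v\<close> on \<open>N\<close> is a value in \<open>H\<close>
    of \<open>v\<close> with laws of \<open>B\<close> substituted, and such a word is a law of the
    wreath product.\<close>
  have "satisfies_law (H\<lparr>carrier := N\<rparr>) v" if v: "satisfies_law A v" for v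
    unfolding satisfies_law_def
  proof
    fix n :: "nat \<Rightarrow> 'h" assume "n \<in> UNIV \<rightarrow> carrier (H\<lparr>carrier := N\<rparr>)"
    hence n: "n \<in> UNIV \<rightarrow> N" by simp
    obtain \<sigma> ws where *: "\<sigma> \<in> UNIV \<rightarrow> carrier H" "\<And>i. satisfies_law B (ws i)"
      "\<And>v. eval_word H n v = eval_word H \<sigma> (wsubst v ws)" using N_rep[OF n] by blast
    have "satisfies_law H (wsubst v ws)"
      by (intro laws satisfies_law_cartesian_wreath_wsubst AB v *(2))
    thus "eval_word (H\<lparr>carrier := N\<rparr>) n v = \<one>\<^bsub>H\<lparr>carrier := N\<rparr>\<^esub>"
      using *(1,3) H.eval_word_subgroup[OF N n] by (simp add: satisfies_law_def)
  qed
  hence 1: "H\<lparr>carrier := N\<rparr> \<in> generated_variety A"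
    using subgroup.subgroup_is_group[OF N H] by (simp add: generated_variety_iff_laws[OF AB(1)])
  have "satisfies_law (H Mod N) w" if w: "satisfies_law B w" for w
    unfolding satisfies_law_def
  proof
    fix \<tau> :: "nat \<Rightarrow> 'h set" assume "\<tau> \<in> UNIV \<rightarrow> carrier (H Mod N)"
    hence "\<exists>x. x \<in> carrier H \<and> \<tau> i = N #>\<^bsub>H\<^esub> x" for i
      by (auto simp: FactGroup_def RCOSETS_def Pi_iff)
    then obtain \<sigma> where \<sigma>: "\<And>i. \<sigma> i \<in> carrier H" "\<And>i. \<tau> i = N #>\<^bsub>H\<^esub> \<sigma> i" by metis
    have "eval_word (H Mod N) ((\<lambda>x. N #>\<^bsub>H\<^esub> x) \<circ> \<sigma>) w = N #>\<^bsub>H\<^esub> eval_word H \<sigma> w"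
      using \<sigma>(1) N.r_coset_hom_Mod N.factorgroup_is_group by (intro H.eval_word_hom) auto
    also have "(\<lambda>x. N #>\<^bsub>H\<^esub> x) \<circ> \<sigma> = \<tau>" using \<sigma>(2) by auto
    also have "\<sigma> \<in> UNIV \<rightarrow> carrier H" using \<sigma>(1) by simp
    hence "eval_word H \<sigma> w \<in> N" using w unfolding N_def by blast
    hence "N #>\<^bsub>H\<^esub> eval_word H \<sigma> w = N" using N N_sub by (simp add: H.coset_join2)
    finally show "eval_word (H Mod N) \<tau> w = \<one>\<^bsub>H Mod N\<^esub>" by simp
  qed
  hence 2: "H Mod N \<in> generated_variety B"
    using N.factorgroup_is_group by (simp add: generated_variety_iff_laws[OF AB(2)])
  have "\<exists>N. N \<lhd> H \<and> H\<lparr>carrier := N\<rparr> \<in> generated_variety A \<and> H Mod N \<in> generated_variety B"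
    by (rule exI[of _ N], rule conjI[OF normal conjI[OF 1 2]])
  thus ?thesis unfolding product_variety_def mem_Collect_eq by (rule conjI[OF H])
qed

section \<open>Laws of extensions of abelian groups\<close>

lemma generated_variety_comm_group:
  assumes "comm_group A" and H: "H \<in> generated_variety A"
  shows "comm_group H" and "x \<in> carrier H \<Longrightarrow> x [^]\<^bsub>H\<^esub> int (expo A) = \<one>\<^bsub>H\<^esub>"
proof -
  interpret A: unextended_comm_group A using assms(1) by (simp add: unextended_comm_group_def)
  have "group H" and laws: "\<And>w. satisfies_law A w \<Longrightarrow> satisfies_law H w"
    using H generated_variety_iff_laws[OF A.is_group, of H] by auto
  then interpret H: unextended_group H by (simp add: unextended_group_def)
  have "satisfies_law A (wcomm [(0, True)] [(1, True)])"
    unfolding satisfies_law_def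
  proof
    fix \<sigma> :: "nat \<Rightarrow> 'a" assume \<sigma>: "\<sigma> \<in> UNIV \<rightarrow> carrier A"
    hence "\<sigma> 0 \<in> carrier A" "\<sigma> 1 \<in> carrier A" by auto
    hence "\<sigma> 0 \<otimes>\<^bsub>A\<^esub> \<sigma> 1 \<otimes>\<^bsub>A\<^esub> inv\<^bsub>A\<^esub> \<sigma> 0 \<otimes>\<^bsub>A\<^esub> inv\<^bsub>A\<^esub> \<sigma> 1 = \<sigma> 0 \<otimes>\<^bsub>A\<^esub> \<sigma> 1 \<otimes>\<^bsub>A\<^esub> inv\<^bsub>A\<^esub> (\<sigma> 0 \<otimes>\<^bsub>A\<^esub> \<sigma> 1)"
      "\<sigma> 0 \<otimes>\<^bsub>A\<^esub> \<sigma> 1 \<in> carrier A"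
      by (simp_all only: A.inv_mult A.m_assoc A.m_closed A.inv_closed)
    thus "eval_word A \<sigma> (wcomm [(0, True)] [(1, True)]) = \<one>\<^bsub>A\<^esub>"
      using \<open>\<sigma> 0 \<in> carrier A\<close> \<open>\<sigma> 1 \<in> carrier A\<close> by (simp add: A.eval_wcomm[OF \<sigma>])
  qed
  hence comm: "satisfies_law H (wcomm [(0, True)] [(1, True)])" by (rule laws)
  show "comm_group H"
  proof (rule group.group_comm_groupI[OF H.is_group])
    fix x y assume xy: "x \<in> carrier H" "y \<in> carrier H"
    define \<sigma> where "\<sigma> i = (if i = 0 then x else y)" for i :: nat
    have \<sigma>: "\<sigma> \<in> UNIV \<rightarrow> carrier H" using xy by (simp add: \<sigma>_def)
    have "x \<otimes>\<^bsub>H\<^esub> y \<otimes>\<^bsub>H\<^esub> inv\<^bsub>H\<^esub> x \<otimes>\<^bsub>H\<^esub> inv\<^bsub>H\<^esub> y = \<one>\<^bsub>H\<^esub>"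
      using comm \<sigma> xy unfolding satisfies_law_def by (fastforce simp: H.eval_wcomm[OF \<sigma>] \<sigma>_def)
    hence "x \<otimes>\<^bsub>H\<^esub> y \<otimes>\<^bsub>H\<^esub> inv\<^bsub>H\<^esub> (y \<otimes>\<^bsub>H\<^esub> x) = \<one>\<^bsub>H\<^esub>" using xy by (simp add: H.inv_mult_group H.m_assoc)
    thus "x \<otimes>\<^bsub>H\<^esub> y = y \<otimes>\<^bsub>H\<^esub> x" using xy H.inv_equality[of "x \<otimes>\<^bsub>H\<^esub> y" "inv\<^bsub>H\<^esub> (y \<otimes>\<^bsub>H\<^esub> x)"] by simp
  qed
  have "satisfies_law A (wpow [(0, True)] (expo A))"
    unfolding satisfies_law_def
  proof
    fix \<sigma> :: "nat \<Rightarrow> 'a" assume \<sigma>: "\<sigma> \<in> UNIV \<rightarrow> carrier A"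
    hence "\<sigma> 0 \<in> carrier A" by auto
    thus "eval_word A \<sigma> (wpow [(0, True)] (expo A)) = \<one>\<^bsub>A\<^esub>"
      using A.int_pow_expo[of "\<sigma> 0" "int (expo A)"] by (simp add: A.eval_wpow[OF \<sigma>] int_pow_int)
  qed
  hence "satisfies_law H (wpow [(0, True)] (expo A))" by (rule laws)
  hence "eval_word H (\<lambda>_. x) (wpow [(0, True)] (expo A)) = \<one>\<^bsub>H\<^esub>" if "x \<in> carrier H"
    using that by (simp add: satisfies_law_def)
  thus "x [^]\<^bsub>H\<^esub> int (expo A) = \<one>\<^bsub>H\<^esub>" if "x \<in> carrier H"
    using that H.eval_wpow[of "\<lambda>_. x"] by (simp add: int_pow_int)
qed

text \<open>The cocycle of the Kaloujnine--Krasner embedding into \<open>N Wr (H/N)\<close> turns a word into the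
  product over its Fox derivatives.\<close>

lemma satisfies_law_extension:
  fixes H :: "'h monoid"
  assumes H: "group H" and normal: "N \<lhd> H"
    and N: "comm_group (H\<lparr>carrier := N\<rparr>)" and Q: "comm_group (H Mod N)"
    and m: "\<And>x. x \<in> N \<Longrightarrow> x [^]\<^bsub>H\<lparr>carrier := N\<rparr>\<^esub> m = \<one>\<^bsub>H\<^esub>"
    and n: "\<And>x. x \<in> carrier (H Mod N) \<Longrightarrow> x [^]\<^bsub>H Mod N\<^esub> int n = \<one>\<^bsub>H Mod N\<^esub>"
    and r: "fst ` set w \<subseteq> {..<r}" and wexp: "\<And>i. int n dvd wexp w i"
    and fox: "\<And>i u. m dvd scount (\<lambda>(j, v). j = i \<and> (\<forall>l<r. int n dvd wexp v l - wexp u l)) (fox w)"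
  shows "satisfies_law H w"
  unfolding satisfies_law_def
proof
  interpret H: unextended_group H using H by (simp add: unextended_group_def)
  interpret N: normal N H by (rule normal)
  let ?N = "H\<lparr>carrier := N\<rparr>" and ?Q = "H Mod N"
  interpret NN: comm_group ?N by (rule N)
  interpret Q: unextended_comm_group ?Q using Q by (simp add: unextended_comm_group_def)
  define \<pi> where "\<pi> x = N #>\<^bsub>H\<^esub> x" for x
  have \<pi>_hom: "\<pi> \<in> hom H ?Q" unfolding \<pi>_def by (rule N.r_coset_hom_Mod)
  interpret \<pi>: group_hom H ?Q \<pi>
    using \<pi>_hom H.is_group Q.is_group by (simp add: group_hom_def group_hom_axioms_def)
  note [simp del] = mult_FactGroup one_FactGroup
  have \<pi>_1: "x \<in> N" if "x \<in> carrier H" "\<pi> x = \<one>\<^bsub>?Q\<^esub>" for x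
    using that H.rcos_self[OF that(1) N.subgroup_axioms] by (simp add: \<pi>_def one_FactGroup)
  \<comment> \<open>A transversal of the cosets, normalised at the trivial coset so that the cocycle
    can return the value of \<open>w\<close> at the end.\<close>
  define \<tau> where "\<tau> c = (if c = \<one>\<^bsub>?Q\<^esub> then \<one>\<^bsub>H\<^esub> else SOME x. x \<in> carrier H \<and> \<pi> x = c)" for c
  have \<tau>: "\<tau> c \<in> carrier H \<and> \<pi> (\<tau> c) = c" if "c \<in> carrier ?Q" for c
  proof -
    have "\<exists>x. x \<in> carrier H \<and> \<pi> x = c" using that by (auto simp: FactGroup_def RCOSETS_def \<pi>_def)
    from someI_ex[OF this] show ?thesis by (auto simp: \<tau>_def)
  qed
  hence \<tau>c [simp]: "\<tau> c \<in> carrier H" and \<tau>\<pi> [simp]: "\<pi> (\<tau> c) = c" if "c \<in> carrier ?Q" for c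
    using that by auto
  define \<kappa> where "\<kappa> h c = inv\<^bsub>H\<^esub> (\<tau> c) \<otimes>\<^bsub>H\<^esub> (h \<otimes>\<^bsub>H\<^esub> \<tau> (inv\<^bsub>?Q\<^esub> (\<pi> h) \<otimes>\<^bsub>?Q\<^esub> c))" for h c
  have \<kappa>N: "\<kappa> h c \<in> N" if "h \<in> carrier H" "c \<in> carrier ?Q" for h c
    by (rule \<pi>_1) (use that in \<open>simp_all add: \<kappa>_def flip: Q.m_assoc\<close>)
  have \<kappa>H [simp]: "\<kappa> h c \<in> carrier H" if "h \<in> carrier H" "c \<in> carrier ?Q" for h c
    using \<kappa>N[OF that] by simp
  have cancel: "a \<otimes>\<^bsub>H\<^esub> (inv\<^bsub>H\<^esub> a \<otimes>\<^bsub>H\<^esub> b) = b" "inv\<^bsub>H\<^esub> a \<otimes>\<^bsub>H\<^esub> (a \<otimes>\<^bsub>H\<^esub> b) = b" if "a \<in> carrier H" "b \<in> carrier H" for a b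
    using that by (simp_all flip: H.m_assoc)
  have \<kappa>_mult: "\<kappa> (g \<otimes>\<^bsub>H\<^esub> h) c = \<kappa> g c \<otimes>\<^bsub>H\<^esub> \<kappa> h (inv\<^bsub>?Q\<^esub> (\<pi> g) \<otimes>\<^bsub>?Q\<^esub> c)"
    if "g \<in> carrier H" "h \<in> carrier H" "c \<in> carrier ?Q" for g h c
    using that by (simp add: \<kappa>_def H.m_assoc cancel Q.inv_mult_group Q.m_assoc)
  have \<kappa>_one: "\<kappa> \<one>\<^bsub>H\<^esub> c = \<one>\<^bsub>H\<^esub>" if "c \<in> carrier ?Q" for c
    using that by (simp add: \<kappa>_def)
  have \<kappa>_inv: "\<kappa> (inv\<^bsub>H\<^esub> g) c = inv\<^bsub>H\<^esub> (\<kappa> g (\<pi> g \<otimes>\<^bsub>?Q\<^esub> c))"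
    if "g \<in> carrier H" "c \<in> carrier ?Q" for g c
  proof -
    have "\<kappa> (inv\<^bsub>H\<^esub> g) c \<otimes>\<^bsub>H\<^esub> \<kappa> g (\<pi> g \<otimes>\<^bsub>?Q\<^esub> c) = \<kappa> (inv\<^bsub>H\<^esub> g \<otimes>\<^bsub>H\<^esub> g) c"
      using that by (subst \<kappa>_mult) simp_all
    thus ?thesis using that by (intro H.inv_equality[symmetric]) (simp_all add: \<kappa>_one)
  qed
  fix \<sigma> :: "nat \<Rightarrow> 'h" assume \<sigma>: "\<sigma> \<in> UNIV \<rightarrow> carrier H"
  have \<sigma>i [simp]: "\<sigma> i \<in> carrier H" for i using \<sigma> by auto
  have ev [simp]: "eval_word H \<sigma> u \<in> carrier H" for u using \<sigma> by simp
  have invN: "inv\<^bsub>?N\<^esub> x = inv\<^bsub>H\<^esub> x" if "x \<in> N" for x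
    using that by (simp add: H.m_inv_consistent N.subgroup_axioms)
  \<comment> \<open>\<open>\<kappa>\<close> multiplies like the base component in a wreath product,
    so the recursion of \<open>fox\<close> applies to it.\<close>
  have \<kappa>_word: "\<kappa> (eval_word H \<sigma> v) c = sprod ?N (\<lambda>(i, u). \<kappa> (\<sigma> i) (inv\<^bsub>?Q\<^esub> (\<pi> (eval_word H \<sigma> u)) \<otimes>\<^bsub>?Q\<^esub> c)) (fox v)"
    if "c \<in> carrier ?Q" for v c
    using that
  proof (induction v arbitrary: c)
    case Nil
    thus ?case by (simp add: \<kappa>_one)
  next
    case (Cons l v)
    thus ?case
      by (cases "snd l") (simp_all add: \<kappa>_mult \<kappa>_inv invN \<kappa>N sprod_map_apfst case_prod_beta Q.inv_mult_group Q.m_assoc)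
  qed
  have \<pi>\<sigma>: "\<pi> \<circ> \<sigma> \<in> UNIV \<rightarrow> carrier ?Q" by simp
  hence \<pi>\<sigma>': "\<pi> \<circ> \<sigma> \<in> {..<r} \<rightarrow> carrier ?Q" by auto
  have \<pi>_eval: "\<pi> (eval_word H \<sigma> u) = vpow ?Q (\<pi> \<circ> \<sigma>) (wexp u) r" if "fst ` set u \<subseteq> {..<r}" for u
    using H.eval_word_hom[OF \<pi>_hom Q.is_group \<sigma>, of u] Q.eval_word_eq_vpow[OF \<pi>\<sigma> that] by simp
  have vpow_1: "vpow ?Q (\<pi> \<circ> \<sigma>) e r = \<one>\<^bsub>?Q\<^esub>" if e: "\<And>l. l < r \<Longrightarrow> int n dvd e l" for e
  proof (rule Q.vpow_eq_one)
    fix l assume "l < r"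
    then obtain q where "e l = int n * q" using e by blast
    thus "(\<pi> \<circ> \<sigma>) l [^]\<^bsub>?Q\<^esub> e l = \<one>\<^bsub>?Q\<^esub>" using n[of "\<pi> (\<sigma> l)"] by (simp flip: Q.int_pow_pow)
  qed
  \<comment> \<open>Entries from \<open>r\<close> on are set to 0 so that only the first
    \<open>r\<close> coordinates are compared. For \<open>n = 0\<close> reduction modulo
    \<open>n\<close> is the identity, and the key keeps the exact vector.\<close>
  define key where "key = (\<lambda>(i :: nat, u). (i, \<lambda>l. if l < r then wexp u l mod int n else 0))"
  have key: "key (j, v) = key (i, u) \<longleftrightarrow> j = i \<and> (\<forall>l<r. int n dvd wexp v l - wexp u l)" for i j u v
    by (auto simp: key_def fun_eq_iff mod_eq_dvd_iff)
  have "\<kappa> (eval_word H \<sigma> w) \<one>\<^bsub>?Q\<^esub> = \<one>\<^bsub>?N\<^esub>"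
    unfolding \<kappa>_word[OF Q.one_closed]
  proof (rule NN.sprod_eq_one[where f = key and m = m])
    fix k l assume k: "k \<in> fst ` set (fox w)" and l: "l \<in> fst ` set (fox w)" and eq: "key k = key l"
    obtain i u j v where kl: "k = (i, u)" "l = (j, v)" by (cases k, cases l) auto
    have uv: "fst ` set u \<subseteq> {..<r}" "fst ` set v \<subseteq> {..<r}"
    proof -
      obtain s t where "((i, u), s) \<in> set (fox w)" "((j, v), t) \<in> set (fox w)"
        using k l unfolding kl by auto
      from fox_vars[OF this(1)] fox_vars[OF this(2)] r
      show "fst ` set u \<subseteq> {..<r}" "fst ` set v \<subseteq> {..<r}" by blast+
    qed
    have "vpow ?Q (\<pi> \<circ> \<sigma>) (wexp u) r = vpow ?Q (\<pi> \<circ> \<sigma>) (wexp v) r"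
      unfolding Q.vpow_eq_iff[OF \<pi>\<sigma>'] using eq by (intro vpow_1) (simp add: kl key)
    thus "(case k of (i, u) \<Rightarrow> \<kappa> (\<sigma> i) (inv\<^bsub>?Q\<^esub> \<pi> (eval_word H \<sigma> u) \<otimes>\<^bsub>?Q\<^esub> \<one>\<^bsub>?Q\<^esub>)) =
      (case l of (i, u) \<Rightarrow> \<kappa> (\<sigma> i) (inv\<^bsub>?Q\<^esub> \<pi> (eval_word H \<sigma> u) \<otimes>\<^bsub>?Q\<^esub> \<one>\<^bsub>?Q\<^esub>))"
      using eq by (simp add: kl key \<pi>_eval[OF uv(1)] \<pi>_eval[OF uv(2)])
  next
    fix k assume "k \<in> fst ` set (fox w)"
    obtain i u where k: "k = (i, u)" by fastforce
    have "(\<lambda>l. key l = key k) = (\<lambda>(j, v). j = i \<and> (\<forall>l<r. int n dvd wexp v l - wexp u l))"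
      by (auto simp: k key)
    thus "m dvd scount (\<lambda>l. key l = key k) (fox w)" using fox[of i u] by simp
  qed (use m \<kappa>N in \<open>auto split: prod.splits\<close>)
  \<comment> \<open>The word dies in the quotient and \<open>\<tau>\<close> is normalised, so the
    cocycle at the trivial coset is the value of the word itself.\<close>
  moreover have "\<pi> (eval_word H \<sigma> w) = \<one>\<^bsub>?Q\<^esub>" using wexp by (simp add: \<pi>_eval[OF r] vpow_1)
  moreover have "\<tau> \<one>\<^bsub>?Q\<^esub> = \<one>\<^bsub>H\<^esub>" by (simp add: \<tau>_def)
  ultimately show "eval_word H \<sigma> w = \<one>\<^bsub>H\<^esub>" by (simp add: \<kappa>_def)
qed

section \<open>From values in \<open>B\<close> to exponent vectors\<close>

text \<open>Uniqueness of signed digits in base \<open>K\<close>: modulo \<open>K\<close> only the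
  lowest digit remains, and its bound makes it 0.\<close>

lemma weighted_sum_powers_eq_0:
  fixes d :: "nat \<Rightarrow> int" and K :: int
  assumes "\<And>l. l < r \<Longrightarrow> \<bar>d l\<bar> < K" and "(\<Sum>l<r. K ^ l * d l) = 0" and "l < r"
  shows "d l = 0"
  using assms
proof (induction r arbitrary: d l)
  case (Suc r)
  have K: "\<bar>d 0\<bar> < K" by (rule Suc.prems) simp
  have eq: "d 0 + K * (\<Sum>l<r. K ^ l * d (Suc l)) = 0"
    using Suc.prems(2) by (simp add: sum.lessThan_Suc_shift sum_distrib_left mult.assoc del: sum.lessThan_Suc)
  hence "d 0 = K * - (\<Sum>l<r. K ^ l * d (Suc l))" by simp
  hence "K dvd d 0" by (rule dvdI)
  hence d0: "d 0 = 0" using K zdvd_not_zless[of "\<bar>d 0\<bar>" K] by (cases "d 0 = 0") auto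
  hence sum: "(\<Sum>l<r. K ^ l * d (Suc l)) = 0" using eq K by simp
  show ?case
  proof (cases l)
    case 0
    thus ?thesis using d0 by simp
  next
    case (Suc l')
    thus ?thesis using Suc.IH[of "\<lambda>l. d (Suc l)" l'] sum Suc.prems(1,3) by auto
  qed
qed simp

context unextended_comm_group
begin

lemma vpow_cong: "(\<And>i. i < r \<Longrightarrow> b i = c i) \<Longrightarrow> vpow G b v r = vpow G c v r"
  by (induction r) auto

text \<open>An element of large order separates vectors through the digits of its exponents.\<close>

lemma dvd_fibre_sum_infinite_exponent:
  fixes s :: "'t \<Rightarrow> int" and V :: "'t \<Rightarrow> nat \<Rightarrow> int"
  assumes T: "finite T" and expo: "expo G = 0"
    and H: "\<And>b c. b \<in> {..<r} \<rightarrow> carrier G \<Longrightarrow> c \<in> carrier G \<Longrightarrow> M dvd (\<Sum>t | t \<in> T \<and> vpow G b (V t) r = c. s t)"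
  shows "M dvd (\<Sum>t | t \<in> T \<and> (\<forall>l<r. V t l = U l). s t)"
proof -
  \<comment> \<open>\<open>K\<close> exceeds every difference of coordinates, so the differences are
    digits in base \<open>K\<close>; the 1 makes the bound strict.\<close>
  define K where "K = (\<Sum>t\<in>T. \<Sum>l<r. \<bar>V t l - U l\<bar>) + 1"
  have K: "\<bar>V t l - U l\<bar> < K" if "t \<in> T" "l < r" for t l
  proof -
    have "\<bar>V t l - U l\<bar> \<le> (\<Sum>l<r. \<bar>V t l - U l\<bar>)" using that by (intro member_le_sum) auto
    also have "\<dots> \<le> (\<Sum>t\<in>T. \<Sum>l<r. \<bar>V t l - U l\<bar>)"
      using that T by (intro member_le_sum) (auto intro: sum_nonneg)
    finally show ?thesis by (simp add: K_def)
  qed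
  define e where "e t = (\<Sum>l<r. K ^ l * (V t l - U l))" for t
  \<comment> \<open>Every nonzero \<open>e t\<close> divides the factorial of \<open>R\<close>. An
    element not killed by this factorial is killed by none of them.\<close>
  define R where "R = nat (\<Sum>t\<in>T. \<bar>e t\<bar>)"
  have "\<not> int (expo G) dvd int (fact R)" using expo by simp
  then obtain x where x: "x \<in> carrier G" "x [^] int (fact R) \<noteq> \<one>"
    using expo_dvd_iff by blast
  have xe: "x [^] e t = \<one> \<longleftrightarrow> (\<forall>l<r. V t l = U l)" if t: "t \<in> T" for t
  proof
    assume 1: "x [^] e t = \<one>"
    have "e t = 0"
    proof (rule ccontr)
      assume "e t \<noteq> 0"
      have "\<bar>e t\<bar> \<le> (\<Sum>t\<in>T. \<bar>e t\<bar>)" using T t by (intro member_le_sum) auto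
      hence "nat \<bar>e t\<bar> dvd fact R" using \<open>e t \<noteq> 0\<close> by (intro dvd_fact) (auto simp: R_def)
      hence "int (nat \<bar>e t\<bar>) dvd int (fact R)" by (simp only: int_dvd_int_iff)
      hence "e t dvd int (fact R)" by simp
      then obtain k where "int (fact R) = e t * k" by (elim dvdE)
      hence "x [^] int (fact R) = (x [^] e t) [^] k" using x(1) by (simp only: int_pow_pow)
      thus False using 1 x(2) by simp
    qed
    hence "V t l - U l = 0" if "l < r" for l
      using K[OF t] that by (intro weighted_sum_powers_eq_0[of r "\<lambda>l. V t l - U l" K]) (simp_all add: e_def)
    thus "\<forall>l<r. V t l = U l" by simp
  qed (simp add: e_def)
  define b where "b l = x [^] (K ^ l)" for l :: nat
  have b: "b \<in> {..<r} \<rightarrow> carrier G" using x by (simp add: b_def)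
  have "vpow G b (V t) r = vpow G b U r \<longleftrightarrow> x [^] e t = \<one>" for t
    unfolding vpow_eq_iff[OF b] b_def vpow_powers[OF x(1)] e_def ..
  hence "{t. t \<in> T \<and> vpow G b (V t) r = vpow G b U r} = {t. t \<in> T \<and> (\<forall>l<r. V t l = U l)}"
    using xe by blast
  thus ?thesis using H[OF b, of "vpow G b U r"] b by simp
qed

text \<open>Induction on \<open>d\<close>, splitting off the full power of one prime: an element of
  order \<open>p ^ j\<close> and one of the coprime order \<open>d'\<close> have a product of order
  \<open>d\<close>.\<close>

lemma ex_element_of_order:
  fixes d :: nat
  assumes "expo G > 0" and "d dvd expo G"
  shows "\<exists>x\<in>carrier G. \<forall>k::int. x [^] k = \<one> \<longleftrightarrow> int d dvd k"
  using assms(2)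
proof (induction d rule: less_induct)
  case (less d)
  let ?n = "expo G"
  have d0: "d > 0" using less.prems assms(1) by (auto intro: Nat.gr0I)
  show ?case
  proof (cases "d = 1")
    case True
    thus ?thesis by (intro bexI[of _ \<one>]) auto
  next
    case False
    then obtain p where p: "prime p" "p dvd d" by (meson prime_factor_nat)
    define j where "j = multiplicity p d"
    obtain d' where d': "d = p ^ j * d'" "\<not> p dvd d'"
      using multiplicity_decompose'[of d p] d0 p(1) unfolding j_def by (metis bot_nat_0.extremum_strict not_prime_unit)
    have j: "j > 0" using p d0 by (auto simp: j_def prime_multiplicity_gt_zero_iff)
    have cop: "coprime (p ^ j) d'" using d'(2) p(1) by (simp add: prime_imp_coprime)
    have "p ^ j > 1" using p(1) j by (intro one_less_power prime_gt_1_nat)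
    hence "d' < d" using d0 by (simp add: d'(1))
    moreover have "d' dvd ?n" using less.prems d'(1) dvd_mult_right by blast
    ultimately obtain y where y: "y \<in> carrier G" "\<And>k::int. y [^] k = \<one> \<longleftrightarrow> int d' dvd k"
      using less.IH by blast
    have "p ^ j dvd ?n" using less.prems d'(1) dvd_mult_left by blast
    then obtain h where h: "?n = p ^ j * h" by blast
    have h0: "h > 0" using assms(1) h by (auto intro: Nat.gr0I)
    \<comment> \<open>\<open>p ^ (j - 1) * h\<close> is the exponent divided by \<open>p\<close>, so
      some \<open>x0\<close> survives it; the power \<open>h\<close> of \<open>x0\<close> then has
      order exactly \<open>p ^ j\<close>.\<close>
    have "?n = p * (p ^ (j - 1) * h)" using j h by (cases j) auto
    moreover have "p ^ (j - 1) * h < p * (p ^ (j - 1) * h)"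
      using h0 p(1) by (simp add: prime_gt_0_nat prime_gt_Suc_0_nat)
    ultimately have "p ^ (j - 1) * h < ?n" by simp
    hence "\<not> ?n dvd p ^ (j - 1) * h" using h0 p(1) by (auto dest!: dvd_imp_le simp: prime_gt_0_nat)
    hence "\<not> int ?n dvd int (p ^ (j - 1) * h)" by (simp only: int_dvd_int_iff) simp
    then obtain x0 where x0: "x0 \<in> carrier G" "x0 [^] int (p ^ (j - 1) * h) \<noteq> \<one>"
      using expo_dvd_iff by blast
    define x where "x = x0 [^] int h"
    have x: "x \<in> carrier G" using x0 by (simp add: x_def)
    have x_pow: "x [^] k = x0 [^] (int h * k)" for k :: int
      using x0 by (simp add: x_def int_pow_pow)
    have x_iff: "x [^] k = \<one> \<longleftrightarrow> int (p ^ j) dvd k" for k :: int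
    proof
      assume "int (p ^ j) dvd k"
      then obtain q where "k = int (p ^ j) * q" by blast
      hence "int h * k = int ?n * q" by (simp add: h)
      thus "x [^] k = \<one>" unfolding x_pow using x0(1) by (intro int_pow_expo) auto
    next
      assume k: "x [^] k = \<one>"
      show "int (p ^ j) dvd k"
      proof (rule ccontr)
        \<comment> \<open>The gcd is \<open>p ^ i\<close> with \<open>i < j\<close>, and by Bezout
          it kills \<open>x\<close>. Then so does \<open>p ^ (j - 1)\<close>, against the choice of
          \<open>x0\<close>.\<close>
        assume nd: "\<not> int (p ^ j) dvd k"
        define g where "g = gcd k (int (p ^ j))"
        have "nat g dvd p ^ j" unfolding g_def by (metis gcd_dvd2 gcd_ge_0_int int_dvd_int_iff int_nat_eq)
        then obtain i where i: "nat g = p ^ i" "i \<le> j" using p(1) divides_primepow_nat by blast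
        have "g = int (nat g)" by (simp add: g_def)
        hence g: "g = int (p ^ i)" by (simp only: i(1))
        have "i \<noteq> j" using nd g by (metis g_def gcd_dvd1)
        hence "p ^ i dvd p ^ (j - 1)" using i(2) by (intro le_imp_power_dvd) simp
        then obtain q where q: "p ^ (j - 1) = p ^ i * q" by blast
        obtain u v where uv: "u * k + v * int (p ^ j) = g" using bezout_int[of k "int (p ^ j)"] unfolding g_def by blast
        have "x [^] int (p ^ j) = \<one>" unfolding x_pow using x0(1) by (intro int_pow_expo) (auto simp: h)
        moreover have "g = k * u + int (p ^ j) * v" using uv by (simp add: mult.commute)
        hence "x [^] g = (x [^] k) [^] u \<otimes> (x [^] int (p ^ j)) [^] v"
          using x by (simp only: int_pow_pow int_pow_mult)
        ultimately have "x [^] g = \<one>" using k by simp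
        hence "(x [^] g) [^] int q = \<one>" by simp
        moreover have "int (p ^ (j - 1)) = g * int q" by (simp only: g q of_nat_mult)
        ultimately have "x [^] int (p ^ (j - 1)) = \<one>" using x by (simp only: int_pow_pow)
        thus False using x0(2) by (simp add: x_pow mult.commute)
      qed
    qed
    have "(x \<otimes> y) [^] k = \<one> \<longleftrightarrow> int d dvd k" for k :: int
    proof
      assume "int d dvd k"
      hence "int (p ^ j) dvd k" "int d' dvd k" unfolding d'(1) by (auto intro: dvd_mult_left dvd_mult_right)
      hence "x [^] k = \<one>" "y [^] k = \<one>" by (simp_all only: x_iff y(2))
      thus "(x \<otimes> y) [^] k = \<one>" using x y(1) by (simp add: int_pow_distrib)
    next
      \<comment> \<open>The power \<open>d'\<close> removes \<open>y\<close> and leaves a condition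
        on \<open>x\<close> alone; once \<open>x\<close> drops out, the condition on
        \<open>y\<close> is left.\<close>
      assume k: "(x \<otimes> y) [^] k = \<one>"
      have "x [^] (k * int d') = \<one>"
      proof -
        have "\<one> = ((x \<otimes> y) [^] k) [^] int d'" using k by simp
        also have "\<dots> = x [^] (k * int d') \<otimes> y [^] (k * int d')" using x y(1) by (simp add: int_pow_distrib int_pow_pow)
        also have "y [^] (k * int d') = \<one>" by (simp add: y(2))
        finally show ?thesis using x by simp
      qed
      hence "int (p ^ j) dvd k * int d'" by (simp add: x_iff)
      moreover have "coprime (int (p ^ j)) (int d')" using cop by (simp only: coprime_int_iff)
      ultimately have 1: "int (p ^ j) dvd k" by (simp add: coprime_dvd_mult_left_iff)
      hence "y [^] k = \<one>" using k x y(1) by (simp add: int_pow_distrib x_iff[THEN iffD2])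
      hence "int d' dvd k" by (simp add: y(2))
      thus "int d dvd k" using 1 \<open>coprime (int (p ^ j)) (int d')\<close> by (simp add: d'(1) divides_mult)
    qed
    thus ?thesis using x y(1) by (intro bexI[of _ "x \<otimes> y"]) auto
  qed
qed

text \<open>The \<open>\<beta> l\<close> are independent of order \<open>t\<close>, while for
  \<open>n'\<close> a single element \<open>\<gamma>\<close> must do. Under the assignment
  \<open>\<beta> l \<otimes> \<gamma> [^] a l\<close> the value at a vector determines the vector
  modulo \<open>t\<close> and one linear form modulo \<open>n'\<close>; varying \<open>a\<close>
  gives the hypothesis of the Fourier inversion.\<close>

lemma dvd_fibre_sum_finite_exponent:
  fixes s :: "'t \<Rightarrow> int" and V :: "'t \<Rightarrow> nat \<Rightarrow> int"
  assumes T: "finite T" and n0: "expo G > 0" and n: "expo G = t * n'" and tn: "coprime t n'"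
    and M: "M = 0 \<or> coprime M (int n')"
    and \<beta>: "\<beta> \<in> {..<r} \<rightarrow> carrier G" and \<beta>t: "\<And>l. l < r \<Longrightarrow> \<beta> l [^] int t = \<one>"
    and free: "\<And>e l. vpow G \<beta> e r = \<one> \<Longrightarrow> l < r \<Longrightarrow> int t dvd e l"
    and H: "\<And>b c. b \<in> {..<r} \<rightarrow> carrier G \<Longrightarrow> c \<in> carrier G \<Longrightarrow> M dvd (\<Sum>t | t \<in> T \<and> vpow G b (V t) r = c. s t)"
  shows "M dvd (\<Sum>t | t \<in> T \<and> (\<forall>l<r. int (expo G) dvd V t l - U l). s t)"
proof -
  have n'0: "n' > 0" using n n0 by (auto intro: Nat.gr0I)
  obtain \<gamma> where \<gamma>: "\<gamma> \<in> carrier G" "\<And>k::int. \<gamma> [^] k = \<one> \<longleftrightarrow> int n' dvd k"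
    using ex_element_of_order[OF n0, of n'] n by auto
  have tn': "coprime (int t) (int n')" using tn by simp
  have \<beta>_iff: "vpow G \<beta> e r = \<one> \<longleftrightarrow> (\<forall>l<r. int t dvd e l)" for e
  proof
    assume e: "\<forall>l<r. int t dvd e l"
    show "vpow G \<beta> e r = \<one>"
    proof (rule vpow_eq_one)
      fix l assume l: "l < r"
      then obtain q where "e l = int t * q" using e by blast
      thus "\<beta> l [^] e l = \<one>" using \<beta>t[OF l] \<beta> l by (simp add: Pi_iff flip: int_pow_pow)
    qed
  qed (use free in blast)
  have \<beta>_pow: "vpow G \<beta> e r [^] int t = \<one>" for e
    unfolding vpow_int_pow[OF \<beta>] \<beta>_iff by simp
  let ?T = "{t' \<in> T. \<forall>l<r. int t dvd V t' l - U l}"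
  have "M dvd (\<Sum>t' | t' \<in> ?T \<and> (\<forall>l<r. int n' dvd V t' l - U l). s t')"
  proof (rule dvd_fibre_sum[OF _ n'0 M])
    fix a j
    define b where "b l = \<beta> l \<otimes> \<gamma> [^] (a l :: int)" for l :: nat
    have \<gamma>a: "(\<lambda>l. \<gamma> [^] (a l :: int)) \<in> {..<r} \<rightarrow> carrier G" using \<gamma>(1) by simp
    have b: "b \<in> {..<r} \<rightarrow> carrier G" using \<beta> \<gamma>(1) by (simp add: b_def Pi_iff)
    \<comment> \<open>The \<open>\<beta>\<close>-part of the target is pinned at \<open>U\<close>,
      whereas the \<open>\<gamma>\<close>-part runs through all residues \<open>j\<close>.\<close>
    define c where "c = vpow G \<beta> U r \<otimes> \<gamma> [^] (j :: int)"
    have c: "c \<in> carrier G" using \<beta> \<gamma>(1) by (simp add: c_def)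
    have "vpow G b (V t') r = c \<longleftrightarrow> (\<forall>l<r. int t dvd V t' l - U l) \<and> int n' dvd (\<Sum>l<r. a l * V t' l) - j" for t'
    proof -
      define X where "X = vpow G \<beta> (\<lambda>l. V t' l - U l) r"
      define k where "k = (\<Sum>l<r. a l * V t' l) - j"
      have X: "X \<in> carrier G" using \<beta> by (simp add: X_def)
      have "vpow G b (V t') r = vpow G \<beta> (V t') r \<otimes> \<gamma> [^] (\<Sum>l<r. a l * V t' l)"
        unfolding b_def by (simp add: vpow_mult_base[OF \<beta> \<gamma>a] vpow_powers[OF \<gamma>(1)])
      also have "\<dots> = (X \<otimes> vpow G \<beta> U r) \<otimes> \<gamma> [^] (k + j)"
        using \<beta> by (simp add: X_def k_def flip: vpow_add)
      also have "\<dots> = (X \<otimes> \<gamma> [^] k) \<otimes> c"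
        using \<beta> \<gamma>(1) X by (simp add: c_def int_pow_mult m_ac)
      finally have "vpow G b (V t') r = (X \<otimes> \<gamma> [^] k) \<otimes> c" .
      hence "vpow G b (V t') r = c \<longleftrightarrow> X \<otimes> \<gamma> [^] k = \<one>"
        using X \<gamma>(1) c by simp
      also have "\<dots> \<longleftrightarrow> X = \<one> \<and> \<gamma> [^] k = \<one>"
      proof
        \<comment> \<open>The power \<open>t\<close> kills \<open>X\<close>, and \<open>t\<close> is
          invertible modulo the order \<open>n'\<close> of \<open>\<gamma>\<close>; thus both
          factors are trivial.\<close>
        assume 1: "X \<otimes> \<gamma> [^] k = \<one>"
        hence "\<one> = (X \<otimes> \<gamma> [^] k) [^] int t" by simp
        also have "\<dots> = X [^] int t \<otimes> \<gamma> [^] (k * int t)"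
          using X \<gamma>(1) by (simp add: int_pow_distrib int_pow_pow)
        also have "X [^] int t = \<one>" unfolding X_def by (rule \<beta>_pow)
        finally have "\<gamma> [^] (k * int t) = \<one>" using \<gamma>(1) by simp
        hence "int n' dvd k * int t" by (simp add: \<gamma>(2))
        hence "int n' dvd k" using tn' by (simp add: coprime_dvd_mult_left_iff coprime_commute)
        thus "X = \<one> \<and> \<gamma> [^] k = \<one>" using 1 X by (simp add: \<gamma>(2)[THEN iffD2])
      qed simp
      finally show ?thesis by (simp add: X_def k_def \<beta>_iff \<gamma>(2))
    qed
    hence "{t'. t' \<in> T \<and> vpow G b (V t') r = c} = {t'. t' \<in> ?T \<and> int n' dvd (\<Sum>l<r. a l * V t' l) - j}"
      by auto
    thus "M dvd (\<Sum>t' | t' \<in> ?T \<and> int n' dvd (\<Sum>l<r. a l * V t' l) - j. s t')"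
      using H[OF b c] by simp
  qed (use T in simp)
  also have "{t'. t' \<in> ?T \<and> (\<forall>l<r. int n' dvd V t' l - U l)} = {t'. t' \<in> T \<and> (\<forall>l<r. int (expo G) dvd V t' l - U l)}"
    using tn' by (auto simp: n intro: divides_mult dvd_mult_left dvd_mult_right)
  finally show ?thesis .
qed

end

section \<open>Torsion factors and independent elements\<close>

lemma finite_image_iff_same_fibres:
  assumes "\<And>x y. x \<in> S \<Longrightarrow> y \<in> S \<Longrightarrow> f x = f y \<longleftrightarrow> g x = g y"
  shows "finite (f ` S) \<longleftrightarrow> finite (g ` S)"
proof -
  have *: "finite (f ` S)" if "finite (g ` S)" and fg: "\<And>x y. x \<in> S \<Longrightarrow> y \<in> S \<Longrightarrow> g x = g y \<Longrightarrow> f x = f y"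
    for f :: "'a \<Rightarrow> 'd" and g :: "'a \<Rightarrow> 'e"
  proof (rule finite_surj[OF that(1), of _ "\<lambda>z. f (inv_into S g z)"])
    have "f x = f (inv_into S g (g x))" if "x \<in> S" for x
      using that by (intro fg) (auto intro: inv_into_into simp: f_inv_into_f)
    thus "f ` S \<subseteq> (\<lambda>z. f (inv_into S g z)) ` g ` S" by auto
  qed
  show ?thesis using *[of g f] *[of f g] assms by blast
qed

context unextended_comm_group
begin

lemma subgroup_torsion: "subgroup {b \<in> carrier G. b [^] (s::nat) = \<one>} G"
proof
  show "x \<otimes> y \<in> {b \<in> carrier G. b [^] s = \<one>}"
    if "x \<in> {b \<in> carrier G. b [^] s = \<one>}" "y \<in> {b \<in> carrier G. b [^] s = \<one>}" for x y
    using that by (simp add: nat_pow_distrib)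
qed (auto simp: nat_pow_inv)

lemma torsion_part_eq: "torsion_part G s = {b \<in> carrier G. b [^] s = \<one>}"
  unfolding torsion_part_def
  by (intro equalityI generate_subgroup_incl subset_refl subgroup_torsion subsetI generate.incl)

text \<open>The power map \<open>t\<close> is a homomorphism with kernel B[t], so cosets of the
  kernel correspond to powers. In this form the condition is applied in both directions of the
  theorem.\<close>

lemma infinite_torsion_factor_iff:
  "infinite (carrier (torsion_factor G s t)) \<longleftrightarrow> infinite ((\<lambda>b. b [^] t) ` {b \<in> carrier G. b [^] s = \<one>})"
proof -
  let ?S = "{b \<in> carrier G. b [^] s = \<one>}" and ?T = "{b \<in> carrier G. b [^] t = \<one>}"
  have T: "subgroup ?T G" by (rule subgroup_torsion)
  have "carrier (torsion_factor G s t) = (\<lambda>a. ?T #> a) ` ?S"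
    by (auto simp: torsion_factor_def FactGroup_def RCOSETS_def r_coset_def torsion_part_eq)
  moreover have "finite ((\<lambda>a. ?T #> a) ` ?S) \<longleftrightarrow> finite ((\<lambda>b. b [^] t) ` ?S)"
  proof (rule finite_image_iff_same_fibres)
    fix x y assume "x \<in> ?S" "y \<in> ?S"
    hence x: "x \<in> carrier G" and y: "y \<in> carrier G" by auto
    show "?T #> x = ?T #> y \<longleftrightarrow> x [^] t = y [^] t"
    proof
      assume "?T #> x = ?T #> y"
      hence "x \<in> ?T #> y" using rcos_self[OF x T] by simp
      then obtain h where "h \<in> ?T" "x = h \<otimes> y" by (auto simp: r_coset_def)
      thus "x [^] t = y [^] t" using y by (simp add: nat_pow_distrib)
    next
      assume eq: "x [^] t = y [^] t"
      have "(x \<otimes> inv y) [^] t = \<one>" using x y eq by (simp add: nat_pow_distrib nat_pow_inv)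
      hence "x \<otimes> inv y \<in> ?T" using x y by simp
      moreover have "x = (x \<otimes> inv y) \<otimes> y" using x y by (simp add: m_assoc)
      ultimately have "x \<in> ?T #> y" unfolding r_coset_def by blast
      thus "?T #> x = ?T #> y" using repr_independence[OF _ y T] by simp
    qed
  qed
  ultimately show ?thesis by simp
qed

text \<open>Each new generator is chosen so that its power \<open>q\<^sup>k\<^sup>-\<^sup>1\<close> avoids the finite subgroup
  generated by the previous ones.\<close>

lemma ex_independent_torsion_elements:
  assumes q: "prime (q::nat)" and k: "k > 0"
    and inf: "infinite ((\<lambda>b. b [^] (q ^ (k - 1))) ` {b \<in> carrier G. b [^] (q ^ k) = \<one>})"
  shows "\<exists>\<beta>\<in>{..<r} \<rightarrow> carrier G. (\<forall>l<r. \<beta> l [^] int (q ^ k) = \<one>) \<and>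
    (\<forall>e. vpow G \<beta> e r = \<one> \<longrightarrow> (\<forall>l<r. int (q ^ k) dvd e l)) \<and> finite (range (\<lambda>e. vpow G \<beta> e r))"
proof (induction r)
  case (Suc r)
  let ?t = "q ^ k"
  obtain \<beta> where \<beta>: "\<beta> \<in> {..<r} \<rightarrow> carrier G" "\<And>l. l < r \<Longrightarrow> \<beta> l [^] int ?t = \<one>"
    "\<And>e l. vpow G \<beta> e r = \<one> \<Longrightarrow> l < r \<Longrightarrow> int ?t dvd e l" and fin: "finite (range (\<lambda>e. vpow G \<beta> e r))"
    using Suc.IH by blast
  let ?S = "range (\<lambda>e. vpow G \<beta> e r)"
  obtain b where b: "b \<in> carrier G" "b [^] ?t = \<one>" "b [^] (q ^ (k - 1)) \<notin> ?S"
  proof -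
    \<comment> \<open>Finiteness of \<open>?S\<close>, the subgroup generated so far, is carried
      through the induction for the sake of this choice.\<close>
    have "\<not> (\<lambda>b. b [^] (q ^ (k - 1))) ` {b \<in> carrier G. b [^] ?t = \<one>} \<subseteq> ?S"
      using inf fin by (meson finite_subset)
    thus ?thesis using that by auto
  qed
  have bt: "b [^] int ?t = \<one>" using b(2) by (simp only: int_pow_int)
  define \<beta>' where "\<beta>' = \<beta>(r := b)"
  have vpow': "vpow G \<beta>' e (Suc r) = vpow G \<beta> e r \<otimes> b [^] e r" for e
  proof -
    have "vpow G \<beta>' e r = vpow G \<beta> e r" by (rule vpow_cong) (simp add: \<beta>'_def)
    thus ?thesis by (simp add: \<beta>'_def)
  qed
  have 1: "\<beta>' \<in> {..<Suc r} \<rightarrow> carrier G" using \<beta>(1) b(1) by (auto simp: \<beta>'_def less_Suc_eq)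
  have 2: "\<beta>' l [^] int ?t = \<one>" if "l < Suc r" for l
    using that \<beta>(2) bt by (auto simp: \<beta>'_def less_Suc_eq)
  have 3: "int ?t dvd e l" if e: "vpow G \<beta>' e (Suc r) = \<one>" and l: "l < Suc r" for e l
  proof -
    have "vpow G \<beta> e r \<otimes> b [^] e r = \<one>" using e by (simp only: vpow')
    hence "b [^] e r = inv (vpow G \<beta> e r)"
      using \<beta>(1) b(1) by (metis inv_equality inv_inv int_pow_closed vpow_closed)
    hence ber: "b [^] e r = vpow G \<beta> (\<lambda>i. - e i) r" by (simp add: vpow_neg[OF \<beta>(1)])
    \<comment> \<open>Otherwise the gcd of \<open>e r\<close> and \<open>q ^ k\<close> divides
      \<open>q ^ (k - 1)\<close>. By Bezout the power \<open>q ^ (k - 1)\<close> of \<open>b\<close>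
      is then a power of \<open>b [^] e r\<close>, which lies in \<open>?S\<close>.\<close>
    have t_dvd: "int ?t dvd e r"
    proof (rule ccontr)
      assume nd: "\<not> int ?t dvd e r"
      define g where "g = gcd (e r) (int ?t)"
      have "nat g dvd ?t" unfolding g_def by (metis gcd_dvd2 gcd_ge_0_int int_dvd_int_iff int_nat_eq)
      then obtain i where i: "nat g = q ^ i" "i \<le> k" using q divides_primepow_nat by blast
      have "g = int (nat g)" by (simp add: g_def)
      hence g: "g = int (q ^ i)" by (simp only: i(1))
      have "i \<noteq> k" using nd g by (metis g_def gcd_dvd1)
      hence "q ^ i dvd q ^ (k - 1)" using i(2) by (intro le_imp_power_dvd) simp
      then obtain h where h: "q ^ (k - 1) = q ^ i * h" by blast
      obtain u v where uv: "u * e r + v * int ?t = g" using bezout_int[of "e r" "int ?t"] unfolding g_def by blast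
      have "int (q ^ (k - 1)) = g * int h" by (simp only: g h of_nat_mult)
      also have "\<dots> = e r * (u * int h) + int ?t * (v * int h)" by (simp add: uv[symmetric] algebra_simps)
      finally have "b [^] int (q ^ (k - 1)) = (b [^] e r) [^] (u * int h) \<otimes> (b [^] int ?t) [^] (v * int h)"
        using b(1) by (simp only: int_pow_pow int_pow_mult)
      also have "\<dots> = vpow G \<beta> (\<lambda>i. - e i) r [^] (u * int h)"
        using \<beta>(1) by (simp add: bt[simplified] ber)
      also have "\<dots> \<in> ?S" unfolding vpow_int_pow[OF \<beta>(1)] by blast
      finally show False using b(3) by (simp only: int_pow_int)
    qed
    then obtain h where "e r = int ?t * h" by blast
    hence "b [^] e r = (b [^] int ?t) [^] h" using b(1) by (simp only: int_pow_pow)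
    hence "b [^] e r = \<one>" by (simp only: bt int_pow_one)
    hence "vpow G \<beta> e r = \<one>" using e \<beta>(1) by (simp only: vpow') simp
    thus ?thesis using \<beta>(3) t_dvd l by (auto simp: less_Suc_eq)
  qed
  have "range (\<lambda>e. vpow G \<beta>' e (Suc r)) \<subseteq> (\<lambda>(x, j). x \<otimes> b [^] j) ` (?S \<times> {0..<int ?t})"
  proof clarify
    fix e
    have t0: "int ?t > 0" using q by (simp add: prime_gt_0_nat)
    have "b [^] e r = b [^] (int ?t * (e r div int ?t) + e r mod int ?t)" by simp
    also have "\<dots> = (b [^] int ?t) [^] (e r div int ?t) \<otimes> b [^] (e r mod int ?t)"
      using b(1) by (simp only: int_pow_pow int_pow_mult)
    also have "\<dots> = b [^] (e r mod int ?t)" using b(1) by (simp only: bt int_pow_one) simp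
    finally have "vpow G \<beta>' e (Suc r) = (\<lambda>(x, j). x \<otimes> b [^] j) (vpow G \<beta> e r, e r mod int ?t)"
      by (simp only: vpow' prod.case)
    moreover have "(vpow G \<beta> e r, e r mod int ?t) \<in> ?S \<times> {0..<int ?t}"
      using t0 by simp
    ultimately show "vpow G \<beta>' e (Suc r) \<in> (\<lambda>(x, j). x \<otimes> b [^] j) ` (?S \<times> {0..<int ?t})"
      by (rule image_eqI)
  qed
  hence 4: "finite (range (\<lambda>e. vpow G \<beta>' e (Suc r)))" by (rule finite_subset) (simp add: fin)
  show ?case using 1 2 3 4 by blast
qed simp

text \<open>Since Fourier inversion divides by n', one prime power of \<open>m\<close> is treated at
  a time, with the prime itself removed from n' by means of independent elements.\<close>

lemma expo_dvd_fibre_sum: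
  fixes s :: "'t \<Rightarrow> int" and V :: "'t \<Rightarrow> nat \<Rightarrow> int" and m :: nat
  assumes T: "finite T"
    and cond: "m = 0 \<or> expo G = 0 \<or> (\<forall>p. prime p \<and> p dvd m \<and> p dvd expo G \<longrightarrow>
      infinite (carrier (torsion_factor G (p ^ multiplicity p (expo G)) (p ^ (multiplicity p (expo G) - 1)))))"
    and H: "\<And>b c. b \<in> {..<r} \<rightarrow> carrier G \<Longrightarrow> c \<in> carrier G \<Longrightarrow> int m dvd (\<Sum>t | t \<in> T \<and> vpow G b (V t) r = c. s t)"
  shows "int m dvd (\<Sum>t | t \<in> T \<and> (\<forall>l<r. int (expo G) dvd V t l - U l). s t)" (is "_ dvd ?F")
proof (cases "expo G = 0")
  case True
  thus ?thesis using dvd_fibre_sum_infinite_exponent[OF T True H, of U] by simp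
next
  case False
  hence n0: "expo G > 0" by simp
  have coprime_case: "M dvd ?F" if "M dvd int m" "M = 0 \<or> coprime M (int (expo G))" for M
  proof (rule dvd_fibre_sum_finite_exponent[OF T n0, of 1 "expo G" M "\<lambda>_. \<one>"])
    fix b c assume "b \<in> {..<r} \<rightarrow> carrier G" "c \<in> carrier G"
    from dvd_trans[OF that(1) H[OF this]] show "M dvd (\<Sum>t | t \<in> T \<and> vpow G b (V t) r = c. s t)" .
  qed (use that in auto)
  show ?thesis
  proof (cases "m = 0")
    case True
    thus ?thesis using coprime_case[of 0] by simp
  next
    case False
    have "int (p ^ multiplicity p m) dvd ?F" if p: "prime p" for p
    proof (cases "p dvd m \<and> p dvd expo G")
      case False
      show ?thesis
      proof (rule coprime_case)
        show "int (p ^ multiplicity p m) dvd int m" by (simp only: int_dvd_int_iff multiplicity_dvd)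
        have "coprime (p ^ multiplicity p m) (expo G)"
          using False p by (cases "p dvd m") (auto simp: not_dvd_imp_multiplicity_0 prime_imp_coprime)
        thus "int (p ^ multiplicity p m) = 0 \<or> coprime (int (p ^ multiplicity p m)) (int (expo G))"
          by (simp only: coprime_int_iff) simp
      qed
    next
      case True
      let ?k = "multiplicity p (expo G)"
      have k: "?k > 0" using True p n0 by (simp add: prime_multiplicity_gt_zero_iff)
      have "infinite (carrier (torsion_factor G (p ^ ?k) (p ^ (?k - 1))))"
        using cond True p False \<open>m \<noteq> 0\<close> n0 by auto
      then obtain \<beta> where \<beta>: "\<beta> \<in> {..<r} \<rightarrow> carrier G" "\<And>l. l < r \<Longrightarrow> \<beta> l [^] int (p ^ ?k) = \<one>"
        "\<And>e l. vpow G \<beta> e r = \<one> \<Longrightarrow> l < r \<Longrightarrow> int (p ^ ?k) dvd e l"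
        using ex_independent_torsion_elements[OF p k, of r] unfolding infinite_torsion_factor_iff by blast
      obtain n' where n': "expo G = p ^ ?k * n'" "\<not> p dvd n'"
        using multiplicity_decompose'[of "expo G" p] n0 p by (metis bot_nat_0.extremum_strict not_prime_unit)
      have cop: "coprime (p ^ i) n'" for i using n'(2) p by (simp add: prime_imp_coprime)
      have "coprime (int (p ^ multiplicity p m)) (int n')" using cop by (simp only: coprime_int_iff)
      hence M: "int (p ^ multiplicity p m) = 0 \<or> coprime (int (p ^ multiplicity p m)) (int n')" ..
      show ?thesis
      proof (rule dvd_fibre_sum_finite_exponent[OF T n0 n'(1) cop M \<beta>(1)])
        show "\<beta> l [^] int (p ^ ?k) = \<one>" if "l < r" for l using that by (rule \<beta>(2))
        show "int (p ^ ?k) dvd e l" if "vpow G \<beta> e r = \<one>" "l < r" for e l using that by (rule \<beta>(3))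
      next
        fix b c assume "b \<in> {..<r} \<rightarrow> carrier G" "c \<in> carrier G"
        from H[OF this] show "int (p ^ multiplicity p m) dvd (\<Sum>t | t \<in> T \<and> vpow G b (V t) r = c. s t)"
          by (rule dvd_trans[rotated]) (simp only: int_dvd_int_iff multiplicity_dvd)
      qed
    qed
    hence *: "p ^ multiplicity p m dvd nat \<bar>?F\<bar>" if "prime p" for p
      using that by (simp only: dvd_nat_abs_iff)
    \<comment> \<open>Multiplicities say nothing about 0, so a vanishing sum is set apart.\<close>
    have "m dvd nat \<bar>?F\<bar>"
    proof (cases "?F = 0")
      case False
      show ?thesis
      proof (rule multiplicity_le_imp_dvd[OF \<open>m \<noteq> 0\<close>])
        fix p :: nat assume p: "prime p"
        have "\<not> is_unit p" using p not_prime_unit by blast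
        with False * [OF p] show "multiplicity p m \<le> multiplicity p (nat \<bar>?F\<bar>)"
          by (intro multiplicity_geI) simp_all
      qed
    qed simp
    thus ?thesis by (simp only: dvd_nat_abs_iff)
  qed
qed

end

text \<open>Passes from values in \<open>B\<close> to exponent vectors. The index set consists of
  the entries of \<open>fox w\<close> belonging to variable \<open>i\<close>, weighted by their
  signs.\<close>

lemma expo_dvd_scount_fox_mod:
  assumes A: "comm_group A" and B: "comm_group B" and W: "W = cartesian_wreath A B \<or> W = direct_wreath A B"
    and law: "satisfies_law W w" and r: "fst ` set w \<subseteq> {..<r}"
    and cond: "expo A = 0 \<or> expo B = 0 \<or> (\<forall>p. prime p \<and> p dvd expo A \<and> p dvd expo B \<longrightarrow>
      infinite (carrier (torsion_factor B (p ^ multiplicity p (expo B)) (p ^ (multiplicity p (expo B) - 1)))))"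
  shows "int (expo A) dvd scount (\<lambda>(j, v). j = i \<and> (\<forall>l<r. int (expo B) dvd wexp v l - U l)) (fox w)"
    and "int (expo B) dvd wexp w l"
proof -
  interpret A: unextended_comm_group A using A by (simp add: unextended_comm_group_def)
  interpret B: unextended_comm_group B using B by (simp add: unextended_comm_group_def)
  show "int (expo B) dvd wexp w l"
    using expo_dvd_scount_fox(2)[OF A.is_group B.is_group W law _ B.one_closed]
    by (intro B.expo_dvd_wexp) (simp add: satisfies_law_def)
  define T where "T = {t \<in> {..<length (fox w)}. fst (fst (fox w ! t)) = i}"
  define V where "V t = wexp (snd (fst (fox w ! t)))" for t
  define s where "s t = (if snd (fox w ! t) then 1 else - 1 :: int)" for t
  have "int (expo A) dvd (\<Sum>t | t \<in> T \<and> (\<forall>l<r. int (expo B) dvd V t l - U l). s t)"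
  proof (rule B.expo_dvd_fibre_sum[OF _ cond])
    fix b c assume b: "b \<in> {..<r} \<rightarrow> carrier B" and c: "c \<in> carrier B"
    \<comment> \<open>The assignment is given below \<open>r\<close> only; its extension by the
      identity is not seen by the prefixes of \<open>w\<close>.\<close>
    define b' where "b' i = (if i < r then b i else \<one>\<^bsub>B\<^esub>)" for i
    have b': "b' \<in> UNIV \<rightarrow> carrier B" using b by (auto simp: b'_def)
    have "eval_word B b' (snd (fst (fox w ! t))) = vpow B b (V t) r" if "t < length (fox w)" for t
    proof -
      obtain j u s where t: "fox w ! t = ((j, u), s)" by (cases "fox w ! t") auto
      have "((j, u), s) \<in> set (fox w)" using that t nth_mem by metis
      hence "fst ` set u \<subseteq> {..<r}" using fox_vars r by blast
      hence "eval_word B b' u = vpow B b' (wexp u) r" by (rule B.eval_word_eq_vpow[OF b'])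
      also have "\<dots> = vpow B b (wexp u) r" by (rule B.vpow_cong) (simp add: b'_def)
      finally show ?thesis by (simp add: t V_def)
    qed
    hence "{t \<in> {..<length (fox w)}. (\<lambda>(j, u). j = i \<and> eval_word B b' u = c) (fst (fox w ! t))}
      = {t. t \<in> T \<and> vpow B b (V t) r = c}"
      by (auto simp: T_def case_prod_beta)
    thus "int (expo A) dvd (\<Sum>t | t \<in> T \<and> vpow B b (V t) r = c. s t)"
      using expo_dvd_scount_fox(1)[OF A.is_group B.is_group W law b' c, of i]
      unfolding scount_eq_sum s_def by simp
  qed (simp add: T_def)
  moreover have "{t \<in> {..<length (fox w)}. (\<lambda>(j, v). j = i \<and> (\<forall>l<r. int (expo B) dvd wexp v l - U l)) (fst (fox w ! t))}
      = {t. t \<in> T \<and> (\<forall>l<r. int (expo B) dvd V t l - U l)}"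
    by (auto simp: T_def V_def case_prod_beta)
  ultimately show "int (expo A) dvd scount (\<lambda>(j, v). j = i \<and> (\<forall>l<r. int (expo B) dvd wexp v l - U l)) (fox w)"
    unfolding scount_eq_sum s_def by simp
qed

section \<open>Iterated commutators\<close>

text \<open>The element 1 - d of the group ring of \<open>B\<close> acting on functions, in
  multiplicative notation.\<close>

definition wdelta :: "'a monoid \<Rightarrow> 'b monoid \<Rightarrow> 'b \<Rightarrow> ('b \<Rightarrow> 'a) \<Rightarrow> 'b \<Rightarrow> 'a" where
  "wdelta A B d f = (\<lambda>x\<in>carrier B. f x \<otimes>\<^bsub>A\<^esub> inv\<^bsub>A\<^esub> (f (inv\<^bsub>B\<^esub> d \<otimes>\<^bsub>B\<^esub> x)))"

lemma wdelta_closed: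
  assumes "group A" "group B" "f \<in> carrier B \<rightarrow>\<^sub>E carrier A" "d \<in> carrier B"
  shows "wdelta A B d f \<in> carrier B \<rightarrow>\<^sub>E carrier A"
proof -
  interpret A: group A by fact
  interpret B: group B by fact
  show ?thesis using assms(3,4) by (auto simp: wdelta_def PiE_iff)
qed

lemma funpow_wdelta_closed:
  assumes "group A" "group B" "f \<in> carrier B \<rightarrow>\<^sub>E carrier A" "d \<in> carrier B"
  shows "(wdelta A B d ^^ j) f \<in> carrier B \<rightarrow>\<^sub>E carrier A"
  by (induction j) (simp_all add: wdelta_closed assms)

lemma fold_wdelta_closed:
  assumes "group A" "group B" "f \<in> carrier B \<rightarrow>\<^sub>E carrier A" "set ds \<subseteq> carrier B"
  shows "fold (wdelta A B) ds f \<in> carrier B \<rightarrow>\<^sub>E carrier A"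
  using assms(3,4) by (induction ds arbitrary: f) (simp_all add: wdelta_closed assms(1,2))

lemma wdelta_commute:
  assumes "comm_group A" "comm_group B" "f \<in> carrier B \<rightarrow>\<^sub>E carrier A" "d \<in> carrier B" "e \<in> carrier B"
  shows "wdelta A B d (wdelta A B e f) = wdelta A B e (wdelta A B d f)"
proof -
  interpret A: comm_group A by fact
  interpret B: comm_group B by fact
  show ?thesis unfolding wdelta_def
  proof (rule restrict_ext)
    fix x assume x: "x \<in> carrier B"
    have [simp]: "f y \<in> carrier A" if "y \<in> carrier B" for y using assms(3) that by auto
    have "inv\<^bsub>B\<^esub> e \<otimes>\<^bsub>B\<^esub> (inv\<^bsub>B\<^esub> d \<otimes>\<^bsub>B\<^esub> x) = inv\<^bsub>B\<^esub> d \<otimes>\<^bsub>B\<^esub> (inv\<^bsub>B\<^esub> e \<otimes>\<^bsub>B\<^esub> x)"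
      using assms(4,5) x by (simp add: B.m_lcomm)
    thus "(\<lambda>x\<in>carrier B. f x \<otimes>\<^bsub>A\<^esub> inv\<^bsub>A\<^esub> f (inv\<^bsub>B\<^esub> e \<otimes>\<^bsub>B\<^esub> x)) x \<otimes>\<^bsub>A\<^esub>
        inv\<^bsub>A\<^esub> (\<lambda>x\<in>carrier B. f x \<otimes>\<^bsub>A\<^esub> inv\<^bsub>A\<^esub> f (inv\<^bsub>B\<^esub> e \<otimes>\<^bsub>B\<^esub> x)) (inv\<^bsub>B\<^esub> d \<otimes>\<^bsub>B\<^esub> x) =
      (\<lambda>x\<in>carrier B. f x \<otimes>\<^bsub>A\<^esub> inv\<^bsub>A\<^esub> f (inv\<^bsub>B\<^esub> d \<otimes>\<^bsub>B\<^esub> x)) x \<otimes>\<^bsub>A\<^esub>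
        inv\<^bsub>A\<^esub> (\<lambda>x\<in>carrier B. f x \<otimes>\<^bsub>A\<^esub> inv\<^bsub>A\<^esub> f (inv\<^bsub>B\<^esub> d \<otimes>\<^bsub>B\<^esub> x)) (inv\<^bsub>B\<^esub> e \<otimes>\<^bsub>B\<^esub> x)"
      using assms(4,5) x by (simp add: A.inv_mult A.m_ac)
  qed
qed

lemma funpow_wdelta_commute:
  assumes "comm_group A" "comm_group B" "f \<in> carrier B \<rightarrow>\<^sub>E carrier A" "d \<in> carrier B" "e \<in> carrier B"
  shows "(wdelta A B d ^^ j) (wdelta A B e f) = wdelta A B e ((wdelta A B d ^^ j) f)"
proof (induction j)
  case (Suc j)
  have "(wdelta A B d ^^ j) f \<in> carrier B \<rightarrow>\<^sub>E carrier A"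
    using assms by (intro funpow_wdelta_closed) (auto simp: comm_group_def)
  thus ?case using Suc wdelta_commute[OF assms(1,2) _ assms(4,5)] by simp
qed simp

text \<open>The operators commute, so \<open>j\<close> occurrences of \<open>d\<close> can be
  applied before all others.\<close>

lemma fold_wdelta_extract:
  assumes AB: "comm_group A" "comm_group B" and d: "d \<in> carrier B"
    and "f \<in> carrier B \<rightarrow>\<^sub>E carrier A" "set ds \<subseteq> carrier B" "j \<le> count_list ds d"
  shows "\<exists>es. set es \<subseteq> carrier B \<and> fold (wdelta A B) ds f = fold (wdelta A B) es ((wdelta A B d ^^ j) f)"
  using assms(4-6)
proof (induction ds arbitrary: f j)
  case Nil
  thus ?case by (intro exI[of _ "[]"]) simp
next
  case (Cons e ds)
  have e: "e \<in> carrier B" using Cons.prems by simp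
  have ef: "wdelta A B e f \<in> carrier B \<rightarrow>\<^sub>E carrier A"
    using Cons.prems AB by (intro wdelta_closed) (auto simp: comm_group_def)
  show ?case
  proof (cases "e = d \<and> j > 0")
    case True
    then obtain i where i: "j = Suc i" by (cases j) auto
    have "i \<le> count_list ds d" using Cons.prems(3) True i by simp
    from Cons.IH[OF ef _ this] Cons.prems(2) obtain es where
      "set es \<subseteq> carrier B" "fold (wdelta A B) ds (wdelta A B e f) = fold (wdelta A B) es ((wdelta A B d ^^ i) (wdelta A B e f))"
      by auto
    thus ?thesis using True i by (intro exI[of _ es]) (simp add: funpow_swap1)
  next
    case False
    hence "j \<le> count_list ds d" using Cons.prems(3) by (auto split: if_splits)
    from Cons.IH[OF ef _ this] Cons.prems(2) obtain es where
      "set es \<subseteq> carrier B" "fold (wdelta A B) ds (wdelta A B e f) = fold (wdelta A B) es ((wdelta A B d ^^ j) (wdelta A B e f))"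
      by auto
    thus ?thesis using e funpow_wdelta_commute[OF AB Cons.prems(1) d e, of j]
      by (intro exI[of _ "e # es"]) simp
  qed
qed

text \<open>The binomial theorem for (1 - d)^j in the group ring; Pascal's rule merges the two
  products of the induction step.\<close>

lemma funpow_wdelta_binomial:
  assumes AB: "comm_group A" "comm_group B" and f: "f \<in> carrier B \<rightarrow>\<^sub>E carrier A" and d: "d \<in> carrier B"
    and x: "x \<in> carrier B"
  shows "(wdelta A B d ^^ j) f x =
    finprod A (\<lambda>k. f (inv\<^bsub>B\<^esub> d [^]\<^bsub>B\<^esub> k \<otimes>\<^bsub>B\<^esub> x) [^]\<^bsub>A\<^esub> ((- 1) ^ k * int (j choose k))) {..j}"
proof -
  interpret A: comm_group A by (rule AB)
  interpret B: comm_group B by (rule AB)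
  define y where "y = inv\<^bsub>B\<^esub> d"
  have y: "y \<in> carrier B" using d by (simp add: y_def)
  have fc [simp]: "f z \<in> carrier A" if "z \<in> carrier B" for z using f that by auto
  show ?thesis unfolding y_def[symmetric] using x
  proof (induction j arbitrary: x)
    case 0
    thus ?case using y by simp
  next
    case (Suc j)
    define a where "a k = f (y [^]\<^bsub>B\<^esub> k \<otimes>\<^bsub>B\<^esub> x)" for k :: nat
    have a [simp]: "a k \<in> carrier A" for k using y Suc.prems by (simp add: a_def)
    have yx: "y \<otimes>\<^bsub>B\<^esub> x \<in> carrier B" using y Suc.prems by simp
    have shift: "f (y [^]\<^bsub>B\<^esub> k \<otimes>\<^bsub>B\<^esub> (y \<otimes>\<^bsub>B\<^esub> x)) = a (Suc k)" for k :: nat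
      using y Suc.prems by (simp add: a_def B.m_assoc)
    let ?c = "\<lambda>j k. (- 1) ^ k * int (j choose k)"
    \<comment> \<open>Extending the product to \<open>Suc j\<close>, where the binomial coefficient
      is 0, allows its first factor to be split off and aligns it with the shifted product.\<close>
    have 1: "finprod A (\<lambda>k. a k [^]\<^bsub>A\<^esub> ?c j k) {..j} =
      finprod A (\<lambda>k. a (Suc k) [^]\<^bsub>A\<^esub> ?c j (Suc k)) {..j} \<otimes>\<^bsub>A\<^esub> a 0"
    proof -
      have "finprod A (\<lambda>k. a k [^]\<^bsub>A\<^esub> ?c j k) {..Suc j} = finprod A (\<lambda>k. a k [^]\<^bsub>A\<^esub> ?c j k) {..j}"
        by (subst A.finprod_Suc) (auto intro!: A.finprod_closed simp: binomial_eq_0)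
      moreover have "finprod A (\<lambda>k. a k [^]\<^bsub>A\<^esub> ?c j k) {..Suc j} =
        finprod A (\<lambda>k. a (Suc k) [^]\<^bsub>A\<^esub> ?c j (Suc k)) {..j} \<otimes>\<^bsub>A\<^esub> a 0"
        by (subst A.finprod_Suc2) auto
      ultimately show ?thesis by simp
    qed
    have 2: "inv\<^bsub>A\<^esub> finprod A (\<lambda>k. a (Suc k) [^]\<^bsub>A\<^esub> ?c j k) {..j} = finprod A (\<lambda>k. a (Suc k) [^]\<^bsub>A\<^esub> (- ?c j k)) {..j}"
    proof (rule A.inv_equality)
      have "finprod A (\<lambda>k. a (Suc k) [^]\<^bsub>A\<^esub> (- ?c j k)) {..j} \<otimes>\<^bsub>A\<^esub> finprod A (\<lambda>k. a (Suc k) [^]\<^bsub>A\<^esub> ?c j k) {..j}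
        = finprod A (\<lambda>k. a (Suc k) [^]\<^bsub>A\<^esub> (- ?c j k) \<otimes>\<^bsub>A\<^esub> a (Suc k) [^]\<^bsub>A\<^esub> ?c j k) {..j}"
        by (rule A.finprod_multf[symmetric]) auto
      also have "\<dots> = \<one>\<^bsub>A\<^esub>" by (rule A.finprod_one_eqI) (simp add: A.int_pow_neg)
      finally show "finprod A (\<lambda>k. a (Suc k) [^]\<^bsub>A\<^esub> (- ?c j k)) {..j} \<otimes>\<^bsub>A\<^esub> finprod A (\<lambda>k. a (Suc k) [^]\<^bsub>A\<^esub> ?c j k) {..j} = \<one>\<^bsub>A\<^esub>" .
    qed (auto intro!: A.finprod_closed)
    have "(wdelta A B d ^^ Suc j) f x = (wdelta A B d ^^ j) f x \<otimes>\<^bsub>A\<^esub> inv\<^bsub>A\<^esub> ((wdelta A B d ^^ j) f (y \<otimes>\<^bsub>B\<^esub> x))"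
      using Suc.prems by (simp add: wdelta_def y_def)
    also have "\<dots> = finprod A (\<lambda>k. a k [^]\<^bsub>A\<^esub> ?c j k) {..j} \<otimes>\<^bsub>A\<^esub> inv\<^bsub>A\<^esub> finprod A (\<lambda>k. a (Suc k) [^]\<^bsub>A\<^esub> ?c j k) {..j}"
      unfolding Suc.IH[OF Suc.prems] Suc.IH[OF yx] shift by (simp only: a_def)
    also have "\<dots> = finprod A (\<lambda>k. a (Suc k) [^]\<^bsub>A\<^esub> ?c j (Suc k)) {..j} \<otimes>\<^bsub>A\<^esub> a 0 \<otimes>\<^bsub>A\<^esub> finprod A (\<lambda>k. a (Suc k) [^]\<^bsub>A\<^esub> (- ?c j k)) {..j}"
      by (simp only: 1 2)
    also have "\<dots> = finprod A (\<lambda>k. a (Suc k) [^]\<^bsub>A\<^esub> ?c j (Suc k)) {..j} \<otimes>\<^bsub>A\<^esub> finprod A (\<lambda>k. a (Suc k) [^]\<^bsub>A\<^esub> (- ?c j k)) {..j} \<otimes>\<^bsub>A\<^esub> a 0"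
      by (simp add: A.m_ac A.finprod_closed Pi_iff)
    also have "finprod A (\<lambda>k. a (Suc k) [^]\<^bsub>A\<^esub> ?c j (Suc k)) {..j} \<otimes>\<^bsub>A\<^esub> finprod A (\<lambda>k. a (Suc k) [^]\<^bsub>A\<^esub> (- ?c j k)) {..j}
      = finprod A (\<lambda>k. a (Suc k) [^]\<^bsub>A\<^esub> ?c j (Suc k) \<otimes>\<^bsub>A\<^esub> a (Suc k) [^]\<^bsub>A\<^esub> (- ?c j k)) {..j}"
      by (rule A.finprod_multf[symmetric]) auto
    also have "\<dots> = finprod A (\<lambda>k. a (Suc k) [^]\<^bsub>A\<^esub> ?c (Suc j) (Suc k)) {..j}"
      by (intro A.finprod_cong') (auto simp: algebra_simps simp flip: A.int_pow_mult)
    also have "\<dots> \<otimes>\<^bsub>A\<^esub> a 0 = finprod A (\<lambda>k. a k [^]\<^bsub>A\<^esub> ?c (Suc j) k) {..Suc j}"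
      by (subst A.finprod_Suc2) auto
    finally show ?case by (simp only: a_def)
  qed
qed

text \<open>Since \<open>p\<close> divides the inner binomial coefficients, \<open>(1 - T)\<^sup>p\<close> agrees with \<open>1 - T\<^sup>p\<close> on
  functions whose values have order dividing \<open>p\<close>; for \<open>p = 2\<close> signs do not matter.\<close>

lemma funpow_prime_wdelta:
  assumes AB: "comm_group A" "comm_group B" and f: "f \<in> carrier B \<rightarrow>\<^sub>E carrier A" and d: "d \<in> carrier B"
    and p: "prime (p::nat)" and dp: "d [^]\<^bsub>B\<^esub> p = \<one>\<^bsub>B\<^esub>" and fp: "\<And>x. x \<in> carrier B \<Longrightarrow> f x [^]\<^bsub>A\<^esub> p = \<one>\<^bsub>A\<^esub>"
  shows "(wdelta A B d ^^ p) f = (\<lambda>x\<in>carrier B. \<one>\<^bsub>A\<^esub>)"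
proof -
  interpret A: comm_group A by (rule AB)
  interpret B: comm_group B by (rule AB)
  have fc [simp]: "f z \<in> carrier A" if "z \<in> carrier B" for z using f that by auto
  have fpk: "f z [^]\<^bsub>A\<^esub> k = \<one>\<^bsub>A\<^esub>" if z: "z \<in> carrier B" and k: "int p dvd k" for z and k :: int
  proof -
    obtain q where "k = int p * q" using k by blast
    thus ?thesis using z fp[OF z] by (simp add: int_pow_int flip: A.int_pow_pow)
  qed
  have "(wdelta A B d ^^ p) f x = \<one>\<^bsub>A\<^esub>" if x: "x \<in> carrier B" for x
  proof -
    define a where "a k = f (inv\<^bsub>B\<^esub> d [^]\<^bsub>B\<^esub> k \<otimes>\<^bsub>B\<^esub> x) [^]\<^bsub>A\<^esub> ((- 1) ^ k * int (p choose k))" for k :: nat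
    \<comment> \<open>With \<open>p = p' + 2\<close> the first and last factors separate from the
      \<open>p' + 1\<close> inner ones.\<close>
    obtain p' where p': "p = Suc (Suc p')" using prime_ge_2_nat[OF p] by (metis add_2_eq_Suc le_Suc_ex)
    have ac: "a k \<in> carrier A" for k using x d by (simp add: a_def)
    have mid: "a (Suc k) = \<one>\<^bsub>A\<^esub>" if "k \<le> p'" for k
    proof -
      have "p dvd (p choose Suc k)" using p that p' by (intro dvd_choose_prime) auto
      hence "int p dvd (- 1) ^ Suc k * int (p choose Suc k)" by (simp only: dvd_mult int_dvd_int_iff)
      thus ?thesis unfolding a_def using x d by (intro fpk) simp_all
    qed
    have a0: "a 0 = f x" using x by (simp add: a_def)
    have ap: "a p = f x [^]\<^bsub>A\<^esub> ((- 1) ^ p :: int)"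
      using x d dp by (simp add: a_def B.nat_pow_inv)
    have "(wdelta A B d ^^ p) f x = finprod A a {..Suc (Suc p')}"
      unfolding funpow_wdelta_binomial[OF AB f d x] a_def p' ..
    also have "\<dots> = finprod A (\<lambda>k. a (Suc k)) {..Suc p'} \<otimes>\<^bsub>A\<^esub> a 0"
      using ac by (intro A.finprod_Suc2) simp
    also have "finprod A (\<lambda>k. a (Suc k)) {..Suc p'} = a p \<otimes>\<^bsub>A\<^esub> finprod A (\<lambda>k. a (Suc k)) {..p'}"
      using ac by (subst A.finprod_Suc) (simp_all add: p')
    also have "finprod A (\<lambda>k. a (Suc k)) {..p'} = \<one>\<^bsub>A\<^esub>" using mid by (intro A.finprod_one_eqI) simp
    also have "a p \<otimes>\<^bsub>A\<^esub> \<one>\<^bsub>A\<^esub> \<otimes>\<^bsub>A\<^esub> a 0 = f x [^]\<^bsub>A\<^esub> ((- 1) ^ p + 1 :: int)"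
      using x ac by (simp add: a0 ap A.int_pow_mult)
    \<comment> \<open>The sum is 0 for odd \<open>p\<close> and 2 for \<open>p = 2\<close>.\<close>
    also have "int p dvd (- 1) ^ p + 1"
      using prime_odd_nat[OF p] prime_ge_2_nat[OF p] by (cases "p = 2") auto
    hence "f x [^]\<^bsub>A\<^esub> ((- 1) ^ p + 1 :: int) = \<one>\<^bsub>A\<^esub>" using x by (intro fpk)
    finally show ?thesis .
  qed
  moreover have "(wdelta A B d ^^ p) f \<in> carrier B \<rightarrow>\<^sub>E carrier A"
    using A.is_group B.is_group f d by (rule funpow_wdelta_closed)
  ultimately show ?thesis by (intro extensionalityI[of _ "carrier B"]) (auto simp: PiE_iff)
qed

lemma fold_wdelta_eq_one:
  assumes AB: "comm_group A" "comm_group B" and f: "f \<in> carrier B \<rightarrow>\<^sub>E carrier A"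
    and p: "prime (p::nat)" and fp: "\<And>x. x \<in> carrier B \<Longrightarrow> f x [^]\<^bsub>A\<^esub> p = \<one>\<^bsub>A\<^esub>"
    and D: "finite D" "D \<subseteq> {d \<in> carrier B. d [^]\<^bsub>B\<^esub> p = \<one>\<^bsub>B\<^esub>}"
    and ds: "set ds \<subseteq> D" "length ds \<ge> card D * p" "ds \<noteq> []"
  shows "fold (wdelta A B) ds f = (\<lambda>x\<in>carrier B. \<one>\<^bsub>A\<^esub>)"
proof -
  interpret A: comm_group A by (rule AB)
  interpret B: comm_group B by (rule AB)
  have "\<exists>d\<in>D. count_list ds d \<ge> p"
  proof (rule ccontr)
    assume *: "\<not> ?thesis"
    have "length ds = (\<Sum>d\<in>D. count_list ds d)" using sum_count_set[OF ds(1) D(1)] by simp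
    \<comment> \<open>Strictness requires \<open>D\<close> to be nonempty, which
      \<open>ds \<noteq> []\<close> provides.\<close>
    also have "\<dots> < (\<Sum>d\<in>D. p)" using * D(1) ds by (intro sum_strict_mono) auto
    finally show False using ds(2) by simp
  qed
  then obtain d where d: "d \<in> D" "count_list ds d \<ge> p" by blast
  have dB: "d \<in> carrier B" "d [^]\<^bsub>B\<^esub> p = \<one>\<^bsub>B\<^esub>" using d D by auto
  have "set ds \<subseteq> carrier B" using ds D by auto
  from fold_wdelta_extract[OF AB dB(1) f this d(2)] obtain es where es: "set es \<subseteq> carrier B"
    "fold (wdelta A B) ds f = fold (wdelta A B) es ((wdelta A B d ^^ p) f)" by blast
  have one: "fold (wdelta A B) es c = c" if c: "c = (\<lambda>x\<in>carrier B. \<one>\<^bsub>A\<^esub>)" for c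
    using es(1)
  proof (induction es)
    case (Cons e es)
    have "wdelta A B e c = c" using Cons.prems by (auto simp: c wdelta_def intro!: restrict_ext)
    thus ?case using Cons by simp
  qed simp
  note es(2)
  also have "(wdelta A B d ^^ p) f = (\<lambda>x\<in>carrier B. \<one>\<^bsub>A\<^esub>)"
    by (rule funpow_prime_wdelta[OF AB f dB(1) p dB(2) fp])
  also have "fold (wdelta A B) es (\<lambda>x\<in>carrier B. \<one>\<^bsub>A\<^esub>) = (\<lambda>x\<in>carrier B. \<one>\<^bsub>A\<^esub>)"
    by (rule one) simp
  finally show ?thesis .
qed

text \<open>The \<open>d i\<close> are triangular with respect to the \<open>\<chi> l\<close>.
  Before step \<open>j\<close> the support lies in the kernel of \<open>\<chi> j\<close>, which does
  not contain \<open>d j\<close>; the translated copy therefore misses the identity, and the value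
  there survives. Later \<open>\<chi> l\<close> do not see \<open>d j\<close>, so their kernels
  still contain the support.\<close>

lemma fold_wdelta_at_one:
  assumes A: "group A" and B: "group B" and C: "group C" and h: "h \<in> carrier B \<rightarrow>\<^sub>E carrier A"
    and d: "\<And>i. d i \<in> carrier B" and \<chi>: "\<And>l. \<chi> l \<in> hom B C"
    and \<chi>d: "\<And>i. i < r \<Longrightarrow> \<chi> i (d i) \<noteq> \<one>\<^bsub>C\<^esub>" "\<And>i l. i < l \<Longrightarrow> l < r \<Longrightarrow> \<chi> l (d i) = \<one>\<^bsub>C\<^esub>"
    and supp: "\<And>x l. x \<in> carrier B \<Longrightarrow> h x \<noteq> \<one>\<^bsub>A\<^esub> \<Longrightarrow> l < r \<Longrightarrow> \<chi> l x = \<one>\<^bsub>C\<^esub>"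
    and "j \<le> r"
  shows "fold (wdelta A B) (map d [0..<j]) h \<one>\<^bsub>B\<^esub> = h \<one>\<^bsub>B\<^esub> \<and>
    (\<forall>x l. x \<in> carrier B \<longrightarrow> fold (wdelta A B) (map d [0..<j]) h x \<noteq> \<one>\<^bsub>A\<^esub> \<longrightarrow> j \<le> l \<longrightarrow> l < r \<longrightarrow> \<chi> l x = \<one>\<^bsub>C\<^esub>)"
  using assms(10)
proof (induction j)
  case 0
  show ?case using supp by simp
next
  case (Suc j)
  interpret A: group A by (rule A)
  interpret B: group B by (rule B)
  interpret C: group C by (rule C)
  define f where "f = fold (wdelta A B) (map d [0..<j]) h"
  have f: "f \<in> carrier B \<rightarrow>\<^sub>E carrier A" unfolding f_def by (rule fold_wdelta_closed[OF A B h]) (use d in auto)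
  hence fc [simp]: "f x \<in> carrier A" if "x \<in> carrier B" for x using that by auto
  have IH: "f \<one>\<^bsub>B\<^esub> = h \<one>\<^bsub>B\<^esub>" "\<And>x l. x \<in> carrier B \<Longrightarrow> f x \<noteq> \<one>\<^bsub>A\<^esub> \<Longrightarrow> j \<le> l \<Longrightarrow> l < r \<Longrightarrow> \<chi> l x = \<one>\<^bsub>C\<^esub>"
    using Suc unfolding f_def by auto
  have \<chi>_hom: "group_hom B C (\<chi> l)" for l
    using \<chi> B C by (simp add: group_hom_def group_hom_axioms_def)
  have \<chi>c [simp]: "\<chi> l x \<in> carrier C" if "x \<in> carrier B" for l x using group_hom.hom_closed[OF \<chi>_hom that] .
  have \<chi>inv: "\<chi> l (inv\<^bsub>B\<^esub> x) = inv\<^bsub>C\<^esub> (\<chi> l x)" if "x \<in> carrier B" for l x using group_hom.hom_inv[OF \<chi>_hom that] .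
  have \<chi>mult: "\<chi> l (x \<otimes>\<^bsub>B\<^esub> y) = \<chi> l x \<otimes>\<^bsub>C\<^esub> \<chi> l y" if "x \<in> carrier B" "y \<in> carrier B" for l x y
    using group_hom.hom_mult[OF \<chi>_hom that] .
  have step: "fold (wdelta A B) (map d [0..<Suc j]) h x = f x \<otimes>\<^bsub>A\<^esub> inv\<^bsub>A\<^esub> (f (inv\<^bsub>B\<^esub> (d j) \<otimes>\<^bsub>B\<^esub> x))"
    if "x \<in> carrier B" for x using that by (simp add: f_def wdelta_def)
  have "f (inv\<^bsub>B\<^esub> (d j)) = \<one>\<^bsub>A\<^esub>"
  proof (rule ccontr)
    assume "f (inv\<^bsub>B\<^esub> (d j)) \<noteq> \<one>\<^bsub>A\<^esub>"
    hence "inv\<^bsub>C\<^esub> (\<chi> j (d j)) = \<one>\<^bsub>C\<^esub>" using IH(2)[of "inv\<^bsub>B\<^esub> (d j)" j] d Suc.prems by (simp add: \<chi>inv)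
    thus False using \<chi>d(1)[of j] Suc.prems d by (simp add: C.inv_eq_1_iff)
  qed
  hence 1: "fold (wdelta A B) (map d [0..<Suc j]) h \<one>\<^bsub>B\<^esub> = h \<one>\<^bsub>B\<^esub>"
    using step[of "\<one>\<^bsub>B\<^esub>"] d IH(1) fc[of "\<one>\<^bsub>B\<^esub>"] by simp
  have 2: "\<chi> l x = \<one>\<^bsub>C\<^esub>"
    if x: "x \<in> carrier B" and ne: "fold (wdelta A B) (map d [0..<Suc j]) h x \<noteq> \<one>\<^bsub>A\<^esub>" and l: "Suc j \<le> l" "l < r" for x l
  proof (cases "f x = \<one>\<^bsub>A\<^esub>")
    case False
    thus ?thesis using IH(2) x l by simp
  next
    case True
    hence "f (inv\<^bsub>B\<^esub> (d j) \<otimes>\<^bsub>B\<^esub> x) \<noteq> \<one>\<^bsub>A\<^esub>" using ne step[OF x] by auto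
    hence "\<chi> l (inv\<^bsub>B\<^esub> (d j) \<otimes>\<^bsub>B\<^esub> x) = \<one>\<^bsub>C\<^esub>" using IH(2)[of "inv\<^bsub>B\<^esub> (d j) \<otimes>\<^bsub>B\<^esub> x" l] d x l by simp
    thus ?thesis using d x l \<chi>d(2)[of j l] by (simp add: \<chi>mult \<chi>inv)
  qed
  show ?case using 1 2 by blast
qed

section \<open>A law of the given wreath product that fails in a larger one\<close>

lemma snd_eval_word_cartesian_wreath:
  assumes "group A" "group B" and \<sigma>: "\<sigma> \<in> UNIV \<rightarrow> carrier (cartesian_wreath A B)"
  shows "snd (eval_word (cartesian_wreath A B) \<sigma> w) = eval_word B (\<lambda>i. snd (\<sigma> i)) w"
proof -
  have "\<sigma> i \<in> carrier (cartesian_wreath A B)" for i using \<sigma> by auto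
  hence \<sigma>': "fst (\<sigma> i) \<in> carrier B \<rightarrow>\<^sub>E carrier A" "snd (\<sigma> i) \<in> carrier B" for i
    by (simp_all add: carrier_cartesian_wreath mem_Times_iff)
  have "eval_word (cartesian_wreath A B) (\<lambda>i. (fst (\<sigma> i), snd (\<sigma> i))) w =
    ((\<lambda>x\<in>carrier B. sprod A (\<lambda>(i, u). fst (\<sigma> i) (inv\<^bsub>B\<^esub> (eval_word B (\<lambda>i. snd (\<sigma> i)) u) \<otimes>\<^bsub>B\<^esub> x)) (fox w)), eval_word B (\<lambda>i. snd (\<sigma> i)) w)"
    by (rule eval_word_cartesian_wreath[OF assms(1,2) \<sigma>'])
  thus ?thesis by simp
qed

text \<open>Conjugation acts on the abelian base group through \<open>d\<close> alone, so
  \<open>g\<close> cancels and 1 - d is left.\<close>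

lemma commutator_cartesian_wreath:
  assumes "comm_group A" "comm_group B" and f: "f \<in> carrier B \<rightarrow>\<^sub>E carrier A"
    and g: "g \<in> carrier B \<rightarrow>\<^sub>E carrier A" and d: "d \<in> carrier B"
  defines "W \<equiv> cartesian_wreath A B"
  shows "(f, \<one>\<^bsub>B\<^esub>) \<otimes>\<^bsub>W\<^esub> (g, d) \<otimes>\<^bsub>W\<^esub> inv\<^bsub>W\<^esub> (f, \<one>\<^bsub>B\<^esub>) \<otimes>\<^bsub>W\<^esub> inv\<^bsub>W\<^esub> (g, d) = (wdelta A B d f, \<one>\<^bsub>B\<^esub>)"
proof -
  interpret A: comm_group A by fact
  interpret B: comm_group B by fact
  have [simp]: "f x \<in> carrier A" "g x \<in> carrier A" if "x \<in> carrier B" for x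
    using f g that by auto
  have [simp]: "g x \<otimes>\<^bsub>A\<^esub> (inv\<^bsub>A\<^esub> g x \<otimes>\<^bsub>A\<^esub> a) = a" if "x \<in> carrier B" "a \<in> carrier A" for x a
    using that by (simp flip: A.m_assoc)
  show ?thesis
    using d unfolding W_def inv_cartesian_wreath[OF A.is_group B.is_group f B.one_closed]
      inv_cartesian_wreath[OF A.is_group B.is_group g d]
    by (auto simp: mult_cartesian_wreath wdelta_def A.m_ac B.inv_mult simp flip: B.m_assoc intro!: restrict_ext)
qed

lemma nat_pow_cartesian_wreath_base:
  assumes "group A" "group B" and f: "f \<in> carrier B \<rightarrow>\<^sub>E carrier A"
  shows "(f, \<one>\<^bsub>B\<^esub>) [^]\<^bsub>cartesian_wreath A B\<^esub> (e::nat) = ((\<lambda>x\<in>carrier B. f x [^]\<^bsub>A\<^esub> e), \<one>\<^bsub>B\<^esub>)"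
proof -
  interpret A: group A by fact
  interpret B: group B by fact
  show ?thesis
    by (induction e) (auto simp: one_cartesian_wreath mult_cartesian_wreath restrict_def)
qed

text \<open>The inner commutator forces the value into the base group and the power \<open>e\<close>
  gives it order dividing p; the outer commutators then apply the operators 1 - d. Variables 0 and 1
  are spent on the inner commutator, whence the shift by 2.\<close>

primrec iter_comm_word :: "nat \<Rightarrow> nat \<Rightarrow> nat \<Rightarrow> group_word" where
  "iter_comm_word e q 0 = wpow (wcomm [(0, True)] [(1, True)]) e"
| "iter_comm_word e q (Suc j) = wcomm (iter_comm_word e q j) (wpow [(j + 2, True)] q)"

lemma eval_iter_comm_word:
  assumes A: "comm_group A" and B: "comm_group B"
    and \<sigma>: "\<sigma> \<in> UNIV \<rightarrow> carrier (cartesian_wreath A B)"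
    and h: "eval_word (cartesian_wreath A B) \<sigma> (iter_comm_word e q 0) = (h, \<one>\<^bsub>B\<^esub>)" "h \<in> carrier B \<rightarrow>\<^sub>E carrier A"
  shows "eval_word (cartesian_wreath A B) \<sigma> (iter_comm_word e q j) =
    (fold (wdelta A B) (map (\<lambda>i. snd (\<sigma> (i + 2)) [^]\<^bsub>B\<^esub> q) [0..<j]) h, \<one>\<^bsub>B\<^esub>)"
proof (induction j)
  case 0
  show ?case using h(1) by simp
next
  case (Suc j)
  let ?W = "cartesian_wreath A B"
  interpret A: comm_group A by fact
  interpret B: unextended_comm_group B using B by (simp add: unextended_comm_group_def)
  interpret W: unextended_group ?W
    using group_cartesian_wreath[OF A.is_group B.is_group] by (simp add: unextended_group_def)
  have \<sigma>i: "\<sigma> i \<in> carrier ?W" for i using \<sigma> by auto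
  hence snd: "snd (\<sigma> i) \<in> carrier B" for i by (simp add: carrier_cartesian_wreath mem_Times_iff)
  define d where "d = (\<lambda>i. snd (\<sigma> (i + 2)) [^]\<^bsub>B\<^esub> q)"
  have d: "d i \<in> carrier B" for i using snd by (simp add: d_def)
  define f where "f = fold (wdelta A B) (map d [0..<j]) h"
  have f: "f \<in> carrier B \<rightarrow>\<^sub>E carrier A"
    unfolding f_def by (rule fold_wdelta_closed[OF A.is_group B.is_group h(2)]) (use d in auto)
  define y where "y = eval_word ?W \<sigma> (wpow [(j + 2, True)] q)"
  have y: "y \<in> carrier ?W" using \<sigma> by (simp add: y_def)
  have "snd y = d j"
    unfolding y_def snd_eval_word_cartesian_wreath[OF A.is_group B.is_group \<sigma>]
    using snd by (simp add: B.eval_wpow d_def)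
  then obtain g where y_eq: "y = (g, d j)" and g: "g \<in> carrier B \<rightarrow>\<^sub>E carrier A"
    using y by (cases y) (auto simp: carrier_cartesian_wreath)
  have "eval_word ?W \<sigma> (iter_comm_word e q j) = (f, \<one>\<^bsub>B\<^esub>)"
    using Suc.IH by (simp only: f_def d_def)
  hence "eval_word ?W \<sigma> (iter_comm_word e q (Suc j)) = (wdelta A B (d j) f, \<one>\<^bsub>B\<^esub>)"
    unfolding iter_comm_word.simps W.eval_wcomm[OF \<sigma>] y_def[symmetric] y_eq
    using commutator_cartesian_wreath[OF A B f g d] by simp
  thus ?case by (simp add: f_def d_def)
qed

lemma satisfies_law_iter_comm_word:
  fixes A :: "'a monoid" and B :: "'b monoid"
  assumes A: "comm_group A" and B: "comm_group B" and p: "prime p" "p dvd expo A" "p dvd expo B"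
    and m: "expo A > 0" and n: "expo B > 0"
    and D: "D = (\<lambda>b. b [^]\<^bsub>B\<^esub> (expo B div p)) ` carrier B" "finite D"
  shows "satisfies_law (cartesian_wreath A B) (iter_comm_word (expo A div p) (expo B div p) (card D * p))"
  unfolding satisfies_law_def
proof
  let ?W = "cartesian_wreath A B"
  interpret A: unextended_comm_group A using A by (simp add: unextended_comm_group_def)
  interpret B: unextended_comm_group B using B by (simp add: unextended_comm_group_def)
  interpret W: unextended_group ?W
    using group_cartesian_wreath[OF A.is_group B.is_group] by (simp add: unextended_group_def)
  fix \<sigma> :: "nat \<Rightarrow> ('b \<Rightarrow> 'a) \<times> 'b" assume \<sigma>: "\<sigma> \<in> UNIV \<rightarrow> carrier ?W"
  let ?e = "expo A div p" and ?q = "expo B div p" and ?r = "card D * p"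
  have \<sigma>i: "\<sigma> i \<in> carrier ?W" for i using \<sigma> by auto
  hence snd: "snd (\<sigma> i) \<in> carrier B" for i by (simp add: carrier_cartesian_wreath mem_Times_iff)
  hence snd': "(\<lambda>i. snd (\<sigma> i)) \<in> UNIV \<rightarrow> carrier B" by simp
  define z where "z = eval_word ?W \<sigma> (wcomm [(0, True)] [(1, True)])"
  have z: "z \<in> carrier ?W" using \<sigma> by (simp add: z_def)
  \<comment> \<open>A word with zero exponent vector is a law of the abelian group \<open>B\<close>,
    so \<open>z\<close> lies in the base group.\<close>
  have "wexp (wcomm [(0, True)] [(1, True)]) i = 0" for i by (simp add: wcomm_def winv_def)
  hence "satisfies_law B (wcomm [(0, True)] [(1, True)])" by (simp add: B.satisfies_law_iff_expo_dvd)
  hence "snd z = \<one>\<^bsub>B\<^esub>"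
    unfolding z_def snd_eval_word_cartesian_wreath[OF A.is_group B.is_group \<sigma>]
    using snd' by (simp add: satisfies_law_def)
  then obtain f where z_eq: "z = (f, \<one>\<^bsub>B\<^esub>)" and f: "f \<in> carrier B \<rightarrow>\<^sub>E carrier A"
    using z by (cases z) (auto simp: carrier_cartesian_wreath)
  define h where "h = (\<lambda>x\<in>carrier B. f x [^]\<^bsub>A\<^esub> ?e)"
  have h0: "eval_word ?W \<sigma> (iter_comm_word ?e ?q 0) = (h, \<one>\<^bsub>B\<^esub>)"
    unfolding iter_comm_word.simps W.eval_wpow[OF \<sigma>] z_def[symmetric] z_eq h_def
    by (rule nat_pow_cartesian_wreath_base[OF A.is_group B.is_group f])
  have h: "h \<in> carrier B \<rightarrow>\<^sub>E carrier A" using f by (auto simp: h_def PiE_iff)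
  have "fold (wdelta A B) (map (\<lambda>i. snd (\<sigma> (i + 2)) [^]\<^bsub>B\<^esub> ?q) [0..<?r]) h = (\<lambda>x\<in>carrier B. \<one>\<^bsub>A\<^esub>)"
  proof (rule fold_wdelta_eq_one[OF A B h p(1) _ D(2)])
    fix x assume x: "x \<in> carrier B"
    have "f x \<in> carrier A" using x f by auto
    hence "h x [^]\<^bsub>A\<^esub> p = f x [^]\<^bsub>A\<^esub> expo A"
      using x p(2) by (simp add: h_def A.nat_pow_pow)
    also have "\<dots> = f x [^]\<^bsub>A\<^esub> int (expo A)" by (simp only: int_pow_int)
    also have "\<dots> = \<one>\<^bsub>A\<^esub>" using f x by (intro A.int_pow_expo) auto
    finally show "h x [^]\<^bsub>A\<^esub> p = \<one>\<^bsub>A\<^esub>" .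
  next
    have "b [^]\<^bsub>B\<^esub> expo B = \<one>\<^bsub>B\<^esub>" if "b \<in> carrier B" for b
    proof -
      have "b [^]\<^bsub>B\<^esub> int (expo B) = \<one>\<^bsub>B\<^esub>" using that by (intro B.int_pow_expo) auto
      thus ?thesis by (simp only: int_pow_int)
    qed
    thus "D \<subseteq> {d \<in> carrier B. d [^]\<^bsub>B\<^esub> p = \<one>\<^bsub>B\<^esub>}"
      using p(3) by (auto simp: D(1) B.nat_pow_pow)
    show "set (map (\<lambda>i. snd (\<sigma> (i + 2)) [^]\<^bsub>B\<^esub> ?q) [0..<?r]) \<subseteq> D"
      using snd by (auto simp: D(1))
    have "D \<noteq> {}" using D(1) B.one_closed by blast
    thus "map (\<lambda>i. snd (\<sigma> (i + 2)) [^]\<^bsub>B\<^esub> ?q) [0..<?r] \<noteq> []"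
      using D(2) p(1) by (auto simp: card_gt_0_iff prime_gt_0_nat)
  qed simp
  thus "eval_word ?W \<sigma> (iter_comm_word ?e ?q ?r) = \<one>\<^bsub>?W\<^esub>"
    using eval_iter_comm_word[OF A B \<sigma> h0 h] by (simp only: one_cartesian_wreath)
qed

text \<open>There are \<open>r + 1\<close> coordinates: coordinate \<open>r\<close> for the inner
  commutator, the coordinates below \<open>r\<close> for the outer ones. The value at the identity
  passes unchanged through the outer commutators and is \<open>m div p\<close>, which is nonzero
  modulo \<open>m\<close>.\<close>

lemma not_satisfies_law_iter_comm_word:
  fixes m n r :: nat
  assumes p: "prime p" "p dvd m" "p dvd n" and m: "m > 0" and n: "n > 0"
  defines "Z \<equiv> integer_mod_group"
  shows "\<not> satisfies_law (cartesian_wreath (Z m) (product_group {..r} (\<lambda>_. Z n))) (iter_comm_word (m div p) (n div p) r)"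
proof
  let ?A = "Z m" and ?B = "product_group {..r} (\<lambda>_. Z n)" and ?e = "m div p" and ?q = "n div p"
  let ?W = "cartesian_wreath ?A ?B"
  assume law: "satisfies_law ?W (iter_comm_word ?e ?q r)"
  have A: "comm_group ?A" by (simp add: Z_def)
  have Zc: "carrier (Z k) = {0..<int k}" if "k > 0" for k using that by (simp add: Z_def carrier_integer_mod_group)
  interpret A: unextended_comm_group ?A using A by (simp add: unextended_comm_group_def)
  have "group ?B" by (simp add: Z_def)
  hence B: "comm_group ?B"
    by (rule group.group_comm_groupI) (simp add: Z_def add.commute)
  interpret B: unextended_comm_group ?B using B by (simp add: unextended_comm_group_def)
  interpret W: unextended_group ?W
    using group_cartesian_wreath[OF A.is_group B.is_group] by (simp add: unextended_group_def)
  have p1: "p > 1" using p(1) by (rule prime_gt_1_nat)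
  have n1: "n > 1" using p n p1 by (metis dvd_imp_le le_neq_implies_less less_le_trans)
  have e: "0 < ?e" "?e < m" and q: "0 < ?q" "?q < n"
    using p m n p1 by (auto simp: dvd_imp_le div_greater_zero_iff)
  have m1: "m > 1" using e by linarith
  define u where "u k = (\<lambda>i\<in>{..r}. if i = k then 1 else 0 :: int)" for k
  have u: "u k \<in> carrier ?B" for k using n1 by (auto simp: u_def Zc)
  define \<chi> where "\<chi> l x = (x l :: int)" for l :: nat and x :: "nat \<Rightarrow> int"
  have \<chi>: "\<chi> l \<in> hom ?B (Z n)" if "l \<le> r" for l
    using that by (intro homI) (auto simp: \<chi>_def PiE_iff)
  have \<chi>u: "\<chi> l (u k [^]\<^bsub>?B\<^esub> ?q) = (if l = k then int ?q else 0)" if "l \<le> r" for l k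
  proof -
    interpret \<chi>: group_hom ?B "Z n" "\<chi> l"
      using \<chi>[OF that] B.is_group by (simp add: group_hom_def group_hom_axioms_def Z_def)
    have "\<chi> l (u k [^]\<^bsub>?B\<^esub> ?q) = \<chi> l (u k) [^]\<^bsub>Z n\<^esub> ?q" using u by (rule \<chi>.hom_nat_pow)
    thus ?thesis using that q by (auto simp: \<chi>_def u_def Z_def)
  qed
  define c where "c = (\<lambda>x\<in>carrier ?B. 0 :: int)"
  define \<delta> where "\<delta> = (\<lambda>x\<in>carrier ?B. if x = \<one>\<^bsub>?B\<^esub> then 1 else 0 :: int)"
  have c: "c \<in> carrier ?B \<rightarrow>\<^sub>E carrier ?A" using m by (auto simp: c_def Zc)
  have \<delta>: "\<delta> \<in> carrier ?B \<rightarrow>\<^sub>E carrier ?A" using m1 by (auto simp: \<delta>_def Zc)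
  \<comment> \<open>The commutator of the delta function with \<open>u r\<close> is supported at the
    identity and at \<open>u r\<close>, where all coordinates below \<open>r\<close> vanish.
    Variable \<open>i + 2\<close> receives the unit vector \<open>u i\<close>.\<close>
  define \<sigma> where "\<sigma> i = (if i = 0 then (\<delta>, \<one>\<^bsub>?B\<^esub>) else if i = 1 then (c, u r) else (c, u (i - 2)))" for i :: nat
  have \<sigma>: "\<sigma> \<in> UNIV \<rightarrow> carrier ?W"
    using c \<delta> u B.one_closed by (auto simp: \<sigma>_def carrier_cartesian_wreath simp del: carrier_product_group one_product_group)
  define f where "f = wdelta ?A ?B (u r) \<delta>"
  have f: "f \<in> carrier ?B \<rightarrow>\<^sub>E carrier ?A" unfolding f_def using A.is_group B.is_group \<delta> u by (rule wdelta_closed)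
  define h where "h = (\<lambda>x\<in>carrier ?B. f x [^]\<^bsub>?A\<^esub> ?e)"
  have h: "h \<in> carrier ?B \<rightarrow>\<^sub>E carrier ?A" using f by (auto simp: h_def PiE_iff simp del: carrier_product_group)
  have "\<sigma> i \<in> carrier ?W" for i using \<sigma> by auto
  hence "eval_word ?W \<sigma> (wcomm [(0, True)] [(1, True)]) = \<sigma> 0 \<otimes>\<^bsub>?W\<^esub> \<sigma> 1 \<otimes>\<^bsub>?W\<^esub> inv\<^bsub>?W\<^esub> (\<sigma> 0) \<otimes>\<^bsub>?W\<^esub> inv\<^bsub>?W\<^esub> (\<sigma> 1)"
    by (simp add: W.eval_wcomm[OF \<sigma>])
  also have "\<dots> = (f, \<one>\<^bsub>?B\<^esub>)"
    unfolding f_def commutator_cartesian_wreath[OF A B \<delta> c u, symmetric] by (simp add: \<sigma>_def)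
  finally have "eval_word ?W \<sigma> (wcomm [(0, True)] [(1, True)]) = (f, \<one>\<^bsub>?B\<^esub>)" .
  hence h0: "eval_word ?W \<sigma> (iter_comm_word ?e ?q 0) = (h, \<one>\<^bsub>?B\<^esub>)"
    unfolding h_def nat_pow_cartesian_wreath_base[OF A.is_group B.is_group f, symmetric]
    by (simp add: W.eval_wpow[OF \<sigma>])
  have u_ne: "u r \<noteq> \<one>\<^bsub>?B\<^esub>"
  proof
    assume "u r = \<one>\<^bsub>?B\<^esub>"
    from fun_cong[OF this, of r] show False by (simp add: u_def Z_def)
  qed
  have \<delta>1: "\<delta> x = (if x = \<one>\<^bsub>?B\<^esub> then 1 else 0)" if "x \<in> carrier ?B" for x
    using that by (simp only: \<delta>_def restrict_apply if_True)
  have inv_u: "inv\<^bsub>?B\<^esub> (u r) \<noteq> \<one>\<^bsub>?B\<^esub>" using u_ne B.inv_eq_1_iff[OF u] by simp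
  have h_one: "h \<one>\<^bsub>?B\<^esub> = int ?e"
  proof -
    have "f \<one>\<^bsub>?B\<^esub> = \<delta> \<one>\<^bsub>?B\<^esub> \<otimes>\<^bsub>?A\<^esub> inv\<^bsub>?A\<^esub> (\<delta> (inv\<^bsub>?B\<^esub> (u r)))"
      unfolding f_def wdelta_def restrict_apply using B.one_closed B.r_one[OF B.inv_closed[OF u]] by simp
    also have "\<dots> = 1"
      unfolding \<delta>1[OF B.one_closed] \<delta>1[OF B.inv_closed[OF u]] using inv_u m1 by (simp add: Z_def carrier_integer_mod_group)
    finally show ?thesis unfolding h_def restrict_apply using B.one_closed e by (simp add: Z_def)
  qed
  have supp: "\<chi> l x = \<one>\<^bsub>Z n\<^esub>" if x: "x \<in> carrier ?B" and hx: "h x \<noteq> \<one>\<^bsub>?A\<^esub>" and l: "l < r" for x l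
  proof -
    have "f x \<noteq> \<one>\<^bsub>?A\<^esub>"
    proof
      assume "f x = \<one>\<^bsub>?A\<^esub>"
      hence "h x = \<one>\<^bsub>?A\<^esub>" unfolding h_def restrict_apply if_P[OF x] by (simp only: A.nat_pow_one)
      thus False using hx by contradiction
    qed
    moreover have "f x = \<delta> x \<otimes>\<^bsub>?A\<^esub> inv\<^bsub>?A\<^esub> (\<delta> (inv\<^bsub>?B\<^esub> (u r) \<otimes>\<^bsub>?B\<^esub> x))"
      unfolding f_def wdelta_def restrict_apply if_P[OF x] ..
    ultimately have "\<delta> x \<noteq> 0 \<or> \<delta> (inv\<^bsub>?B\<^esub> (u r) \<otimes>\<^bsub>?B\<^esub> x) \<noteq> 0"
      using m by (auto simp: Z_def carrier_integer_mod_group)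
    hence "x = \<one>\<^bsub>?B\<^esub> \<or> inv\<^bsub>?B\<^esub> (u r) \<otimes>\<^bsub>?B\<^esub> x = \<one>\<^bsub>?B\<^esub>"
      unfolding \<delta>1[OF x] \<delta>1[OF B.m_closed[OF B.inv_closed[OF u] x]] by presburger
    hence "x = \<one>\<^bsub>?B\<^esub> \<or> x = u r"
      using x u B.inv_equality[of "inv\<^bsub>?B\<^esub> (u r)" x] by (metis B.inv_closed B.inv_equality B.inv_inv B.l_inv B.r_inv)
    thus ?thesis using l by (auto simp: \<chi>_def u_def Z_def)
  qed
  \<comment> \<open>A homomorphism is demanded for every index, but coordinate maps are
    homomorphisms only up to \<open>r\<close>; larger indices get coordinate
    \<open>r\<close>.\<close>
  define \<chi>' where "\<chi>' l = (if l < r then \<chi> l else \<chi> r)" for l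
  have "fold (wdelta ?A ?B) (map (\<lambda>i. snd (\<sigma> (i + 2)) [^]\<^bsub>?B\<^esub> ?q) [0..<r]) h \<one>\<^bsub>?B\<^esub> = h \<one>\<^bsub>?B\<^esub>"
  proof (rule fold_wdelta_at_one[where \<chi> = \<chi>' and C = "Z n" and r = r, THEN conjunct1])
    show "group ?A" "group ?B" "group (Z n)" by (rule A.is_group B.is_group group_integer_mod_group[of n, folded Z_def])+
    show "h \<in> carrier ?B \<rightarrow>\<^sub>E carrier ?A" by (rule h)
    show "snd (\<sigma> (i + 2)) [^]\<^bsub>?B\<^esub> ?q \<in> carrier ?B" for i using B.nat_pow_closed[OF u] by (simp only: \<sigma>_def) simp
    show "\<chi>' l \<in> hom ?B (Z n)" for l using \<chi> by (simp add: \<chi>'_def)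
    show "\<chi>' i (snd (\<sigma> (i + 2)) [^]\<^bsub>?B\<^esub> ?q) \<noteq> \<one>\<^bsub>Z n\<^esub>" if "i < r" for i
      using that \<chi>u[of i i] q by (simp add: \<chi>'_def \<sigma>_def Z_def)
    show "\<chi>' l (snd (\<sigma> (i + 2)) [^]\<^bsub>?B\<^esub> ?q) = \<one>\<^bsub>Z n\<^esub>" if "i < l" "l < r" for i l
      using that \<chi>u[of l i] by (simp add: \<chi>'_def \<sigma>_def Z_def)
    show "\<chi>' l x = \<one>\<^bsub>Z n\<^esub>" if "x \<in> carrier ?B" "h x \<noteq> \<one>\<^bsub>?A\<^esub>" "l < r" for x l
      using supp[OF that] that(3) by (simp add: \<chi>'_def)
  qed simp
  moreover have "eval_word ?W \<sigma> (iter_comm_word ?e ?q r) = \<one>\<^bsub>?W\<^esub>"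
    using law \<sigma> by (simp add: satisfies_law_def)
  hence "fold (wdelta ?A ?B) (map (\<lambda>i. snd (\<sigma> (i + 2)) [^]\<^bsub>?B\<^esub> ?q) [0..<r]) h = (\<lambda>x\<in>carrier ?B. \<one>\<^bsub>?A\<^esub>)"
    unfolding eval_iter_comm_word[OF A B \<sigma> h0 h] one_cartesian_wreath by simp
  ultimately have "h \<one>\<^bsub>?B\<^esub> = \<one>\<^bsub>?A\<^esub>" using B.one_closed by (simp only: restrict_apply if_True)
  thus False using h_one e by (simp add: Z_def)
qed

section \<open>Exponents of the test groups and isomorphic copies\<close>

lemma expo_pos_iff: "expo G > 0 \<longleftrightarrow> finite_exponent G"
proof -
  have "group_exponent G > 0" if "finite_exponent G"
    using LeastI_ex[OF that[unfolded finite_exponent_def]] by (simp add: group_exponent_def)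
  thus ?thesis by (auto simp: expo_def)
qed

lemma expo_eqI:
  assumes "group G" and m: "\<And>k::int. (\<forall>x\<in>carrier G. x [^]\<^bsub>G\<^esub> k = \<one>\<^bsub>G\<^esub>) \<longleftrightarrow> int m dvd k"
  shows "expo G = m"
proof -
  interpret unextended_group G using assms(1) by (simp add: unextended_group_def)
  have "int (expo G) dvd k \<longleftrightarrow> int m dvd k" for k using m expo_dvd_iff by blast
  from this[of "int m"] this[of "int (expo G)"] show ?thesis by (simp add: dvd_antisym)
qed

lemma expo_integer_mod_group:
  assumes "n > 0"
  shows "expo (integer_mod_group n) = n"
proof (rule expo_eqI)
  fix k :: int
  show "(\<forall>x\<in>carrier (integer_mod_group n). x [^]\<^bsub>integer_mod_group n\<^esub> k = \<one>\<^bsub>integer_mod_group n\<^esub>) \<longleftrightarrow> int n dvd k"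
  \<comment> \<open>For \<open>n = 1\<close> the number 1 is not in the carrier and cannot serve as
    generator.\<close>
  proof (cases "n = 1")
    case False
    hence "1 \<in> carrier (integer_mod_group n)" by simp
    thus ?thesis by (auto simp: int_pow_integer_mod_group dvd_eq_mod_eq_0 dest: bspec[of _ _ 1] intro: mod_0_imp_dvd)
  qed (simp add: int_pow_integer_mod_group)
qed simp

lemma expo_product_group_const:
  fixes G :: "'a monoid"
  assumes G: "group G" and I: "i \<in> I"
  shows "expo (product_group I (\<lambda>_. G)) = expo G"
proof (rule expo_eqI)
  interpret G: unextended_group G using G by (simp add: unextended_group_def)
  let ?P = "product_group I (\<lambda>_. G)"
  show P: "group ?P" using G by simp
  have hom: "(\<lambda>x. x j) \<in> hom ?P G" if "j \<in> I" for j
    using that by (intro homI) auto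
  have pow: "(x [^]\<^bsub>?P\<^esub> k) j = x j [^]\<^bsub>G\<^esub> k" if "x \<in> carrier ?P" "j \<in> I" for x j and k :: int
    using hom_int_pow[OF hom[OF that(2)] that(1) P G] .
  fix k :: int
  show "(\<forall>x\<in>carrier ?P. x [^]\<^bsub>?P\<^esub> k = \<one>\<^bsub>?P\<^esub>) \<longleftrightarrow> int (expo G) dvd k"
    unfolding G.expo_dvd_iff[symmetric]
  proof (intro iffI ballI)
    fix a assume *: "\<forall>x\<in>carrier ?P. x [^]\<^bsub>?P\<^esub> k = \<one>\<^bsub>?P\<^esub>" and a: "a \<in> carrier G"
    have "(\<lambda>j\<in>I. a) \<in> carrier ?P" using a by simp
    with * pow[OF this I, of k] I show "a [^]\<^bsub>G\<^esub> k = \<one>\<^bsub>G\<^esub>" by simp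
  next
    fix x assume *: "\<forall>a\<in>carrier G. a [^]\<^bsub>G\<^esub> k = \<one>\<^bsub>G\<^esub>" and x: "x \<in> carrier ?P"
    have "x [^]\<^bsub>?P\<^esub> k \<in> carrier ?P" using P x by (rule group.int_pow_closed)
    moreover have "(x [^]\<^bsub>?P\<^esub> k) j = \<one>\<^bsub>G\<^esub>" if "j \<in> I" for j
      using pow[OF x that, of k] * x that by auto
    ultimately show "x [^]\<^bsub>?P\<^esub> k = \<one>\<^bsub>?P\<^esub>"
      by (intro extensionalityI[of _ I]) (auto simp: PiE_iff)
  qed
qed

lemma generated_variety_eq_if_expo_eq:
  assumes "comm_group A" "comm_group A'" "expo A = expo A'"
  shows "generated_variety A = generated_variety A'"
proof -
  interpret A: unextended_comm_group A using assms(1) by (simp add: unextended_comm_group_def)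
  interpret A': unextended_comm_group A' using assms(2) by (simp add: unextended_comm_group_def)
  show ?thesis
    by (auto simp: generated_variety_iff_laws[OF A.is_group] generated_variety_iff_laws[OF A'.is_group]
        A.satisfies_law_iff_expo_dvd A'.satisfies_law_iff_expo_dvd assms(3))
qed

lemma satisfies_law_iso:
  assumes "group G" "group H" and \<phi>: "\<phi> \<in> iso G H"
  shows "satisfies_law H w \<longleftrightarrow> satisfies_law G w"
proof -
  interpret G: unextended_group G using assms(1) by (simp add: unextended_group_def)
  interpret \<phi>: group_hom G H \<phi>
    using assms by (simp add: group_hom_def group_hom_axioms_def iso_def)
  have hom: "\<phi> \<in> hom G H" and bij: "bij_betw \<phi> (carrier G) (carrier H)" using \<phi> by (auto simp: iso_def)
  show ?thesis
    unfolding satisfies_law_def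
  proof (intro iffI ballI)
    fix \<tau> :: "nat \<Rightarrow> _" assume *: "\<forall>\<sigma>\<in>UNIV \<rightarrow> carrier H. eval_word H \<sigma> w = \<one>\<^bsub>H\<^esub>" and \<tau>: "\<tau> \<in> UNIV \<rightarrow> carrier G"
    have "\<phi> \<circ> \<tau> \<in> UNIV \<rightarrow> carrier H" using \<tau> by (auto simp: Pi_iff)
    from bspec[OF * this] have "\<phi> (eval_word G \<tau> w) = \<phi> \<one>\<^bsub>G\<^esub>"
      by (simp only: G.eval_word_hom[OF hom assms(2) \<tau>] \<phi>.hom_one)
    thus "eval_word G \<tau> w = \<one>\<^bsub>G\<^esub>"
      by (rule inj_onD[OF bij_betw_imp_inj_on[OF bij]]) (use \<tau> in simp_all)
  next
    fix \<sigma> :: "nat \<Rightarrow> _" assume *: "\<forall>\<tau>\<in>UNIV \<rightarrow> carrier G. eval_word G \<tau> w = \<one>\<^bsub>G\<^esub>" and \<sigma>: "\<sigma> \<in> UNIV \<rightarrow> carrier H"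
    define \<tau> where "\<tau> = inv_into (carrier G) \<phi> \<circ> \<sigma>"
    have "\<sigma> i \<in> \<phi> ` carrier G" for i using bij \<sigma> by (auto simp: bij_betw_def)
    hence \<tau>: "\<tau> \<in> UNIV \<rightarrow> carrier G" "\<phi> \<circ> \<tau> = \<sigma>"
      by (auto simp: \<tau>_def fun_eq_iff inv_into_into f_inv_into_f)
    show "eval_word H \<sigma> w = \<one>\<^bsub>H\<^esub>"
      using * \<tau> G.eval_word_hom[OF hom assms(2) \<tau>(1)] by simp
  qed
qed

text \<open>The variety is a set at the arbitrary infinite type \<open>'h\<close>, so a witness has
  to be transported to that type; finiteness makes this possible.\<close>

lemma ex_iso_copy:
  fixes G :: "'g monoid"
  assumes "group G" "finite (carrier G)" "infinite (UNIV :: 'h set)"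
  shows "\<exists>(H :: 'h monoid) \<phi>. group H \<and> \<phi> \<in> iso G H"
proof -
  interpret group G by fact
  obtain S :: "'h set" where S: "finite S" "card S = card (carrier G)"
    using infinite_arbitrarily_large[OF assms(3)] by blast
  then obtain \<phi> :: "'g \<Rightarrow> 'h" where \<phi>: "inj_on \<phi> (carrier G)" using card_le_inj[OF assms(2) S(1)] by auto
  show ?thesis
    using inj_imp_image_group_is_group[OF \<phi>] inj_imp_image_group_iso[OF \<phi>]
    by (intro exI[of _ "image_group \<phi> G"] exI[of _ \<phi>] conjI)
qed

section \<open>The two directions of the equivalence\<close>

text \<open>\<open>cond\<close> serves the inclusion of the product variety: it turns a law of
  \<open>W\<close> into the congruences on Fox derivatives that make the law hold in every
  extension.\<close>

lemma product_variety_eq_if_torsion_factors_infinite: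
  fixes A :: "'a monoid" and B :: "'b monoid" and W :: "(('b \<Rightarrow> 'a) \<times> 'b) monoid"
  assumes A: "comm_group A" and B: "comm_group B"
    and W: "W = cartesian_wreath A B \<or> W = direct_wreath A B"
    and cond: "expo A = 0 \<or> expo B = 0 \<or> (\<forall>p. prime p \<and> p dvd expo A \<and> p dvd expo B \<longrightarrow>
      infinite (carrier (torsion_factor B (p ^ multiplicity p (expo B)) (p ^ (multiplicity p (expo B) - 1)))))"
  shows "(generated_variety W :: 'h monoid set) = product_variety (generated_variety A) (generated_variety B)"
proof -
  have AB: "group A" "group B" using A B by (simp_all add: comm_group_def)
  note laws = generated_variety_iff_laws[OF group_wreath[OF AB W]]
  show ?thesis
  proof (intro equalityI subsetI)
    fix H :: "'h monoid" assume "H \<in> generated_variety W"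
    thus "H \<in> product_variety (generated_variety A) (generated_variety B)"
      using in_product_variety_if_wreath_laws[OF AB] satisfies_law_wreath[OF AB W] unfolding laws by blast
  next
    fix H :: "'h monoid" assume "H \<in> product_variety (generated_variety A) (generated_variety B)"
    then obtain N where H: "group H" and N: "N \<lhd> H" and HN: "H\<lparr>carrier := N\<rparr> \<in> generated_variety A"
      and HQ: "H Mod N \<in> generated_variety B" unfolding product_variety_def by blast
    have "satisfies_law H w" if w: "satisfies_law W w" for w
    proof -
      obtain r where r: "fst ` set w \<subseteq> {..<r}"
        by (metis finite_imageI finite_set finite_nat_iff_bounded)
      note C = expo_dvd_scount_fox_mod[OF A B W w r cond]
      show ?thesis
      proof (rule satisfies_law_extension[OF H N _ _ _ _ r C(2) C(1)])
        show "comm_group (H\<lparr>carrier := N\<rparr>)" by (rule generated_variety_comm_group(1)[OF A HN])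
        show "comm_group (H Mod N)" by (rule generated_variety_comm_group(1)[OF B HQ])
        show "x [^]\<^bsub>H\<lparr>carrier := N\<rparr>\<^esub> int (expo A) = \<one>\<^bsub>H\<^esub>" if "x \<in> N" for x
          using generated_variety_comm_group(2)[OF A HN, of x] that by simp
        show "x [^]\<^bsub>H Mod N\<^esub> int (expo B) = \<one>\<^bsub>H Mod N\<^esub>" if "x \<in> carrier (H Mod N)" for x
          using generated_variety_comm_group(2)[OF B HQ that] .
      qed
    qed
    thus "H \<in> generated_variety W" using H unfolding laws by blast
  qed
qed

lemma product_variety_neq_if_torsion_factor_finite:
  fixes A :: "'a monoid" and B :: "'b monoid" and W :: "(('b \<Rightarrow> 'a) \<times> 'b) monoid"
  assumes A: "comm_group A" and B: "comm_group B"
    and W: "W = cartesian_wreath A B \<or> W = direct_wreath A B" and inf: "infinite (UNIV :: 'h set)"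
    and m: "expo A > 0" and n: "expo B > 0" and p: "prime p" "p dvd expo A" "p dvd expo B"
    and fin: "finite (carrier (torsion_factor B (p ^ multiplicity p (expo B)) (p ^ (multiplicity p (expo B) - 1))))"
  shows "(generated_variety W :: 'h monoid set) \<noteq> product_variety (generated_variety A) (generated_variety B)"
proof
  assume eq: "(generated_variety W :: 'h monoid set) = product_variety (generated_variety A) (generated_variety B)"
  interpret B: unextended_comm_group B using B by (simp add: unextended_comm_group_def)
  have AB: "group A" "group B" using A B by (simp_all add: comm_group_def)
  let ?m = "expo A" and ?n = "expo B" and ?k = "multiplicity p (expo B)"
  define D where "D = (\<lambda>b. b [^]\<^bsub>B\<^esub> (?n div p)) ` carrier B"
  \<comment> \<open>The power \<open>?n div p\<close> of \<open>b\<close> is the power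
    \<open>p ^ (?k - 1)\<close> of \<open>b [^] n'\<close>, which lies in B[p^k]; such powers
    correspond to the elements of the finite torsion factor.\<close>
  have "finite D"
  proof (rule finite_subset)
    show "finite ((\<lambda>b. b [^]\<^bsub>B\<^esub> (p ^ (?k - 1))) ` {b \<in> carrier B. b [^]\<^bsub>B\<^esub> (p ^ ?k) = \<one>\<^bsub>B\<^esub>})"
      using fin B.infinite_torsion_factor_iff by blast
    have k: "?k > 0" using p n by (simp add: prime_multiplicity_gt_zero_iff)
    obtain n' where n': "?n = p ^ ?k * n'" using multiplicity_dvd by blast
    have n1: "n' * p ^ ?k = ?n" using n' by (simp add: mult.commute)
    have "?n = p * (n' * p ^ (?k - 1))"
      using n' k by (metis mult.commute mult.left_commute power_eq_if not_gr0)
    hence n2: "?n div p = n' * p ^ (?k - 1)" using p(1) by (metis nonzero_mult_div_cancel_left not_prime_0)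
    show "D \<subseteq> (\<lambda>b. b [^]\<^bsub>B\<^esub> (p ^ (?k - 1))) ` {b \<in> carrier B. b [^]\<^bsub>B\<^esub> (p ^ ?k) = \<one>\<^bsub>B\<^esub>}"
      unfolding D_def
    proof (rule image_subsetI)
      fix b assume b: "b \<in> carrier B"
      have "b [^]\<^bsub>B\<^esub> int ?n = \<one>\<^bsub>B\<^esub>" using b by (intro B.int_pow_expo) auto
      hence "b [^]\<^bsub>B\<^esub> ?n = \<one>\<^bsub>B\<^esub>" by (simp only: int_pow_int)
      hence "(b [^]\<^bsub>B\<^esub> n') [^]\<^bsub>B\<^esub> (p ^ ?k) = \<one>\<^bsub>B\<^esub>" using b by (simp only: B.nat_pow_pow n1)
      moreover have "b [^]\<^bsub>B\<^esub> (?n div p) = (b [^]\<^bsub>B\<^esub> n') [^]\<^bsub>B\<^esub> (p ^ (?k - 1))"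
        using b by (simp only: B.nat_pow_pow n2)
      ultimately show "b [^]\<^bsub>B\<^esub> (?n div p) \<in> (\<lambda>b. b [^]\<^bsub>B\<^esub> (p ^ (?k - 1))) ` {b \<in> carrier B. b [^]\<^bsub>B\<^esub> (p ^ ?k) = \<one>\<^bsub>B\<^esub>}"
        using b by (intro image_eqI[of _ _ "b [^]\<^bsub>B\<^esub> n'"]) auto
    qed
  qed
  define r where "r = card D * p"
  define w where "w = iter_comm_word (?m div p) (?n div p) r"
  have w: "satisfies_law W w"
    unfolding w_def r_def
    by (intro satisfies_law_wreath[OF AB W] satisfies_law_iter_comm_word[OF A B p m n D_def \<open>finite D\<close>])
  \<comment> \<open>These groups have the exponents of \<open>A\<close> and \<open>B\<close>, hence
    generate the same varieties, while the second has the \<open>r + 1\<close> independent elements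
    that \<open>B\<close> may lack.\<close>
  let ?A = "integer_mod_group ?m" and ?B = "product_group {..r} (\<lambda>_. integer_mod_group ?n)"
  let ?X = "cartesian_wreath ?A ?B"
  have A': "comm_group ?A" by simp
  have B': "comm_group ?B"
    by (rule group.group_comm_groupI) (simp_all add: add.commute)
  have AB': "group ?A" "group ?B" by simp_all
  have X: "group ?X" by (rule group_cartesian_wreath[OF AB'])
  have "finite (carrier ?B)" using n by (simp add: carrier_integer_mod_group finite_PiE)
  hence "finite (carrier ?X)"
    unfolding carrier_cartesian_wreath using m by (intro finite_cartesian_product finite_PiE) (simp_all add: carrier_integer_mod_group)
  from ex_iso_copy[OF X this inf] obtain H :: "'h monoid" and \<phi> where H: "group H" "\<phi> \<in> iso ?X H" by blast
  \<comment> \<open>A copy of the wreath product satisfies the laws of the wreath product, which is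
    all that membership asks for.\<close>
  have "H \<in> product_variety (generated_variety ?A) (generated_variety ?B)"
    using in_product_variety_if_wreath_laws[OF AB' H(1)] satisfies_law_iso[OF X H] by blast
  moreover have "expo ?A = ?m" "expo ?B = ?n"
    using expo_integer_mod_group[OF m] expo_integer_mod_group[OF n] by (simp_all add: expo_product_group_const[of _ 0])
  hence "(generated_variety ?A :: 'h monoid set) = generated_variety A"
    "(generated_variety ?B :: 'h set monoid set) = generated_variety B"
    by (intro generated_variety_eq_if_expo_eq A A' B B'; simp)+
  ultimately have "H \<in> generated_variety W" using eq by simp
  hence "satisfies_law H w" using w generated_variety_iff_laws[OF group_wreath[OF AB W], of H] by blast
  hence "satisfies_law ?X w" using satisfies_law_iso[OF X H] by blast
  thus False using not_satisfies_law_iter_comm_word[OF p m n, of r] by (simp only: w_def)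
qed

theorem theorem6p1:
  fixes A :: "'a monoid" and B :: "'b monoid" and W :: "(('b \<Rightarrow> 'a) \<times> 'b) monoid"
  assumes "comm_group A" and "comm_group B"
    and "W = cartesian_wreath A B \<or> W = direct_wreath A B"
    and "infinite (UNIV :: 'h set)"
  shows "((generated_variety W :: 'h monoid set) =
           product_variety (generated_variety A) (generated_variety B)) \<longleftrightarrow>
         (\<not> finite_exponent A \<or> \<not> finite_exponent B) \<or>
         (finite_exponent A \<and> finite_exponent B \<and>
           (\<forall>p. Factorial_Ring.prime p \<and> p dvd group_exponent A \<and> p dvd group_exponent B \<longrightarrow>
             (let k = multiplicity p (group_exponent B)
              in infinite (carrier (torsion_factor B (p ^ k) (p ^ (k - 1)))))))"
proof -
  have expo: "expo G = group_exponent G" if "finite_exponent G" for G :: "'g monoid"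
    using that by (simp add: expo_def)
  show ?thesis
  proof (cases "finite_exponent A \<and> finite_exponent B")
    case True
    \<comment> \<open>Positivity excludes the disjuncts of the sufficient condition in which an
      exponent is 0, and meets the assumptions of the negative direction.\<close>
    have "group_exponent A > 0" "group_exponent B > 0"
      using True expo_pos_iff[of A] expo_pos_iff[of B] by (simp_all add: expo_def)
    thus ?thesis
      using True product_variety_eq_if_torsion_factors_infinite[OF assms(1-3)]
        product_variety_neq_if_torsion_factor_finite[OF assms]
      unfolding Let_def expo[OF conjunct1[OF True]] expo[OF conjunct2[OF True]] by blast
  next
    case False
    hence "expo A = 0 \<or> expo B = 0" by (auto simp: expo_def)
    thus ?thesis using product_variety_eq_if_torsion_factors_infinite[OF assms(1-3)] False by blast
  qed
qed

end
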